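(* Let $r\in\mathbb{N}$ with $r\ge2$. Let $(X,g)$ be a connected and complete Riemannian Banach manifold and let $F\in C^1(X^r)$ be a real-valued function which is bounded from below. Assume that $(F,g^r)$ satisfies the Palais-Smale condition, where $g^r$ denotes the product metric of $g$ on $X^r$, and that $F(\mathrm{Crit}\, F)\subset\mathbb{R}$ is discrete. Then $$\mathsf{TC}_{r,X}(F^\lambda) \leq \sum_{\mu \in (-\infty,\lambda]} \max \{\mathsf{TC}_{r,X}(C) \mid C \in \mathcal{C}_\mu (F)\}\qquad \text{for all } \lambda \in \mathbb{R}.$$
   Context: For a function $F\colon Y\to\mathbb{R}$ put $F^\lambda=\{y\mid F(y)\le\lambda\}$ and $F_\mu=\{y\mid F(y)=\mu\}$. For differentiable $F$ on a manifold, $\mathrm{Crit}\,F=\{y\mid DF_y=0\}$ and $\mathcal{C}_\mu(F)$ is the set of connected components of $F_\mu\cap\mathrm{Crit}\,F$. Palais-Smale condition: for a complete Riemannian Banach manifold $(M,g)$ and $F\in C^1(M)$, the pair $(F,g)$ satisfies the Palais-Smale (PS) condition if every sequence $(x_n)$ in $M$ for which $(|F(x_n)|)$ is bounded and $\lim_{n\to\infty}\nabla^gF(x_n)=0$ has a convergent subsequence; $\nabla^gF$ is the gradient of $F$ with respect to $g$. Sequential subspace complexity: for a path-connected space $X$ and $r\ge2$ let $PX=C^0([0,1],X)$ with the compact-open topology and let $p_r\colon PX\to X^r$, $p_r(\gamma)=(\gamma(0),\gamma(\tfrac1{r-1}),\dots,\gamma(\tfrac{r-2}{r-1}),\gamma(1))$.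 For $A\subset X^r$, $\mathsf{TC}_{r,X}(A)$ is the minimal $n$ for which there exist open subsets $U_1,\dots,U_n\subset X^r$ with $A\subset\bigcup_{i=1}^nU_i$ such that each $U_i$ admits a continuous local section $s_i\colon U_i\to PX$ of $p_r$; if no such $n$ exists, $\mathsf{TC}_{r,X}(A)=\infty$. Convention: the maximum over an empty set is $0$. *)

theory Defs
  imports "HOL-Analysis.Analysis"
begin

section \<open>Smooth maps between Banach spaces\<close>

text \<open>
  \<open>D x [v1, ..., vn]\<close> is the value of the n-th Frechet derivative of \<open>f\<close> at \<open>x\<close> on
  \<open>(v1, ..., vn)\<close>.  Lists make it possible to speak about the derivatives of all orders at once:
  each \<open>D x\<close> restricted to lists of length \<open>n\<close> is a bounded \<open>n\<close>-linear form, and the last clause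
  says that the derivative of order \<open>n + 1\<close> is the Frechet derivative, with respect to the norm of
  bounded \<open>n\<close>-linear maps, of the derivative of order \<open>n\<close>.
\<close>

definition smooth_on :: "'a::real_normed_vector set \<Rightarrow> ('a \<Rightarrow> 'b::real_normed_vector) \<Rightarrow> bool" where
  "smooth_on U f \<longleftrightarrow> open U \<and>
     (\<exists>D :: 'a \<Rightarrow> 'a list \<Rightarrow> 'b. \<forall>x\<in>U.
        D x [] = f x \<and>
        (\<forall>us ws. linear (\<lambda>v. D x (us @ v # ws))) \<and>
        (\<forall>n. \<exists>K. \<forall>vs. length vs = n \<longrightarrow> norm (D x vs) \<le> K * prod_list (map norm vs)) \<and>
        (\<forall>n. \<forall>\<epsilon>>0. \<exists>\<delta>>0. \<forall>h. norm h < \<delta> \<longrightarrow> (\<forall>vs. length vs = n \<longrightarrow>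
            norm (D (x + h) vs - D x vs - D x (h # vs)) \<le> \<epsilon> * norm h * prod_list (map norm vs))))"

section \<open>Banach manifolds\<close>

text \<open>
  The points of a manifold form a type \<open>'m\<close> carrying the manifold topology; \<open>'e\<close> is the Banach
  space it is modelled on.  An atlas is a family of charts indexed by a set of indices; the values
  of a chart outside its domain are irrelevant.
\<close>

record ('c, 'm, 'e) atlas =
  indices :: "'c set"
  cdom :: "'c \<Rightarrow> 'm set"
  chart :: "'c \<Rightarrow> 'm \<Rightarrow> 'e"

definition chart_inv :: "('c, 'm, 'e) atlas \<Rightarrow> 'c \<Rightarrow> 'e \<Rightarrow> 'm" where
  "chart_inv A c = inv_into (cdom A c) (chart A c)"

definition chart_image :: "('c, 'm, 'e) atlas \<Rightarrow> 'c \<Rightarrow> 'e set" where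
  "chart_image A c = chart A c ` cdom A c"

definition transition :: "('c, 'm, 'e) atlas \<Rightarrow> 'c \<Rightarrow> 'c \<Rightarrow> 'e \<Rightarrow> 'e" where
  "transition A c c' = chart A c' \<circ> chart_inv A c"

text \<open>The Hausdorff axiom is imposed by the sort of \<open>'m\<close>.\<close>

definition banach_manifold :: "('c, 'm::t2_space, 'e::banach) atlas \<Rightarrow> bool" where
  "banach_manifold A \<longleftrightarrow>
     (\<Union>c\<in>indices A. cdom A c) = UNIV \<and>
     (\<forall>c\<in>indices A. open (cdom A c) \<and> open (chart_image A c) \<and>
        homeomorphism (cdom A c) (chart_image A c) (chart A c) (chart_inv A c)) \<and>
     (\<forall>c\<in>indices A. \<forall>c'\<in>indices A.
        smooth_on (chart A c ` (cdom A c \<inter> cdom A c')) (transition A c c'))"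

definition chart_at :: "('c, 'm, 'e) atlas \<Rightarrow> 'm \<Rightarrow> 'c" where
  "chart_at A x = (SOME c. c \<in> indices A \<and> x \<in> cdom A c)"

section \<open>Riemannian metrics\<close>

text \<open>
  Tangent vectors at \<open>x\<close> are given by their representatives in \<open>'e\<close> with respect to the charts
  around \<open>x\<close>, which transform by the derivatives of the transition maps.  Accordingly a metric is
  given by its local representatives: \<open>g c x v w\<close> is the inner product of the tangent vectors at
  \<open>x\<close> represented by \<open>v\<close> and \<open>w\<close> in the chart \<open>c\<close>.  The metric is strong, that is, each inner
  product induces the topology of the tangent space: boundedness of the form is part of the
  smoothness clause, and the lower bound is the last clause.
\<close>

type_synonym ('c, 'm, 'e) metric_rep = "'c \<Rightarrow> 'm \<Rightarrow> 'e \<Rightarrow> 'e \<Rightarrow> real"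

definition riemannian_metric ::
    "('c, 'm::t2_space, 'e::banach) atlas \<Rightarrow> ('c, 'm, 'e) metric_rep \<Rightarrow> bool" where
  "riemannian_metric A g \<longleftrightarrow>
     (\<forall>c\<in>indices A. \<exists>G :: 'e \<Rightarrow> 'e \<Rightarrow>\<^sub>L 'e \<Rightarrow>\<^sub>L real. smooth_on (chart_image A c) G \<and>
        (\<forall>x\<in>cdom A c. \<forall>v w. g c x v w = blinfun_apply (blinfun_apply (G (chart A c x)) v) w)) \<and>
     (\<forall>c\<in>indices A. \<forall>c'\<in>indices A. \<forall>x\<in>cdom A c \<inter> cdom A c'. \<forall>v w.
        g c x v w = (let T = frechet_derivative (transition A c c') (at (chart A c x))
                     in g c' x (T v) (T w))) \<and>
     (\<forall>c\<in>indices A. \<forall>x\<in>cdom A c.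
        (\<forall>v w. g c x v w = g c x w v) \<and>
        (\<exists>\<delta>>0. \<forall>v. g c x v v \<ge> \<delta> * (norm v)\<^sup>2))"

subsection \<open>The Riemannian distance and completeness\<close>

definition C1_curve_on ::
    "('c, 'm::topological_space, 'e::real_normed_vector) atlas \<Rightarrow> (real \<Rightarrow> 'm) \<Rightarrow> real \<Rightarrow> real \<Rightarrow> bool" where
  "C1_curve_on A \<gamma> a b \<longleftrightarrow> continuous_on {a..b} \<gamma> \<and>
     (\<forall>c\<in>indices A. \<exists>v. continuous_on {t\<in>{a..b}. \<gamma> t \<in> cdom A c} v \<and>
        (\<forall>t\<in>{a..b}. \<gamma> t \<in> cdom A c \<longrightarrow>
           ((\<lambda>s. chart A c (\<gamma> s)) has_vector_derivative v t) (at t within {a..b})))"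

definition piecewise_C1_curve ::
    "('c, 'm::topological_space, 'e::real_normed_vector) atlas \<Rightarrow> (real \<Rightarrow> 'm) \<Rightarrow> bool" where
  "piecewise_C1_curve A \<gamma> \<longleftrightarrow>
     (\<exists>S. finite S \<and> S \<subseteq> {0..1} \<and> 0 \<in> S \<and> 1 \<in> S \<and>
        (\<forall>a\<in>S. \<forall>b\<in>S. a < b \<and> S \<inter> {a<..<b} = {} \<longrightarrow> C1_curve_on A \<gamma> a b))"

definition speed ::
    "('c, 'm, 'e::real_normed_vector) atlas \<Rightarrow> ('c, 'm, 'e) metric_rep \<Rightarrow> (real \<Rightarrow> 'm) \<Rightarrow> real \<Rightarrow> real" where
  "speed A g \<gamma> t =
     (let c = chart_at A (\<gamma> t);
          v = vector_derivative (\<lambda>s. chart A c (\<gamma> s)) (at t within {0..1})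
      in sqrt (g c (\<gamma> t) v v))"

definition riemannian_dist ::
    "('c, 'm::topological_space, 'e::real_normed_vector) atlas \<Rightarrow> ('c, 'm, 'e) metric_rep \<Rightarrow> 'm \<Rightarrow> 'm \<Rightarrow> ereal" where
  "riemannian_dist A g x y =
     (INF \<gamma>\<in>{\<gamma>. piecewise_C1_curve A \<gamma> \<and> \<gamma> 0 = x \<and> \<gamma> 1 = y}. ereal (integral {0..1} (speed A g \<gamma>)))"

definition complete_riemannian ::
    "('c, 'm::topological_space, 'e::real_normed_vector) atlas \<Rightarrow> ('c, 'm, 'e) metric_rep \<Rightarrow> bool" where
  "complete_riemannian A g \<longleftrightarrow>
     (\<forall>x :: nat \<Rightarrow> 'm.
        (\<forall>\<epsilon>>0. \<exists>N. \<forall>m\<ge>N. \<forall>n\<ge>N. riemannian_dist A g (x m) (x n) < ereal \<epsilon>) \<longrightarrow>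
        (\<exists>l. (\<lambda>n. riemannian_dist A g (x n) l) \<longlonglongrightarrow> 0))"

subsection \<open>Finite powers\<close>

definition power_atlas :: "('c, 'm, 'e) atlas \<Rightarrow> ('c ^ 'r, 'm ^ 'r, 'e ^ 'r) atlas" where
  "power_atlas A =
     \<lparr> indices = {c. \<forall>i. c $ i \<in> indices A},
       cdom = (\<lambda>c. {x. \<forall>i. x $ i \<in> cdom A (c $ i)}),
       chart = (\<lambda>c x. \<chi> i. chart A (c $ i) (x $ i)) \<rparr>"

definition power_metric :: "('c, 'm, 'e) metric_rep \<Rightarrow> ('c ^ 'r::finite, 'm ^ 'r, 'e ^ 'r) metric_rep" where
  "power_metric g = (\<lambda>c x v w. \<Sum>i\<in>UNIV. g (c $ i) (x $ i) (v $ i) (w $ i))"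

section \<open>Differentiable functions, critical points and the Palais-Smale condition\<close>

definition C1_function ::
    "('c, 'm, 'e::real_normed_vector) atlas \<Rightarrow> ('m \<Rightarrow> real) \<Rightarrow> bool" where
  "C1_function A F \<longleftrightarrow>
     (\<forall>c\<in>indices A. \<exists>F' :: 'e \<Rightarrow> 'e \<Rightarrow>\<^sub>L real. continuous_on (chart_image A c) F' \<and>
        (\<forall>y\<in>chart_image A c. (F \<circ> chart_inv A c has_derivative blinfun_apply (F' y)) (at y)))"

definition chart_deriv ::
    "('c, 'm, 'e::real_normed_vector) atlas \<Rightarrow> ('m \<Rightarrow> real) \<Rightarrow> 'c \<Rightarrow> 'm \<Rightarrow> 'e \<Rightarrow> real" where
  "chart_deriv A F c x = frechet_derivative (F \<circ> chart_inv A c) (at (chart A c x))"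

definition Crit :: "('c, 'm, 'e::real_normed_vector) atlas \<Rightarrow> ('m \<Rightarrow> real) \<Rightarrow> 'm set" where
  "Crit A F = {x. \<forall>c\<in>indices A. x \<in> cdom A c \<longrightarrow> chart_deriv A F c x = (\<lambda>v. 0)}"

definition gradient ::
    "('c, 'm, 'e::real_normed_vector) atlas \<Rightarrow> ('c, 'm, 'e) metric_rep \<Rightarrow> ('m \<Rightarrow> real) \<Rightarrow> 'c \<Rightarrow> 'm \<Rightarrow> 'e" where
  "gradient A g F c x = (THE v. \<forall>w. g c x v w = chart_deriv A F c x w)"

definition gradient_norm ::
    "('c, 'm, 'e::real_normed_vector) atlas \<Rightarrow> ('c, 'm, 'e) metric_rep \<Rightarrow> ('m \<Rightarrow> real) \<Rightarrow> 'm \<Rightarrow> real" where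
  "gradient_norm A g F x =
     (let c = chart_at A x; v = gradient A g F c x in sqrt (g c x v v))"

definition palais_smale ::
    "('c, 'm::topological_space, 'e::real_normed_vector) atlas \<Rightarrow> ('c, 'm, 'e) metric_rep \<Rightarrow> ('m \<Rightarrow> real) \<Rightarrow> bool" where
  "palais_smale A g F \<longleftrightarrow>
     (\<forall>x :: nat \<Rightarrow> 'm.
        bounded (range (\<lambda>n. \<bar>F (x n)\<bar>)) \<and> (\<lambda>n. gradient_norm A g F (x n)) \<longlonglongrightarrow> 0 \<longrightarrow>
        (\<exists>l k. strict_mono (k :: nat \<Rightarrow> nat) \<and> (x \<circ> k) \<longlonglongrightarrow> l))"

definition sublevel :: "('m \<Rightarrow> real) \<Rightarrow> real \<Rightarrow> 'm set" where
  "sublevel F a = {y. F y \<le> a}"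

definition critical_components ::
    "('c, 'm::topological_space, 'e::real_normed_vector) atlas \<Rightarrow> ('m \<Rightarrow> real) \<Rightarrow> real \<Rightarrow> 'm set set" where
  "critical_components A F \<mu> = components ({y. F y = \<mu>} \<inter> Crit A F)"

section \<open>Sequential subspace complexity\<close>

definition path_set :: "(real \<Rightarrow> 'm::topological_space) set" where
  "path_set = {\<gamma>. continuous_on {0..1} \<gamma> \<and> \<gamma> \<in> extensional {0..1}}"

text \<open>The space \<open>PX\<close> of paths on the unit interval with the compact-open topology.\<close>

definition path_topology :: "(real \<Rightarrow> 'm::topological_space) topology" where
  "path_topology = topology_generated_by
     {{\<gamma> \<in> path_set. \<gamma> ` K \<subseteq> V} | K V. compact K \<and> K \<subseteq> {0..1} \<and> open V}"

text \<open>
  The power \<open>X\<^sup>r\<close> is \<open>'m ^ 'r\<close> with \<open>r = CARD('r)\<close>; the linear order on the index type lists the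
  coordinates, so that \<open>card {..<i}\<close> is the position, counted from \<open>0\<close>, of the coordinate \<open>i\<close>.
\<close>

definition path_eval :: "(real \<Rightarrow> 'm) \<Rightarrow> 'm ^ 'r::{finite,linorder}" where
  "path_eval \<gamma> = (\<chi> i. \<gamma> (real (card {..<i}) / (real CARD('r) - 1)))"

definition has_section :: "('m::topological_space ^ 'r::{finite,linorder}) set \<Rightarrow> bool" where
  "has_section U \<longleftrightarrow>
     (\<exists>s. continuous_map (top_of_set U) path_topology s \<and> (\<forall>x\<in>U. path_eval (s x) = x))"

text \<open>The infimum of the empty set of extended natural numbers is \<open>\<infinity>\<close>.\<close>

definition TC :: "('m::topological_space ^ 'r::{finite,linorder}) set \<Rightarrow> enat" where
  "TC A = (INF n\<in>{n. \<exists>U :: nat \<Rightarrow> _ set.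
              (\<forall>i<n. open (U i) \<and> has_section (U i)) \<and> A \<subseteq> (\<Union>i<n. U i)}. enat n)"

end

theory Submission
  imports Defs
begin

text \<open>
  The proof is Lusternik--Schnirelmann theory without differential equations.  Near a point where
  the norm of the gradient is at least \<open>\<delta>\<close>, moving along a segment in a chart gives a local
  deformation that satisfies \<open>\<sigma> d(x, y) \<le> F x - F y\<close> when it takes \<open>x\<close> to \<open>y\<close>; this relation is
  Ekeland's order.  A \<open>\<sigma>\<close>-discrete refinement of the cover by such neighbourhoods yields countably
  many global deformations respecting the order.  Apply them in turn, each infinitely often.  As
  long as \<open>F\<close> stays above a level, the resulting points form a Cauchy sequence, and its limit would
  be a point that none of the deformations moves, which is impossible away from the critical points.
  Hence every point gets below the level after finitely many steps, and stopping at a continuously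
  chosen time gives a homotopy.

  By the Palais--Smale condition this pushes \<open>{F \<le> b + \<epsilon>}\<close>, minus a neighbourhood of the compact
  critical set \<open>K\<close> of level \<open>b\<close>, into \<open>{F \<le> b - \<epsilon>}\<close>.  The complexity does not increase along such
  a homotopy, and that of \<open>K\<close> is bounded by the complexities of its components, because \<open>K\<close> is a
  finite disjoint union of relatively clopen sets, each covered like a single component.
\<close>

section \<open>Sections over open sets and the complexity\<close>

text \<open>Since \<open>F\<close> is merely C1, its gradient field is only continuous and need not
  have a flow. Ekeland's order serves instead because it forgets the parametrization: being
  transitive, it bounds the distance travelled by the height lost, divided by
  \<open>\<sigma>\<close>, no matter how many deformations were applied. This single bound makes
  orbits Cauchy and also keeps an orbit that starts away from the critical set of a level from
  coming near it while it crosses that level. Points of a manifold cannot be averaged, so local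
  descents cannot be glued by a partition of unity. They are either run one after the other or
  combined when their supports are far apart; this is what the discrete families are for. The price
  is an infinite sequence of deformations, so a stopping time is needed that depends continuously on
  the point. On the topological side only a few properties of the complexity enter: monotonicity,
  subadditivity, passage to an open neighbourhood, behaviour under homotopies that start at the
  identity, and the estimate by components.\<close>

definition grid_pos :: "'r::{finite,linorder} \<Rightarrow> real" where
  "grid_pos i = real (card {..<i}) / (real CARD('r) - 1)"

lemma card_lessThan_less: "card {..<i} < CARD('r)" for i :: "'r::{finite,linorder}"
  by (rule psubset_card_mono) auto

lemma grid_pos_in: "grid_pos (i :: 'r::{finite,linorder}) \<in> {0..1}"
proof -
  have "real (card {..<i}) \<le> real CARD('r) - 1"
    using card_lessThan_less[of i] by linarith
  then show ?thesis
    by (auto simp: grid_pos_def divide_le_eq_1)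
qed

text \<open>The exponential law for the compact-open topology: a continuous family of paths is a
  continuous map on \<open>U \<times> {0..1}\<close>. All later constructions take place on the
  product, where maps can be pasted.\<close>

lemma has_section_iff:
  fixes U :: "('m::topological_space ^ 'r::{finite,linorder}) set"
  shows "has_section U \<longleftrightarrow>
    (\<exists>q. continuous_on (U \<times> {0..1::real}) q \<and> (\<forall>x\<in>U. \<forall>i. q (x, grid_pos i) = x $ i))"
    (is "_ \<longleftrightarrow> ?R")
proof
  assume "has_section U"
  then obtain s where s: "continuous_map (top_of_set U) path_topology s"
    and ev: "\<And>x. x \<in> U \<Longrightarrow> path_eval (s x) = x"
    unfolding has_section_def by blast
  have sub: "s ` U \<subseteq> \<Union> {{\<gamma> \<in> path_set. \<gamma> ` K \<subseteq> V} | K V. compact K \<and> K \<subseteq> {0..1} \<and> open V}"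
    and pre: "\<And>K V. \<lbrakk>compact K; K \<subseteq> {0..1}; open V\<rbrakk> \<Longrightarrow>
       openin (top_of_set U) (s -` {\<gamma> \<in> path_set. \<gamma> ` K \<subseteq> V} \<inter> U)"
    using s unfolding path_topology_def continuous_on_generated_topo_iff topspace_euclidean_subtopology
    by blast+
  have ps: "s x \<in> path_set" if "x \<in> U" for x
    using sub that by auto
  let ?q = "\<lambda>(x, t). s x t"
  have "continuous_on (U \<times> {0..1}) ?q"
    unfolding continuous_on_topological
  proof (intro ballI allI impI)
    fix z B assume z: "z \<in> U \<times> {0..1::real}" and B: "open B" "?q z \<in> B"
    obtain x t where xt: "z = (x, t)" "x \<in> U" "t \<in> {0..1}" using z by auto
    have "continuous_on {0..1} (s x)" using ps[OF xt(2)] by (simp add: path_set_def)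
    then obtain A where A: "open A" "t \<in> A" "\<And>u. \<lbrakk>u \<in> {0..1}; u \<in> A\<rbrakk> \<Longrightarrow> s x u \<in> B"
      using xt(3) B unfolding continuous_on_topological xt(1) by (metis case_prod_conv)
    obtain e where e: "e > 0" "cball t e \<subseteq> A" using A open_contains_cball by blast
    \<comment> \<open>Local compactness of the interval: \<open>K\<close> is a compact neighbourhood
      of \<open>t\<close> on which the path of \<open>x\<close> stays in \<open>B\<close>, and the
      subbasic set of \<open>K\<close> and \<open>B\<close> controls the paths of all nearby points
      at once.\<close>
    define K where "K = cball t e \<inter> {0..1}"
    have K: "compact K" "K \<subseteq> {0..1}" by (auto simp: K_def compact_Int)
    have "openin (top_of_set U) (s -` {\<gamma> \<in> path_set. \<gamma> ` K \<subseteq> B} \<inter> U)"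
      using pre K B by blast
    then obtain W where W: "open W" "s -` {\<gamma> \<in> path_set. \<gamma> ` K \<subseteq> B} \<inter> U = U \<inter> W"
      by (auto simp: openin_open)
    have "s x ` K \<subseteq> B" using A e by (auto simp: K_def)
    then have "x \<in> W" using W ps xt by blast
    show "\<exists>A. open A \<and> z \<in> A \<and> (\<forall>y\<in>U \<times> {0..1}. y \<in> A \<longrightarrow> ?q y \<in> B)"
    proof (intro exI conjI ballI impI)
      show "open (W \<times> ball t e)" using W by (simp add: open_Times)
      show "z \<in> W \<times> ball t e" using xt e \<open>x \<in> W\<close> by auto
      fix y assume y: "y \<in> U \<times> {0..1}" "y \<in> W \<times> ball t e"
      obtain x' t' where y': "y = (x', t')" by (cases y)
      have "x' \<in> U" "x' \<in> W" "t' \<in> K" using y by (simp_all add: K_def y')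
      then have "s x' ` K \<subseteq> B" using W(2) by blast
      then show "?q y \<in> B" using \<open>t' \<in> K\<close> by (auto simp: y')
    qed
  qed
  moreover have "?q (x, grid_pos i) = x $ i" if "x \<in> U" for x i
    using arg_cong[OF ev[OF that], of "\<lambda>v. v $ i"] by (simp add: path_eval_def grid_pos_def)
  ultimately show ?R by blast
next
  assume ?R
  then obtain q where q: "continuous_on (U \<times> {0..1::real}) q"
    and qv: "\<And>x i. x \<in> U \<Longrightarrow> q (x, grid_pos i) = x $ i" by blast
  define s where "s x = restrict (\<lambda>t. q (x, t)) {0..1}" for x
  have ps: "s x \<in> path_set" if "x \<in> U" for x
  proof -
    have "continuous_on {0..1} (\<lambda>t. q (x, t))"
      by (rule continuous_on_compose2[OF q]) (use that in \<open>auto intro!: continuous_intros\<close>)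
    then have "continuous_on {0..1} (s x)"
      by (rule continuous_on_eq) (simp add: s_def)
    then show ?thesis
      by (simp add: path_set_def s_def)
  qed
  have "continuous_map (top_of_set U) path_topology s"
    unfolding path_topology_def
  proof (rule continuous_on_generated_topo)
    fix B :: "(real \<Rightarrow> 'm) set" assume "B \<in> {{\<gamma> \<in> path_set. \<gamma> ` K \<subseteq> V} | K V. compact K \<and> K \<subseteq> {0..1::real} \<and> open V}"
    then obtain K V where KV: "compact K" "K \<subseteq> {0..1::real}" "open V"
      and B: "B = {\<gamma> \<in> path_set. \<gamma> ` K \<subseteq> V}" by blast
    obtain W where W: "open W" "(U \<times> {0..1}) \<inter> q -` V = W \<inter> (U \<times> {0..1})"
      using q KV(3) unfolding continuous_on_open_invariant by (metis inf_commute)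
    have "\<exists>T. openin (top_of_set U) T \<and> x \<in> T \<and> T \<subseteq> s -` B \<inter> topspace (top_of_set U)"
      if x: "x \<in> s -` B \<inter> topspace (top_of_set U)" for x
    proof -
      have xU: "x \<in> U" and "s x ` K \<subseteq> V" using x B by auto
      then have "q (x, t) \<in> V" if "t \<in> K" for t
        using that KV(2) by (auto simp: s_def image_subset_iff)
      then have "{x} \<times> K \<subseteq> W" using W(2) KV(2) xU by blast
      \<comment> \<open>Compactness of \<open>K\<close> gives one neighbourhood of \<open>x\<close>
        that works for all times in \<open>K\<close>.\<close>
      then obtain X0 where X0: "x \<in> X0" "open X0" "X0 \<times> K \<subseteq> W"
        using Elementary_Topology.tube_lemma[OF KV(1) W(1)] by blast
      have "X0 \<inter> U \<subseteq> s -` B"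
      proof
        fix y assume y: "y \<in> X0 \<inter> U"
        have "q (y, t) \<in> V" if "t \<in> K" for t
          using X0(3) y that KV(2) W(2) by blast
        then have "s y ` K \<subseteq> V" using KV(2) by (auto simp: s_def)
        then show "y \<in> s -` B" using ps y B by auto
      qed
      then show ?thesis
        using X0 xU by (intro exI[of _ "U \<inter> X0"]) (auto simp: openin_open)
    qed
    then show "openin (top_of_set U) (s -` B \<inter> topspace (top_of_set U))"
      by (subst openin_subopen) blast
  next
    \<comment> \<open>The empty compact set makes the whole of \<open>path_set\<close> a subbasic
      set, so the generated topology lives on all of it.\<close>
    have "path_set \<in> {{\<gamma> \<in> path_set. \<gamma> ` K \<subseteq> V} | K V. compact K \<and> K \<subseteq> {0..1::real} \<and> open V}"
      by (intro CollectI exI[of _ "{}"] exI[of _ UNIV]) auto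
    then show "s ` topspace (top_of_set U) \<subseteq> \<Union> {{\<gamma> \<in> path_set. \<gamma> ` K \<subseteq> V} | K V. compact K \<and> K \<subseteq> {0..1::real} \<and> open V}"
      using ps by force
  qed
  moreover have "path_eval (s x) = x" if "x \<in> U" for x
  proof -
    have "path_eval (s x) $ i = x $ i" for i
      using qv[OF that, of i] grid_pos_in[of i] unfolding path_eval_def s_def grid_pos_def[symmetric]
      by simp
    then show ?thesis by (simp add: vec_eq_iff)
  qed
  ultimately show "has_section U" unfolding has_section_def by blast
qed

lemma has_section_subset:
  assumes "has_section U" and "V \<subseteq> U"
  shows "has_section V"
proof -
  obtain q where q: "continuous_on (U \<times> {0..1::real}) q" "\<forall>x\<in>U. \<forall>i. q (x, grid_pos i) = x $ i"
    using assms(1) unfolding has_section_iff by blast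
  have "continuous_on (V \<times> {0..1}) q"
    using q(1) by (rule continuous_on_subset) (use assms(2) in auto)
  moreover have "\<forall>x\<in>V. \<forall>i. q (x, grid_pos i) = x $ i"
    using q(2) assms(2) by (simp add: subset_iff)
  ultimately show ?thesis unfolding has_section_iff by (intro exI[of _ q] conjI)
qed

text \<open>Pasting along disjoint open sets needs no compatibility. This is why far apart pieces of
  a critical level cost only as much as the most expensive piece.\<close>

lemma has_section_disjoint_UN:
  assumes op: "\<And>j. j \<in> J \<Longrightarrow> open (U j)" and sec: "\<And>j. j \<in> J \<Longrightarrow> has_section (U j)"
    and disj: "\<And>j k. \<lbrakk>j \<in> J; k \<in> J; j \<noteq> k\<rbrakk> \<Longrightarrow> U j \<inter> U k = {}"
  shows "has_section (\<Union>j\<in>J. U j)"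
proof -
  obtain q where q: "\<And>j. j \<in> J \<Longrightarrow> continuous_on (U j \<times> {0..1::real}) (q j)"
     "\<And>j x i. \<lbrakk>j \<in> J; x \<in> U j\<rbrakk> \<Longrightarrow> q j (x, grid_pos i) = x $ i"
    using sec unfolding has_section_iff by metis
  let ?D = "(\<Union>j\<in>J. U j) \<times> {0..1::real}"
  let ?T = "\<lambda>j. U j \<times> {0..1::real}"
  obtain Q where Q: "continuous_map (top_of_set ?D) euclidean Q"
    "\<And>x j. \<lbrakk>j \<in> J; x \<in> topspace (top_of_set ?D) \<inter> ?T j\<rbrakk> \<Longrightarrow> Q x = q j x"
  proof (rule pasting_lemma_exists[where X="top_of_set ?D" and I=J and T="?T" and Y=euclidean and f=q])
    show "topspace (top_of_set ?D) \<subseteq> (\<Union>j\<in>J. ?T j)" by auto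
    show "openin (top_of_set ?D) (?T j)" if "j \<in> J" for j
      using op that unfolding openin_open
      by (intro exI[of _ "U j \<times> UNIV"]) (auto simp: open_Times)
    show "continuous_map (subtopology (top_of_set ?D) (?T j)) euclidean (q j)" if "j \<in> J" for j
    proof -
      have "?D \<inter> ?T j = ?T j" using that by auto
      then show ?thesis using q(1)[OF that] by (simp add: subtopology_subtopology)
    qed
    show "q i x = q j x" if "i \<in> J" "j \<in> J" "x \<in> topspace (top_of_set ?D) \<inter> ?T i \<inter> ?T j" for i j x
      using disj[of i j] that by fastforce
  qed (rule that)
  show ?thesis unfolding has_section_iff
  proof (intro exI conjI ballI allI)
    show "continuous_on ?D Q" using Q(1) by simp
    fix x i assume "x \<in> (\<Union>j\<in>J. U j)"
    then obtain j where "j \<in> J" "x \<in> U j" by blast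
    then show "Q (x, grid_pos i) = x $ i"
      using Q(2)[of j "(x, grid_pos i)"] q(2) grid_pos_in[of i] by auto
  qed
qed

text \<open>The path through \<open>x\<close> runs along the tracks of the homotopy near the grid points, and
  along the given path through \<open>h (x, 1)\<close> in between; the reparametrization \<open>\<theta>\<close> is locally
  constant near the grid points.\<close>

lemma has_section_homotopy:
  fixes U V :: "('m::topological_space ^ 'r::{finite,linorder}) set"
  assumes r: "CARD('r) \<ge> 2"
    and h: "continuous_on (V \<times> {0..1::real}) h"
    and h0: "\<And>x. x \<in> V \<Longrightarrow> h (x, 0) = x" and h1: "\<And>x. x \<in> V \<Longrightarrow> h (x, 1) \<in> U"
    and U: "has_section U"
  shows "has_section V"
proof -
  obtain q where q: "continuous_on (U \<times> {0..1::real}) q"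
    and qv: "\<And>x i. x \<in> U \<Longrightarrow> q (x, grid_pos i) = x $ i"
    using U unfolding has_section_iff by blast
  define m where "m = CARD('r) - 1"
  have m: "m \<ge> 1" "real CARD('r) - 1 = real m" using r by (auto simp: m_def of_nat_diff)
  \<comment> \<open>A staircase: the summand \<open>j\<close> climbs from 0 to \<open>1 / m\<close>
    exactly on the middle third of the interval from \<open>j / m\<close> to
    \<open>(j + 1) / m\<close>, so \<open>\<theta>\<close> equals \<open>k / m\<close> within
    distance \<open>1 / (3 * m)\<close> of \<open>k / m\<close>.\<close>
  define \<theta> where "\<theta> t = (\<Sum>j<m. max 0 (min 1 (3 * real m * t - 3 * real j - 1)) / real m)" for t :: real
  have \<theta>cont: "continuous_on S \<theta>" for S unfolding \<theta>_def by (intro continuous_intros) (use m in auto)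
  have \<theta>in: "\<theta> t \<in> {0..1}" for t
  proof -
    have "\<theta> t \<le> (\<Sum>j<m. 1 / real m)" unfolding \<theta>_def by (intro sum_mono divide_right_mono) auto
    moreover have "\<theta> t \<ge> 0" unfolding \<theta>_def by (intro sum_nonneg) auto
    ultimately show ?thesis using m by simp
  qed
  have gp: "grid_pos i = real (card {..<i}) / real m" for i :: 'r
    using m by (simp add: grid_pos_def)
  have \<theta>grid: "\<theta> t = grid_pos i" if "3 * real m * \<bar>t - grid_pos i\<bar> \<le> 1" for t and i :: 'r
  proof -
    let ?k = "card {..<i}"
    have km: "?k \<le> m" using card_lessThan_less[of i] by (simp add: m_def)
    have "\<bar>3 * real m * t - 3 * real ?k\<bar> = 3 * real m * \<bar>t - grid_pos i\<bar>"
    proof -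
      have "3 * real m * t - 3 * real ?k = 3 * real m * (t - grid_pos i)"
        using m by (simp add: gp field_simps)
      then show ?thesis by (simp add: abs_mult)
    qed
    then have b: "3 * real m * t - 3 * real ?k \<le> 1" "3 * real m * t - 3 * real ?k \<ge> -1"
      using that by linarith+
    have "max 0 (min 1 (3 * real m * t - 3 * real j - 1)) = (if j < ?k then 1 else 0)" for j
    proof (cases "j < ?k")
      case True
      then have "real j + 1 \<le> real ?k" by linarith
      then show ?thesis using b True by simp
    next
      case False
      then have "real ?k \<le> real j" by linarith
      then show ?thesis using b False by simp
    qed
    then have "\<theta> t = (\<Sum>j<m. if j < ?k then 1 / real m else 0)"
      unfolding \<theta>_def by (intro sum.cong) auto
    also have "\<dots> = (\<Sum>j<?k. 1 / real m)"
      using km by (intro sum.mono_neutral_cong_right) auto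
    finally show ?thesis by (simp add: gp)
  qed
  have gsep: "i = j" if "3 * real m * \<bar>t - grid_pos i\<bar> \<le> 1" "3 * real m * \<bar>t - grid_pos j\<bar> \<le> 1"
    for t and i j :: 'r
  proof -
    have "grid_pos i = grid_pos j" using \<theta>grid that by metis
    then have "card {..<i} = card {..<j}" using m by (simp add: gp)
    moreover have "card {..<a} < card {..<b}" if "a < b" for a b :: 'r
      by (rule psubset_card_mono) (use that in auto)
    ultimately show ?thesis by (metis linorder_neqE nat_neq_iff)
  qed
  \<comment> \<open>The grid point of \<open>i\<close> owns the times within
    \<open>1 / (3 * m)\<close> of it, rescaled to run from 1 down to 0 and back: the path is at
    \<open>x $ i\<close> in the centre and at the coordinate \<open>i\<close> of
    \<open>h (x, 1)\<close> on the boundary, where \<open>\<theta>\<close> has already stopped at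
    the grid point and \<open>q\<close> takes over.\<close>
  define T where "T = (\<lambda>io. case io of Some i \<Rightarrow> V \<times> {t\<in>{0..1}. 3 * real m * \<bar>t - grid_pos (i::'r)\<bar> \<le> 1}
      | None \<Rightarrow> V \<times> {t\<in>{0..1}. \<forall>i::'r. 3 * real m * \<bar>t - grid_pos i\<bar> \<ge> 1})"
  define f where "f = (\<lambda>io (x, t). case io of Some i \<Rightarrow> h (x, 3 * real m * \<bar>t - grid_pos (i::'r)\<bar>) $ i
      | None \<Rightarrow> q (h (x, 1), \<theta> t))"
  let ?D = "V \<times> {0..1::real}"
  have fT: "continuous_on (T io) (f io)" for io
  proof (cases io)
    case (Some i)
    have "continuous_on (T io) (\<lambda>(x, t). h (x, 3 * real m * \<bar>t - grid_pos i\<bar>))"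
      unfolding split_def
      by (rule continuous_on_compose2[OF h]) (auto intro!: continuous_intros simp: T_def Some)
    then show ?thesis
      unfolding f_def Some split_def by (auto intro!: continuous_on_component)
  next
    case None
    have c: "continuous_on (T io) (\<lambda>(x, t). h (x, 1))"
      unfolding split_def
      by (rule continuous_on_compose2[OF h]) (auto intro!: continuous_intros simp: T_def None)
    have "continuous_on (T io) (\<lambda>(x, t). q (h (x, 1), \<theta> t))"
      unfolding split_def
      apply (rule continuous_on_compose2[OF q])
       apply (intro continuous_intros continuous_on_compose2[OF \<theta>cont])
      using c \<theta>in h1 by (auto simp: T_def None split_def intro!: continuous_intros)
    then show ?thesis unfolding f_def None by simp
  qed
  have agree: "f a x = f b x" if "x \<in> T a" "x \<in> T b" for a b x
  proof -
    obtain y t where x: "x = (y, t)" by (cases x)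
    have *: "f (Some i) x = f None x" if "x \<in> T (Some i)" "x \<in> T None" for i
    proof -
      have "3 * real m * \<bar>t - grid_pos i\<bar> = 1" "y \<in> V"
        using that by (auto simp: T_def x intro: antisym)
      then show ?thesis using \<theta>grid[of t i] qv h1 by (simp add: f_def x)
    qed
    show ?thesis
    proof (cases a; cases b)
      fix i j assume "a = Some i" "b = Some j"
      then show ?thesis using gsep[of t i j] that by (auto simp: T_def x)
    qed (use * that in auto)
  qed
  have cov: "\<exists>io. x \<in> T io" if "x \<in> ?D" for x
  proof -
    obtain y t where x: "x = (y, t)" by (cases x)
    show ?thesis
    proof (cases "\<exists>i::'r. 3 * real m * \<bar>t - grid_pos i\<bar> \<le> 1")
      case True
      then obtain i :: 'r where "3 * real m * \<bar>t - grid_pos i\<bar> \<le> 1" by blast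
      then have "x \<in> T (Some i)" using that by (auto simp: T_def x)
      then show ?thesis ..
    next
      case False
      then have "x \<in> T None" using that by (auto simp: T_def x not_le less_imp_le)
      then show ?thesis ..
    qed
  qed
  have clo: "closedin (top_of_set ?D) (T io)" for io
  proof -
    have abs_cont: "continuous_on UNIV (\<lambda>t. 3 * real m * \<bar>t - grid_pos i\<bar>)" for i :: 'r
      by (intro continuous_intros)
    show ?thesis
    proof (cases io)
      case (Some i)
      have "closed (UNIV \<times> {t. 3 * real m * \<bar>t - grid_pos i\<bar> \<le> 1})"
        by (intro closed_Times closed_UNIV closed_Collect_le abs_cont continuous_intros)
      then show ?thesis
        unfolding closedin_closed
        by (rule_tac exI[of _ "UNIV \<times> {t. 3 * real m * \<bar>t - grid_pos i\<bar> \<le> 1}"]) (auto simp: T_def Some)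
    next
      case None
      have "closed (UNIV \<times> {t. \<forall>i::'r. 3 * real m * \<bar>t - grid_pos i\<bar> \<ge> 1})"
        by (intro closed_Times closed_UNIV closed_Collect_all closed_Collect_le abs_cont continuous_intros)
      then show ?thesis
        unfolding closedin_closed
        by (rule_tac exI[of _ "UNIV \<times> {t. \<forall>i::'r. 3 * real m * \<bar>t - grid_pos i\<bar> \<ge> 1}"]) (auto simp: T_def None)
    qed
  qed
  define Q where "Q x = f (SOME io. x \<in> T io) x" for x
  have QT: "Q x = f io x" if "x \<in> T io" for x io
    unfolding Q_def by (rule agree[OF someI[of "\<lambda>io. x \<in> T io"] that]) (rule that)
  have "continuous_map (top_of_set ?D) euclidean Q"
  proof (rule pasting_lemma_closed[of UNIV _ T _ f])
    show "continuous_map (subtopology (top_of_set ?D) (T io)) euclidean (f io)" for io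
    proof -
      have "?D \<inter> T io = T io" by (auto simp: T_def split: option.splits)
      then show ?thesis using fT by (simp add: subtopology_subtopology)
    qed
    show "\<exists>j. j \<in> UNIV \<and> x \<in> T j \<and> Q x = f j x" if "x \<in> topspace (top_of_set ?D)" for x
      using cov[of x] QT that by auto
  qed (use clo agree in auto)
  moreover have "Q (x, grid_pos i) = x $ i" if "x \<in> V" for x i
    using QT[of "(x, grid_pos i)" "Some i"] that grid_pos_in[of i] h0 by (auto simp: T_def f_def)
  ultimately show ?thesis unfolding has_section_iff by auto
qed

section \<open>Covering numbers, homotopies and components\<close>

definition section_cover :: "nat \<Rightarrow> ('m::topological_space ^ 'r::{finite,linorder}) set \<Rightarrow> bool" where
  "section_cover n A \<longleftrightarrow> (\<exists>U. (\<forall>i<n. open (U i) \<and> has_section (U i)) \<and> A \<subseteq> (\<Union>i<n. U i))"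

lemma has_section_empty: "has_section {}"
  by (simp add: has_section_iff)

lemma section_cover_mono:
  assumes "section_cover m A" "m \<le> n" "B \<subseteq> A"
  shows "section_cover n B"
proof -
  obtain U where U: "\<forall>i<m. open (U i) \<and> has_section (U i)" "A \<subseteq> (\<Union>i<m. U i)"
    using assms(1) unfolding section_cover_def by blast
  show ?thesis unfolding section_cover_def
    by (rule exI[of _ "\<lambda>i. if i < m then U i else {}"])
       (use U assms in \<open>fastforce simp: has_section_empty\<close>)
qed

lemma section_cover_Un:
  assumes "section_cover m A" "section_cover n B"
  shows "section_cover (m + n) (A \<union> B)"
proof -
  obtain U where U: "\<forall>i<m. open (U i) \<and> has_section (U i)" "A \<subseteq> (\<Union>i<m. U i)"
    using assms(1) unfolding section_cover_def by blast
  obtain V where V: "\<forall>i<n. open (V i) \<and> has_section (V i)" "B \<subseteq> (\<Union>i<n. V i)"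
    using assms(2) unfolding section_cover_def by blast
  define W where "W i = (if i < m then U i else V (i - m))" for i
  have "\<forall>i<m+n. open (W i) \<and> has_section (W i)"
    using U V by (auto simp: W_def)
  moreover have "A \<union> B \<subseteq> (\<Union>i<m+n. W i)"
  proof
    fix x assume "x \<in> A \<union> B"
    then consider i where "i < m" "x \<in> U i" | i where "i < n" "x \<in> V i" using U V by blast
    then show "x \<in> (\<Union>i<m+n. W i)"
    proof cases
      case 1
      then show ?thesis by (intro UN_I[of i]) (auto simp: W_def)
    next
      case 2
      then show ?thesis by (intro UN_I[of "m + i"]) (auto simp: W_def)
    qed
  qed
  ultimately show ?thesis unfolding section_cover_def by blast
qed

text \<open>A nonempty set of extended naturals contains its infimum, so a finite bound on
  \<open>TC\<close> comes with an actual cover, and \<open>section_cover\<close> can be used without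
  regard to infinite values.\<close>

lemma TC_le_iff: "TC A \<le> enat n \<longleftrightarrow> section_cover n A"
proof
  let ?S = "{n. section_cover n A}"
  have TC: "TC A = (INF n\<in>?S. enat n)" by (simp add: TC_def section_cover_def)
  show "section_cover n A \<Longrightarrow> TC A \<le> enat n" unfolding TC by (intro INF_lower) simp
  assume le: "TC A \<le> enat n"
  then have "?S \<noteq> {}" unfolding TC by (metis INF_empty enat_ord_code(4) leD top_enat_def)
  then have "(INF n\<in>?S. enat n) \<in> enat ` ?S"
    by (simp add: Inf_enat_def) (smt (verit, best) LeastI imageI mem_Collect_eq)
  then obtain k where "section_cover k A" "TC A = enat k" unfolding TC by auto
  then show "section_cover n A" using le section_cover_mono[of k A n A] by simp
qed

lemma enat_leI: "x \<le> y" if "\<And>n. y = enat n \<Longrightarrow> x \<le> enat n" for x y :: enat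
  using that by (cases y) auto

lemma TC_Un: "TC (A \<union> B) \<le> TC A + TC B"
proof (rule enat_leI)
  fix n assume n: "TC A + TC B = enat n"
  then obtain a b where ab: "TC A = enat a" "TC B = enat b"
    by (cases "TC A"; cases "TC B") auto
  then have "section_cover (a + b) (A \<union> B)"
    by (intro section_cover_Un) (simp_all flip: TC_le_iff)
  then show "TC (A \<union> B) \<le> enat n" using n ab TC_le_iff[of "A \<union> B"] by auto
qed

lemma TC_mono: "TC A \<le> TC B" if "A \<subseteq> B"
  by (rule enat_leI) (metis TC_le_iff order_refl section_cover_mono that)

lemma TC_empty: "TC {} = 0"
proof -
  have "TC {} \<le> enat 0" unfolding TC_le_iff section_cover_def by auto
  then show ?thesis by (simp add: zero_enat_def[symmetric])
qed

text \<open>A cover of \<open>B\<close> is pulled back along the end map of the homotopy. The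
  homotopy has to exist on an open \<open>E\<close> around \<open>A\<close>, as otherwise these
  preimages would not be open in the whole power.\<close>

lemma TC_homotopy:
  fixes A B E :: "('m::topological_space ^ 'r::{finite,linorder}) set"
  assumes r: "CARD('r) \<ge> 2" and "open E" and AE: "A \<subseteq> E"
    and h: "continuous_on (E \<times> {0..1::real}) h"
    and h0: "\<And>x. x \<in> E \<Longrightarrow> h (x, 0) = x" and h1: "\<And>x. x \<in> A \<Longrightarrow> h (x, 1) \<in> B"
  shows "TC A \<le> TC B"
proof (rule enat_leI)
  fix n assume "TC B = enat n"
  then have "section_cover n B" by (simp flip: TC_le_iff)
  then obtain U where U: "\<forall>i<n. open (U i) \<and> has_section (U i)" "B \<subseteq> (\<Union>i<n. U i)"
    unfolding section_cover_def by blast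
  define V where "V i = E \<inter> (\<lambda>x. h (x, 1)) -` U i" for i
  have "continuous_on E (\<lambda>x. h (x, 1))"
    by (rule continuous_on_compose2[OF h]) (auto intro!: continuous_intros)
  then have "open (V i)" if "i < n" for i
    using U(1) that \<open>open E\<close> unfolding V_def by (auto intro: continuous_open_preimage)
  moreover have "has_section (V i)" if "i < n" for i
  proof (rule has_section_homotopy[OF r])
    show "continuous_on (V i \<times> {0..1}) h" using h by (rule continuous_on_subset) (auto simp: V_def)
    show "has_section (U i)" using U that by blast
  qed (auto simp: V_def h0)
  moreover have "A \<subseteq> (\<Union>i<n. V i)" using h1 U(2) AE by (fastforce simp: V_def)
  ultimately show "TC A \<le> enat n" unfolding TC_le_iff section_cover_def by blast
qed

text \<open>The sets that witness the complexity are open, so they already cover a neighbourhood. It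
  allows a critical set to be replaced by an open set whose complement can be deformed.\<close>

lemma TC_open_neighbourhood:
  obtains N where "open N" "A \<subseteq> N" "TC N \<le> TC A"
proof (cases "TC A")
  case (enat n)
  then have "section_cover n A" by (simp flip: TC_le_iff)
  then obtain U where U: "\<forall>i<n. open (U i) \<and> has_section (U i)" "A \<subseteq> (\<Union>i<n. U i)"
    unfolding section_cover_def by blast
  then have "TC (\<Union>i<n. U i) \<le> enat n" unfolding TC_le_iff section_cover_def by blast
  then show thesis using that[of "\<Union>i<n. U i"] U enat by auto
next
  case infinity
  then show thesis using that[of UNIV] by auto
qed

text \<open>After shrinking into disjoint neighbourhoods of \<open>A\<close> and \<open>B\<close>,
  the sets with the same index in the two covers merge into one set with a section; hence the bound
  is a common \<open>n\<close> and not a sum.\<close>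

lemma section_cover_disjoint_compact_Un:
  fixes A B :: "('m::topological_space ^ 'r::{finite,linorder}) set"
  assumes haus: "Hausdorff_space (euclidean :: ('m::topological_space ^ 'r::{finite,linorder}) topology)"
    and cpt: "compact A" "compact B" and disj: "A \<inter> B = {}"
    and cov: "section_cover n A" "section_cover n B"
  shows "section_cover n (A \<union> B)"
proof -
  obtain W W' where W: "open W" "open W'" "A \<subseteq> W" "B \<subseteq> W'" "disjnt W W'"
    using Hausdorff_space_compact_separation[OF haus, of A B] cpt disj
    by (auto simp: disjnt_def)
  obtain U where U: "\<forall>i<n. open (U i) \<and> has_section (U i)" "A \<subseteq> (\<Union>i<n. U i)"
    using cov(1) unfolding section_cover_def by blast
  obtain V where V: "\<forall>i<n. open (V i) \<and> has_section (V i)" "B \<subseteq> (\<Union>i<n. V i)"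
    using cov(2) unfolding section_cover_def by blast
  let ?S = "\<lambda>i b. if b then W \<inter> U i else W' \<inter> V i"
  have "open (\<Union>b. ?S i b)" if "i < n" for i
    using U(1) V(1) W that by (auto simp: UNIV_bool)
  moreover have "has_section (\<Union>b. ?S i b)" if "i < n" for i
  proof (rule has_section_disjoint_UN)
    show "has_section (?S i b)" for b
      using U(1) V(1) that has_section_subset by (metis inf_le2)
    show "?S i b \<inter> ?S i c = {}" if "b \<noteq> c" for b c
      using W(5) that by (auto simp: disjnt_iff)
  qed (use U V W that in auto)
  moreover have "A \<union> B \<subseteq> (\<Union>i<n. \<Union>b. ?S i b)"
    using U(2) V(2) W(3,4) by (fastforce simp: UNIV_bool)
  ultimately show ?thesis unfolding section_cover_def
    by (intro exI[of _ "\<lambda>i. \<Union>b. ?S i b"] conjI allI impI)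
qed

text \<open>Components of a compact set may be infinite in number and need not be relatively open,
  so they cannot be treated one by one. Each of them, however, is surrounded by a relatively clopen
  set inside any given neighbourhood, in particular inside the open sets covering the component;
  compactness then leaves finitely many such sets.\<close>

lemma TC_compact_le_components:
  fixes K :: "('m::topological_space ^ 'r::{finite,linorder}) set"
  assumes haus: "Hausdorff_space (euclidean :: ('m::topological_space ^ 'r::{finite,linorder}) topology)" and K: "compact K"
  shows "TC K \<le> (SUP C\<in>components K. TC C)"
proof (rule enat_leI)
  fix n assume n: "(SUP C\<in>components K. TC C) = enat n"
  have ex: "\<exists>Z. x \<in> Z \<and> openin (top_of_set K) Z \<and> compact Z \<and> section_cover n Z" if x: "x \<in> K" for x
  proof -
    let ?C = "connected_component_set K x"
    have "?C \<in> components K" using x by (auto simp: components_def)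
    then have "TC ?C \<le> enat n" unfolding n[symmetric] by (rule SUP_upper)
    moreover obtain N where N: "open N" "?C \<subseteq> N" "TC N \<le> TC ?C"
      by (rule TC_open_neighbourhood)
    ultimately have N': "section_cover n N" by (metis TC_le_iff order_trans)
    have hK: "Hausdorff_space (top_of_set K)" and cK: "compact_space (top_of_set K)"
      using haus K by (simp_all add: Hausdorff_space_subtopology compact_space_subtopology)
    have "?C = connected_component_of_set (top_of_set K) x"
      unfolding connected_component_def connected_component_of_def
      by (auto simp: connectedin_subtopology)
    then have Cin: "?C \<in> connected_components_of (top_of_set K)"
      using x by (auto simp: connected_components_of_def)
    have Ccpt: "compactin (top_of_set K) ?C"
      using cK closedin_connected_components_of[OF Cin] by (rule closedin_compact_space)
    \<comment> \<open>In a locally compact Hausdorff space a compact component is separated from the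
      complement of any neighbourhood of it by a splitting into two open sets.\<close>
    obtain Z Z' where Z: "openin (top_of_set K) Z" "openin (top_of_set K) Z'" "disjnt Z Z'"
       "Z \<union> Z' = topspace (top_of_set K)" "?C \<subseteq> Z" "Z \<subseteq> K \<inter> N"
    proof (rule wilder_locally_compact_component_thm[OF compact_imp_locally_compact_space[OF cK] hK Cin Ccpt])
      show "openin (top_of_set K) (K \<inter> N)" using N(1) by (simp add: openin_open_Int)
      show "?C \<subseteq> K \<inter> N" using N(2) connected_component_subset by blast
    qed (rule that)
    have "Z = K - Z'" using Z(3,4) by (auto simp: disjnt_iff)
    then have "closedin (top_of_set K) Z" using Z(2) by (metis closedin_diff closedin_topspace topspace_euclidean_subtopology)
    then have "compactin (top_of_set K) Z" using cK by (intro closedin_compact_space)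
    then have "compact Z" by (simp add: compactin_subtopology)
    moreover have "x \<in> Z" using Z(5) x by auto
    moreover have "section_cover n Z" using N' Z(6) section_cover_mono by blast
    ultimately show ?thesis using Z(1) by blast
  qed
  define \<Z> where "\<Z> = {Z. openin (top_of_set K) Z \<and> compact Z \<and> section_cover n Z}"
  obtain \<F> where \<F>: "\<F> \<subseteq> \<Z>" "finite \<F>" "K \<subseteq> \<Union>\<F>"
  proof -
    have "\<forall>Z\<in>\<Z>. openin (top_of_set K) Z" "K \<subseteq> \<Union>\<Z>"
      using ex by (auto simp: \<Z>_def)
    then show thesis
      using K that unfolding compact_eq_openin_cover by meson
  qed
  have step: "compact (\<Union>\<G>) \<and> openin (top_of_set K) (\<Union>\<G>) \<and> section_cover n (\<Union>\<G>)"
    if "finite \<G>" "\<G> \<subseteq> \<Z>" for \<G>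
    using that
  proof (induction \<G> rule: finite_induct)
    case empty
    have "section_cover n {}" unfolding section_cover_def
      by (rule exI[of _ "\<lambda>_. {}"]) (simp add: has_section_empty)
    then show ?case by simp
  next
    case (insert Z \<G>)
    then have Z: "openin (top_of_set K) Z" "compact Z" "section_cover n Z" by (auto simp: \<Z>_def)
    have G: "compact (\<Union>\<G>)" "openin (top_of_set K) (\<Union>\<G>)" "section_cover n (\<Union>\<G>)"
      using insert by auto
    obtain T where T: "open T" "Z = K \<inter> T" using Z(1) by (auto simp: openin_open)
    \<comment> \<open>The new set is made disjoint from the old union by cutting it out of that
      union; since it is relatively open, what is left remains compact.\<close>
    have "\<Union>\<G> - Z = \<Union>\<G> - T" using T(2) openin_imp_subset[OF G(2)] by auto
    then have "compact (\<Union>\<G> - Z)" using compact_diff[OF G(1) T(1)] by simp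
    moreover have "section_cover n (\<Union>\<G> - Z)"
      using G(3) by (rule section_cover_mono) auto
    ultimately have "section_cover n (Z \<union> (\<Union>\<G> - Z))"
      using Z by (intro section_cover_disjoint_compact_Un[OF haus]) auto
    moreover have "Z \<union> (\<Union>\<G> - Z) = \<Union>(insert Z \<G>)" by auto
    ultimately show ?case using Z G by (auto intro: compact_Un openin_Un)
  qed
  then have "section_cover n (\<Union>\<F>)" using \<F> by blast
  then show "TC K \<le> enat n" unfolding TC_le_iff using \<F>(3) section_cover_mono by blast
qed

section \<open>Deformations in complete metric spaces\<close>

lemma continuous_on_local:
  assumes "\<And>x. x \<in> S \<Longrightarrow> \<exists>W. open W \<and> x \<in> W \<and> continuous_on (S \<inter> W) f"
  shows "continuous_on S f"
  unfolding continuous_on_def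
proof
  fix x assume x: "x \<in> S"
  then obtain W where W: "open W" "x \<in> W" "continuous_on (S \<inter> W) f" using assms by blast
  then have "(f \<longlongrightarrow> f x) (at x within S \<inter> W)" using x by (simp add: continuous_on_def)
  moreover have "at x within S \<inter> W = at x within S"
    by (rule at_within_nhd[OF W(2,1)]) blast
  ultimately show "(f \<longlongrightarrow> f x) (at x within S)" by simp
qed

text \<open>The type keeps the topology it has, and the metric is an extra function inducing it. One
  development then serves both the truncated Riemannian distance on the manifold and its sum over
  the coordinates of the power.\<close>

locale topological_metric =
  fixes d :: "'a::topological_space \<Rightarrow> 'a \<Rightarrow> real"
  assumes d_nonneg: "d x y \<ge> 0"
    and d_commute: "d x y = d y x"
    and d_eq_0: "d x y = 0 \<longleftrightarrow> x = y"
    and d_triangle: "d x z \<le> d x y + d y z"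
    and open_iff: "open U \<longleftrightarrow> (\<forall>x\<in>U. \<exists>e>0. \<forall>y. d x y < e \<longrightarrow> y \<in> U)"
begin

sublocale Metric_space UNIV d
  by standard (rule d_nonneg d_commute d_eq_0 d_triangle)+

lemma mtopology_eq: "mtopology = euclidean"
  unfolding topology_eq openin_mtopology open_openin[symmetric] open_iff
  by (auto simp: mball_def subset_iff)

lemma Hausdorff: "Hausdorff_space (euclidean :: 'a topology)"
  using Hausdorff_space_mtopology by (simp add: mtopology_eq)

lemma open_ball: "open {y. d x y < e}"
  using openin_mball[of x e] by (simp add: mtopology_eq mball_def)

lemma tendsto_iff_d: "(f \<longlongrightarrow> l) G \<longleftrightarrow> ((\<lambda>x. d (f x) l) \<longlongrightarrow> 0) G"
proof -
  have "(f \<longlongrightarrow> l) G \<longleftrightarrow> limitin mtopology f l G" by (simp add: mtopology_eq)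
  also have "\<dots> \<longleftrightarrow> (\<forall>e>0. eventually (\<lambda>x. d (f x) l < e) G)"
    by (simp add: limitin_metric)
  also have "\<dots> \<longleftrightarrow> ((\<lambda>x. d (f x) l) \<longlongrightarrow> 0) G"
    by (simp add: tendsto_iff dist_real_def d_nonneg)
  finally show ?thesis .
qed

lemma continuous_on_nonexpansive:
  assumes "\<And>x y. \<bar>f x - f y\<bar> \<le> d x y"
  shows "continuous_on S (f :: 'a \<Rightarrow> real)"
proof -
  have "(f \<longlongrightarrow> f x) (at x within S)" for x
  proof -
    have "((\<lambda>y. y) \<longlongrightarrow> x) (at x within S)" by (rule tendsto_ident_at)
    then have "((\<lambda>y. d y x) \<longlongrightarrow> 0) (at x within S)" by (simp add: tendsto_iff_d)
    then have "((\<lambda>y. f y - f x) \<longlongrightarrow> 0) (at x within S)"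
      by (rule tendsto_rabs_zero_cancel[OF tendsto_sandwich[OF _ _ tendsto_const], rotated 2])
         (use assms in auto)
    then show ?thesis by (simp add: LIM_zero_iff)
  qed
  then show ?thesis by (simp add: continuous_on_def)
qed

definition set_dist :: "'a set \<Rightarrow> 'a \<Rightarrow> real" where
  "set_dist S y = (INF x\<in>S. d y x)"

lemma bdd_below_d: "bdd_below (d y ` S)"
  using d_nonneg by (intro bdd_belowI[of _ 0]) auto

lemma set_dist_le: "x \<in> S \<Longrightarrow> set_dist S y \<le> d y x"
  unfolding set_dist_def by (rule cINF_lower[OF bdd_below_d])

lemma set_dist_nonneg: "S \<noteq> {} \<Longrightarrow> set_dist S y \<ge> 0"
  unfolding set_dist_def by (intro cINF_greatest) (use d_nonneg in auto)

lemma set_dist_less: "S \<noteq> {} \<Longrightarrow> set_dist S y < e \<Longrightarrow> \<exists>x\<in>S. d y x < e"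
  unfolding set_dist_def by (subst (asm) cINF_less_iff[OF _ bdd_below_d]) auto

lemma set_dist_zero: "S \<noteq> {} \<Longrightarrow> x \<in> S \<Longrightarrow> set_dist S x = 0"
  using set_dist_le[of x S x] set_dist_nonneg[of S x] d_eq_0[of x x] by simp

lemma set_dist_nonexpansive:
  assumes "S \<noteq> {}"
  shows "\<bar>set_dist S x - set_dist S y\<bar> \<le> d x y"
proof -
  have *: "set_dist S x - d x y \<le> set_dist S y" for x y
    unfolding set_dist_def[of S y]
  proof (rule cINF_greatest[OF assms])
    fix z assume "z \<in> S"
    then show "set_dist S x - d x y \<le> d y z"
      using set_dist_le[of z S x] d_triangle[of x z y] by linarith
  qed
  show ?thesis using *[of x y] *[of y x] d_commute[of x y] by linarith
qed

lemma continuous_on_set_dist: "S \<noteq> {} \<Longrightarrow> continuous_on T (set_dist S)"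
  by (rule continuous_on_nonexpansive) (rule set_dist_nonexpansive)

lemma set_dist_pos:
  assumes "open U" "x \<in> U" "- U \<noteq> {}"
  shows "set_dist (- U) x > 0"
proof -
  obtain e where e: "e > 0" "\<And>y. d x y < e \<Longrightarrow> y \<in> U" using assms open_iff by blast
  then have "\<not> set_dist (- U) x < e" using set_dist_less[OF assms(3), of x e] by auto
  then show ?thesis using e by linarith
qed

text \<open>The form in which the Palais-Smale condition delivers compactness.\<close>

lemma compact_sequentially:
  "compact K \<longleftrightarrow> (\<forall>x::nat\<Rightarrow>'a. range x \<subseteq> K \<longrightarrow> (\<exists>l\<in>K. \<exists>k. strict_mono k \<and> (x \<circ> k) \<longlonglongrightarrow> l))"
proof -
  have "compact K \<longleftrightarrow> compactin mtopology K" by (simp add: mtopology_eq)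
  then show ?thesis unfolding compactin_sequentially by (simp add: mtopology_eq Bex_def)
qed

text \<open>The distance to the complement of \<open>U\<close> is continuous and positive on
  \<open>K\<close>, so it attains a positive minimum there, which serves as
  \<open>e\<close>.\<close>

lemma compact_neighbourhood:
  assumes "compact K" "open U" "K \<subseteq> U" "K \<noteq> {}"
  obtains e where "e > 0" "\<And>y. set_dist K y < e \<Longrightarrow> y \<in> U"
proof (cases "- U = {}")
  case True
  then show ?thesis using that[of 1] by auto
next
  case False
  have "continuous_on K (set_dist (- U))" by (rule continuous_on_set_dist[OF False])
  then obtain x where x: "x \<in> K" "\<And>y. y \<in> K \<Longrightarrow> set_dist (- U) x \<le> set_dist (- U) y"
    using continuous_attains_inf[OF assms(1,4)] by blast
  show ?thesis
  proof (rule that)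
    show "set_dist (- U) x > 0" using set_dist_pos[OF assms(2) _ False] x assms(3) by blast
    fix y assume "set_dist K y < set_dist (- U) x"
    then obtain z where z: "z \<in> K" "d y z < set_dist (- U) x"
      using set_dist_less[OF assms(4)] by blast
    show "y \<in> U"
    proof (rule ccontr)
      assume "y \<notin> U"
      then have "set_dist (- U) z \<le> d z y" by (intro set_dist_le) auto
      then show False using z x(2)[OF z(1)] d_commute[of y z] by linarith
    qed
  qed
qed

text \<open>The estimate in the third clause is Ekeland's order \<open>y \<preceq> x \<longleftrightarrow> \<sigma> d(x, y) \<le> F x - F y\<close>.
  It is transitive and closed, so it survives iteration and limits.\<close>

definition local_descent ::
    "real \<Rightarrow> ('a \<Rightarrow> real) \<Rightarrow> 'a set \<Rightarrow> real \<Rightarrow> ('a \<times> real \<Rightarrow> 'a) \<Rightarrow> bool" where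
  "local_descent \<sigma> F U \<rho> H \<longleftrightarrow> open U \<and> \<rho> > 0 \<and> continuous_on (U \<times> {0..\<rho>}) H \<and>
     (\<forall>u\<in>U. H (u, 0) = u) \<and>
     (\<forall>u\<in>U. \<forall>t\<in>{0..\<rho>}. \<sigma> * d u (H (u, t)) \<le> F u - F (H (u, t))) \<and>
     (\<forall>u\<in>U. \<forall>t\<in>{0<..\<rho>}. F (H (u, t)) < F u)"

text \<open>The running time of the local descents is damped to zero at distance \<open>e\<close>
  from the sets \<open>A z\<close>. As these sets are \<open>3 * e\<close> apart, at most one
  descent is active near any given point, and a single map can perform all of them without any
  averaging.\<close>

lemma separated_descent:
  assumes desc: "\<And>z. z \<in> I \<Longrightarrow> local_descent \<sigma> F (U z) (\<rho> z) (H z)" and e: "e > 0"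
    and inner: "\<And>z x y. \<lbrakk>z \<in> I; x \<in> A z; d x y < 3 * e\<rbrakk> \<Longrightarrow> y \<in> U z"
    and sep: "\<And>z w x y. \<lbrakk>z \<in> I; w \<in> I; z \<noteq> w; x \<in> A z; y \<in> A w\<rbrakk> \<Longrightarrow> d x y \<ge> 3 * e"
  shows "\<exists>\<eta> :: 'a \<times> real \<Rightarrow> 'a. continuous_on (UNIV \<times> {0..1}) \<eta> \<and> (\<forall>x. \<eta> (x, 0) = x) \<and>
     (\<forall>x. \<forall>t\<in>{0..1}. \<sigma> * d x (\<eta> (x, t)) \<le> F x - F (\<eta> (x, t))) \<and>
     (\<forall>z\<in>I. \<forall>x\<in>A z. F (\<eta> (x, 1)) < F x)"
proof (cases "(\<Union>z\<in>I. A z) = {}")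
  case True
  have [simp]: "d x x = 0" for x using d_eq_0 by simp
  show ?thesis
    by (rule exI[of _ fst]) (use True in \<open>auto intro!: continuous_intros\<close>)
next
  case False
  define S where "S = (\<Union>z\<in>I. A z)"
  have Sne: "S \<noteq> {}" using False by (simp add: S_def)
  \<comment> \<open>The damping factor: 1 on the union of the sets \<open>A z\<close>, and 0 from
    distance \<open>e\<close> on.\<close>
  define \<tau> where "\<tau> y = max 0 (1 - set_dist S y / e)" for y
  have \<tau>cont: "continuous_on T \<tau>" for T
    unfolding \<tau>_def using e by (intro continuous_intros continuous_on_set_dist[OF Sne]) auto
  have \<tau>in: "0 \<le> \<tau> y" "\<tau> y \<le> 1" for y
    using set_dist_nonneg[OF Sne, of y] e by (auto simp: \<tau>_def)
  have near: "\<exists>z\<in>I. \<exists>x\<in>A z. d y x < e" if "\<tau> y > 0" for y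
  proof -
    have "set_dist S y / e < 1" using that by (simp add: \<tau>_def less_max_iff_disj)
    then have "set_dist S y < e" using e by simp
    then show ?thesis using set_dist_less[OF Sne] by (auto simp: S_def)
  qed
  define c where "c y = (SOME z. z \<in> I \<and> (\<exists>x\<in>A z. d y x < e))" for y
  have c: "c y \<in> I \<and> (\<exists>x\<in>A (c y). d y x < e)" if "\<tau> y > 0" for y
    unfolding c_def by (rule someI_ex) (use near[OF that] in blast)
  define \<eta> where "\<eta> = (\<lambda>(y, t). if \<tau> y > 0 then H (c y) (y, \<rho> (c y) * t * \<tau> y) else y)"
  have \<rho>: "\<rho> z > 0" "continuous_on (U z \<times> {0..\<rho> z}) (H z)" "\<And>u. u \<in> U z \<Longrightarrow> H z (u, 0) = u"
    "\<And>u t. u \<in> U z \<Longrightarrow> t \<in> {0..\<rho> z} \<Longrightarrow> \<sigma> * d u (H z (u, t)) \<le> F u - F (H z (u, t))"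
    "\<And>u t. u \<in> U z \<Longrightarrow> t \<in> {0<..\<rho> z} \<Longrightarrow> F (H z (u, t)) < F u"
    if "z \<in> I" for z
    using desc[OF that] by (auto simp: local_descent_def)
  have param: "\<rho> z * t * \<tau> y \<in> {0..\<rho> z}" if "z \<in> I" "t \<in> {0..1}" for z t y
  proof -
    have "t * \<tau> y \<le> 1" using that \<tau>in[of y] by (simp add: mult_le_one)
    then have "\<rho> z * (t * \<tau> y) \<le> \<rho> z * 1" using \<rho>(1)[OF that(1)] by (intro mult_left_mono) auto
    then show ?thesis using that \<tau>in[of y] \<rho>(1)[OF that(1)] by (simp add: mult.assoc)
  qed
  have cU: "y \<in> U (c y)" if y: "\<tau> y > 0" for y
  proof -
    obtain x where "x \<in> A (c y)" "d y x < e" using c[OF y] by blast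
    then show ?thesis using inner[of "c y" x y] c[OF y] d_commute[of x y] e by auto
  qed
  have "continuous_on (UNIV \<times> {0..1}) \<eta>"
  proof (rule continuous_on_local)
    fix p :: "'a \<times> real" assume p: "p \<in> UNIV \<times> {0..1}"
    obtain y0 t0 where p0: "p = (y0, t0)" by (cases p)
    define W where "W = {y. d y0 y < e / 2}"
    have W: "open W" "y0 \<in> W" using open_ball[of y0 "e / 2"] d_eq_0[of y0 y0] e by (simp_all add: W_def)
    have "continuous_on (W \<times> {0..1}) \<eta>"
    proof (cases "\<exists>z\<in>I. \<exists>x\<in>A z. d y0 x < 3 * e / 2")
      case True
      then obtain z x where z: "z \<in> I" "x \<in> A z" "d y0 x < 3 * e / 2" by blast
      have WU: "y \<in> U z" if "y \<in> W" for y
        using inner[OF z(1,2), of y] d_triangle[of x y y0] d_commute[of x y0] z(3) that e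
        by (auto simp: W_def)
      have eq: "\<eta> (y, t) = H z (y, \<rho> z * t * \<tau> y)" if y: "y \<in> W" for y t
      proof (cases "\<tau> y > 0")
        case True
        then obtain x' where x': "x' \<in> A (c y)" "d y x' < e" "c y \<in> I" using c by blast
        have "d x x' < 3 * e"
          using d_triangle[of x x' y0] d_triangle[of y0 x' y] d_commute[of x y0] z(3) x'(2) y
          by (auto simp: W_def)
        then have "c y = z" using sep[OF z(1) x'(3) _ z(2) x'(1)] by force
        then show ?thesis using True by (simp add: \<eta>_def)
      next
        case False
        then have "\<tau> y = 0" using \<tau>in[of y] by simp
        then show ?thesis using False \<rho>(3)[OF z(1)] WU[OF y] by (simp add: \<eta>_def)
      qed
      have "continuous_on (W \<times> {0..1}) (\<lambda>p. H z (fst p, \<rho> z * snd p * \<tau> (fst p)))"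
        by (rule continuous_on_compose2[OF \<rho>(2)[OF z(1)]])
           (use WU param z(1) in \<open>auto intro!: continuous_intros continuous_on_compose2[OF \<tau>cont]\<close>)
      then show ?thesis by (rule continuous_on_eq) (auto simp: eq)
    next
      case False
      have eq: "\<eta> (y, t) = y" if y: "y \<in> W" for y t
      proof -
        have "\<not> \<tau> y > 0"
        proof
          assume "\<tau> y > 0"
          then obtain z x where z: "z \<in> I" "x \<in> A z" "d y x < e" using near by blast
          then have "d y0 x < 3 * e / 2" using d_triangle[of y0 x y] y by (auto simp: W_def)
          then show False using False z by blast
        qed
        then show ?thesis by (simp add: \<eta>_def)
      qed
      have "continuous_on (W \<times> {0..1}) (fst :: 'a \<times> real \<Rightarrow> 'a)" by (intro continuous_intros)
      then show ?thesis by (rule continuous_on_eq) (auto simp: eq)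
    qed
    moreover have "(UNIV \<times> {0..1}) \<inter> (W \<times> UNIV) = W \<times> {0..1::real}" by auto
    ultimately show "\<exists>W. open W \<and> p \<in> W \<and> continuous_on (UNIV \<times> {0..1} \<inter> W) \<eta>"
      using W by (intro exI[of _ "W \<times> UNIV"]) (auto simp: open_Times p0)
  qed
  moreover have "\<eta> (x, 0) = x" for x
    using \<rho>(3)[of "c x" x] c[of x] cU[of x] by (auto simp: \<eta>_def)
  moreover have "\<sigma> * d x (\<eta> (x, t)) \<le> F x - F (\<eta> (x, t))" if "t \<in> {0..1}" for x t
  proof (cases "\<tau> x > 0")
    case True
    then show ?thesis using \<rho>(4)[of "c x" x] c[of x] cU[of x] param[of "c x" t x] that by (auto simp: \<eta>_def)
  next
    case False
    then show ?thesis using d_eq_0[of x x] by (simp add: \<eta>_def)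
  qed
  moreover have "F (\<eta> (x, 1)) < F x" if "z \<in> I" "x \<in> A z" for z x
  proof -
    have "x \<in> S" using that by (auto simp: S_def)
    then have "\<tau> x = 1" using set_dist_zero[OF Sne] by (simp add: \<tau>_def)
    then show ?thesis using \<rho>(5)[of "c x" x "\<rho> (c x)"] \<rho>(1)[of "c x"] c[of x] cU[of x]
      by (auto simp: \<eta>_def)
  qed
  ultimately show ?thesis by blast
qed

text \<open>Stone's \<open>\<sigma>\<close>-discrete refinement: the set \<open>A z n\<close> consists of the points whose first
  neighbourhood, with respect to a well-order of the centres, is \<open>U z\<close> and contains the ball of
  radius \<open>3 / 2\<^sup>n\<close>.\<close>

lemma countably_many_descents:
  assumes loc: "\<And>z. z \<in> D \<Longrightarrow> \<exists>U \<rho> H. z \<in> U \<and> local_descent \<sigma> F U \<rho> H"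
  obtains \<eta> :: "nat \<Rightarrow> 'a \<times> real \<Rightarrow> 'a" where
    "\<And>n. continuous_on (UNIV \<times> {0..1}) (\<eta> n)" "\<And>n x. \<eta> n (x, 0) = x"
    "\<And>n x t. t \<in> {0..1} \<Longrightarrow> \<sigma> * d x (\<eta> n (x, t)) \<le> F x - F (\<eta> n (x, t))"
    "\<And>x. x \<in> D \<Longrightarrow> \<exists>n. F (\<eta> n (x, 1)) < F x"
proof -
  obtain U \<rho> H where U: "\<And>z. z \<in> D \<Longrightarrow> z \<in> U z" "\<And>z. z \<in> D \<Longrightarrow> local_descent \<sigma> F (U z) (\<rho> z) (H z)"
    using loc by metis
  obtain r :: "('a \<times> 'a) set" where r: "well_order_on UNIV r" using well_order_on by blast
  then have wf: "wf (r - Id)" and tot: "total_on UNIV r"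
    by (auto simp: well_order_on_def linear_order_on_def)
  define e where "e n = (1/2::real) ^ n" for n
  define A where "A z n = {x. x \<in> U z \<and> (\<forall>w\<in>D. (w, z) \<in> r - Id \<longrightarrow> x \<notin> U w) \<and>
      (\<forall>y. d x y < 3 * e n \<longrightarrow> y \<in> U z)}" for z n
  have sep: "d x y \<ge> 3 * e n" if "z \<in> D" "w \<in> D" "z \<noteq> w" "x \<in> A z n" "y \<in> A w n" for z w x y n
  proof -
    \<comment> \<open>If \<open>z\<close> precedes \<open>w\<close>, points of \<open>A w n\<close>
      avoid \<open>U z\<close>, whereas \<open>U z\<close> contains the ball of radius
      \<open>3 * e n\<close> around each point of \<open>A z n\<close>.\<close>
    have *: "d x y \<ge> 3 * e n" if "z \<in> D" "(z, w) \<in> r - Id" "x \<in> A z n" "y \<in> A w n" for z w x y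
      using that unfolding A_def by force
    have "(z, w) \<in> r - Id \<or> (w, z) \<in> r - Id"
      using tot \<open>z \<noteq> w\<close> unfolding total_on_def by blast
    then show ?thesis using *[of z w x y] *[of w z y x] that d_commute[of x y] by auto
  qed
  have "\<exists>\<eta> :: 'a \<times> real \<Rightarrow> 'a. continuous_on (UNIV \<times> {0..1}) \<eta> \<and> (\<forall>x. \<eta> (x, 0) = x) \<and>
     (\<forall>x. \<forall>t\<in>{0..1}. \<sigma> * d x (\<eta> (x, t)) \<le> F x - F (\<eta> (x, t))) \<and>
     (\<forall>z\<in>D. \<forall>x\<in>A z n. F (\<eta> (x, 1)) < F x)" for n
  proof (rule separated_descent[of D \<sigma> F U \<rho> H "e n" "\<lambda>z. A z n"])
    show "e n > 0" by (simp add: e_def)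
    show "y \<in> U z" if "x \<in> A z n" "d x y < 3 * e n" for z x y
      using that by (auto simp: A_def)
  qed (use U(2) sep in auto)
  then obtain \<eta> :: "nat \<Rightarrow> 'a \<times> real \<Rightarrow> 'a" where \<eta>: "\<And>n. continuous_on (UNIV \<times> {0..1}) (\<eta> n)" "\<And>n x. \<eta> n (x, 0) = x"
     "\<And>n x t. t \<in> {0..1} \<Longrightarrow> \<sigma> * d x (\<eta> n (x, t)) \<le> F x - F (\<eta> n (x, t))"
     "\<And>n z x. \<lbrakk>z \<in> D; x \<in> A z n\<rbrakk> \<Longrightarrow> F (\<eta> n (x, 1)) < F x"
    by metis
  show thesis
  proof (rule that[of \<eta>, OF \<eta>(1,2,3)])
    fix x assume x: "x \<in> D"
    then have "x \<in> {z \<in> D. x \<in> U z}" using U(1) by simp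
    then obtain z where z: "z \<in> {z \<in> D. x \<in> U z}"
      "\<And>w. (w, z) \<in> r - Id \<Longrightarrow> w \<notin> {z \<in> D. x \<in> U z}"
      by (rule wfE_min[OF wf]) blast
    then have "open (U z)" using U(2) by (auto simp: local_descent_def)
    then obtain \<epsilon> where \<epsilon>: "\<epsilon> > 0" "\<And>y. d x y < \<epsilon> \<Longrightarrow> y \<in> U z"
      using z(1) unfolding open_iff by blast
    obtain n where "(1/2::real) ^ n < \<epsilon> / 3" using real_arch_pow_inv[of "\<epsilon> / 3" "1/2"] \<epsilon>(1) by auto
    then have "x \<in> A z n" using z \<epsilon> by (auto simp: A_def e_def)
    then have "F (\<eta> n (x, 1)) < F x" using z(1) by (intro \<eta>(4)[of z]) auto
    then show "\<exists>n. F (\<eta> n (x, 1)) < F x" ..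
  qed
qed

text \<open>The premise \<open>trap\<close> says that in Ekeland's order no route from
  \<open>A\<close> leaves \<open>D\<close> before \<open>F\<close> has dropped below \<beta>. It
  speaks about the order and not about particular orbits, so that it applies to the limit of an
  orbit, which the closed order still relates to the starting point. The homotopy is provided on a
  whole open set around \<open>A\<close>, as \<open>TC_homotopy\<close> demands.\<close>

theorem deformation:
  assumes complete: mcomplete and F: "continuous_on UNIV F" and \<sigma>: "\<sigma> > 0"
    and loc: "\<And>z. z \<in> D \<Longrightarrow> \<exists>U \<rho> H. z \<in> U \<and> local_descent \<sigma> F U \<rho> H"
    and trap: "\<And>x y. \<lbrakk>x \<in> A; \<sigma> * d x y \<le> F x - F y; \<beta> \<le> F y\<rbrakk> \<Longrightarrow> y \<in> D"
  obtains E h where "open E" "A \<subseteq> E" "continuous_on (E \<times> {0..1::real}) h"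
    "\<And>x. x \<in> E \<Longrightarrow> h (x, 0) = x" "\<And>x. x \<in> E \<Longrightarrow> F (h (x, 1)) < \<beta>"
proof -
  obtain \<eta> :: "nat \<Rightarrow> 'a \<times> real \<Rightarrow> 'a" where
    \<eta>: "\<And>n. continuous_on (UNIV \<times> {0..1}) (\<eta> n)" and \<eta>0: "\<And>n x. \<eta> n (x, 0) = x"
    and \<eta>d: "\<And>n x t. t \<in> {0..1} \<Longrightarrow> \<sigma> * d x (\<eta> n (x, t)) \<le> F x - F (\<eta> n (x, t))"
    and \<eta>D: "\<And>x. x \<in> D \<Longrightarrow> \<exists>n. F (\<eta> n (x, 1)) < F x"
    using countably_many_descents[of D \<sigma> F] loc by blast
  \<comment> \<open>Running through all pairs makes every index occur infinitely often as a first
    component.\<close>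
  define \<nu> where "\<nu> k = fst (prod_decode k)" for k
  \<comment> \<open>The deformation of step \<open>k\<close> is run during the time interval from
    \<open>k\<close> to \<open>k + 1\<close>; the clamp \<open>cl\<close> holds it at its start
    before and at its end afterwards. \<open>\<Phi> k (x, s)\<close> is the position at time
    \<open>s\<close> when only the first \<open>k\<close> steps are carried out.\<close>
  define cl where "cl k s = max 0 (min 1 (s - real k))" for k and s :: real
  define \<Phi> where "\<Phi> = rec_nat fst (\<lambda>k \<phi> p. \<eta> (\<nu> k) (\<phi> p, cl k (snd p)))"
  have \<Phi>0: "\<Phi> 0 (x, s) = x" and \<Phi>Suc: "\<Phi> (Suc k) (x, s) = \<eta> (\<nu> k) (\<Phi> k (x, s), cl k s)" for k x s
    by (simp_all add: \<Phi>_def)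
  have \<Phi>cont: "continuous_on T (\<Phi> k)" for k T
  proof (induction k)
    case 0
    then show ?case by (auto simp: \<Phi>_def intro!: continuous_intros)
  next
    case (Suc k)
    have "continuous_on T (\<lambda>p. \<eta> (\<nu> k) (\<Phi> k p, cl k (snd p)))"
      by (rule continuous_on_compose2[OF \<eta>]) (auto simp: cl_def intro!: continuous_intros Suc)
    then show ?case by (simp add: \<Phi>_def)
  qed
  have ek: "\<sigma> * d (\<Phi> k (x, s)) (\<Phi> (k + j) (x, s)) \<le> F (\<Phi> k (x, s)) - F (\<Phi> (k + j) (x, s))" for k j x s
  proof (induction j)
    case 0
    then show ?case using d_eq_0 by simp
  next
    case (Suc j)
    have "\<sigma> * d (\<Phi> (k + j) (x, s)) (\<Phi> (k + Suc j) (x, s)) \<le> F (\<Phi> (k + j) (x, s)) - F (\<Phi> (k + Suc j) (x, s))"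
      using \<eta>d[of "cl (k + j) s" "\<Phi> (k + j) (x, s)"] by (simp add: \<Phi>Suc cl_def)
    moreover have "\<sigma> * d (\<Phi> k (x, s)) (\<Phi> (k + Suc j) (x, s)) \<le>
       \<sigma> * d (\<Phi> k (x, s)) (\<Phi> (k + j) (x, s)) + \<sigma> * d (\<Phi> (k + j) (x, s)) (\<Phi> (k + Suc j) (x, s))"
      using \<sigma> d_triangle by (metis distrib_left mult_left_mono less_imp_le)
    ultimately show ?case using Suc by linarith
  qed
  have mono: "F (\<Phi> j (x, s)) \<le> F (\<Phi> k (x, s))" if "k \<le> j" for k j x s
  proof -
    have "0 \<le> \<sigma> * d (\<Phi> k (x, s)) (\<Phi> j (x, s))" using \<sigma> d_nonneg by simp
    then show ?thesis using ek[of k x s "j - k"] that by simp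
  qed
  have stable: "\<Phi> (k + j) (x, s) = \<Phi> k (x, s)" if "s \<le> real k" for k j x s
    using that by (induction j) (auto simp: \<Phi>Suc cl_def \<eta>0)
  have saturated: "\<Phi> k (x, s) = \<Phi> k (x, s')" if "real k \<le> s" "real k \<le> s'" for k x s s'
    using that by (induction k) (auto simp: \<Phi>0 \<Phi>Suc cl_def)
  define P where "P k x = \<Phi> k (x, real k)" for k x
  have P: "\<Phi> k (x, s) = P k x" if "real k \<le> s" for k x s
    unfolding P_def using that by (intro saturated) auto
  have PSuc: "P (Suc k) x = \<eta> (\<nu> k) (P k x, 1)" for k x
    using P[of k "real (Suc k)"] unfolding P_def by (simp add: \<Phi>Suc cl_def)
  have ekP: "\<sigma> * d (P k x) (P j x) \<le> F (P k x) - F (P j x)" if "k \<le> j" for k j x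
    using ek[of k x "real j" "j - k"] that P[of k "real j" x] by (simp add: P_def)
  have Pcont: "continuous_on T (P k)" for T k
    unfolding P_def by (rule continuous_on_compose2[OF \<Phi>cont[of UNIV]]) (auto intro!: continuous_intros)
  have reach: "\<exists>k. F (P k x) < \<beta>" if x: "x \<in> A" for x
  proof (rule ccontr)
    assume "\<not> ?thesis"
    then have low: "F (P k x) \<ge> \<beta>" for k by (simp add: not_less)
    have "decseq (\<lambda>k. F (P k x))"
    proof (rule decseq_SucI)
      show "F (P (Suc k) x) \<le> F (P k x)" for k
        using ekP[of k "Suc k" x] \<sigma> d_nonneg[of "P k x" "P (Suc k) x"]
        by (metis diff_ge_0_iff_ge le_SucI order_refl less_imp_le mult_nonneg_nonneg order_trans)
    qed
    then obtain L where L: "(\<lambda>k. F (P k x)) \<longlonglongrightarrow> L"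
      using decseq_convergent[of "\<lambda>k. F (P k x)" \<beta>] low by blast
    have "MCauchy (\<lambda>k. P k x)"
      unfolding MCauchy_def
    proof (intro conjI allI impI)
      fix \<epsilon> :: real assume \<epsilon>: "\<epsilon> > 0"
      have "Cauchy (\<lambda>k. F (P k x))" using L by (rule LIMSEQ_imp_Cauchy)
      then obtain M where M: "\<And>m n. \<lbrakk>m \<ge> M; n \<ge> M\<rbrakk> \<Longrightarrow> \<bar>F (P m x) - F (P n x)\<bar> < \<sigma> * \<epsilon>"
        using \<sigma> \<epsilon> unfolding Cauchy_def dist_real_def by (meson mult_pos_pos)
      have *: "d (P m x) (P n x) < \<epsilon>" if "m \<ge> M" "n \<ge> M" "m \<le> n" for m n
      proof -
        have "\<sigma> * d (P m x) (P n x) < \<sigma> * \<epsilon>" using ekP[OF that(3), of x] M[of m n] that by linarith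
        then show ?thesis using \<sigma> by simp
      qed
      show "\<exists>N. \<forall>n n'. N \<le> n \<longrightarrow> N \<le> n' \<longrightarrow> d (P n x) (P n' x) < \<epsilon>"
        by (intro exI[of _ M]) (metis * d_commute nle_le)
    qed auto
    then obtain y where y: "(\<lambda>k. P k x) \<longlonglongrightarrow> y"
      using complete unfolding mcomplete_def by (auto simp: mtopology_eq)
    have Fy: "(\<lambda>k. F (P k x)) \<longlonglongrightarrow> F y"
      using F y by (rule continuous_on_tendsto_compose) auto
    have "(\<lambda>k. d (P k x) y) \<longlonglongrightarrow> 0" using y by (simp add: tendsto_iff_d)
    then have "(\<lambda>k. \<sigma> * (d x y - d (P k x) y)) \<longlonglongrightarrow> \<sigma> * (d x y - 0)"
      by (intro tendsto_intros)
    moreover have "(\<lambda>k. F x - F (P k x)) \<longlonglongrightarrow> F x - F y" using Fy by (intro tendsto_intros)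
    moreover have "\<sigma> * (d x y - d (P k x) y) \<le> F x - F (P k x)" for k
    proof -
      \<comment> \<open>Ekeland's inequality between \<open>x\<close> and \<open>P k x\<close> is
        weakened to one whose left side visibly converges as \<open>P k x\<close> tends to
        \<open>y\<close>.\<close>
      have "d x y - d (P k x) y \<le> d x (P k x)" using d_triangle[of x y "P k x"] by simp
      then have "\<sigma> * (d x y - d (P k x) y) \<le> \<sigma> * d x (P k x)" using \<sigma> by simp
      also have "\<dots> \<le> F x - F (P k x)" using ekP[of 0 k x] by (simp add: P_def \<Phi>0)
      finally show ?thesis .
    qed
    ultimately have "\<sigma> * (d x y - 0) \<le> F x - F y"
      by (intro LIMSEQ_le[of _ _ "\<lambda>k. F x - F (P k x)"]) auto
    moreover have "\<beta> \<le> F y" using Fy low by (intro LIMSEQ_le_const) auto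
    ultimately have "y \<in> D" using trap[OF x] by simp
    then obtain n where n: "F (\<eta> n (y, 1)) < F y" using \<eta>D by blast
    \<comment> \<open>These are the steps at which \<open>\<eta> n\<close> is applied. Along them
      the heights before and after the step both tend to \<open>F y\<close>, which contradicts the
      strict drop under \<open>\<eta> n\<close> at \<open>y\<close>.\<close>
    define k where "k j = prod_encode (n, j)" for j
    have kt: "filterlim k at_top sequentially"
      unfolding k_def by (rule filterlim_at_top_mono[OF filterlim_ident]) (auto intro: always_eventually le_prod_encode_2)
    have "(\<lambda>j. F (P (Suc (k j)) x)) \<longlonglongrightarrow> F y"
      using Fy by (rule filterlim_compose) (rule filterlim_compose[OF filterlim_Suc kt])
    moreover have "(\<lambda>j. F (P (Suc (k j)) x)) \<longlonglongrightarrow> F (\<eta> n (y, 1))"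
    proof -
      have "P (Suc (k j)) x = \<eta> n (P (k j) x, 1)" for j by (simp add: PSuc \<nu>_def k_def)
      moreover have "continuous_on UNIV (\<lambda>z. F (\<eta> n (z, 1)))"
        by (rule continuous_on_compose2[OF F continuous_on_compose2[OF \<eta>]]) (auto intro!: continuous_intros)
      then have "(\<lambda>j. F (\<eta> n (P (k j) x, 1))) \<longlonglongrightarrow> F (\<eta> n (y, 1))"
        by (rule continuous_on_tendsto_compose) (use filterlim_compose[OF y kt] in auto)
      ultimately show ?thesis by simp
    qed
    ultimately show False using n LIMSEQ_unique by fastforce
  qed
  define E where "E k = {x. F (P k x) < \<beta>}" for k
  have Eopen: "open (E k)" for k
    unfolding E_def by (intro open_Collect_less continuous_on_compose2[OF F Pcont] continuous_intros) auto
  have Emono: "E k \<subseteq> E j" if "k \<le> j" for k j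
  proof
    fix x assume "x \<in> E k"
    moreover have "F (P j x) \<le> F (P k x)"
      using ekP[OF that, of x] \<sigma> d_nonneg[of "P k x" "P j x"] by (smt (verit) mult_nonneg_nonneg)
    ultimately show "x \<in> E j" by (simp add: E_def)
  qed
  \<comment> \<open>The first \<open>k\<close> with \<open>x \<in> E k\<close> is only upper
    semicontinuous in \<open>x\<close>, so it cannot be a stopping time. It is bounded from above by
    a continuous function, built from continuous weights \<open>w k\<close> that are positive
    exactly on \<open>E k\<close>.\<close>
  define w where "w k x = (if E k = UNIV then 1 else min 1 (set_dist (- E k) x))" for k x
  have Ene: "- E k \<noteq> {}" if "E k \<noteq> UNIV" for k using that by auto
  have wcont: "continuous_on T (w k)" for k T
    by (cases "E k = UNIV") (auto simp: w_def intro!: continuous_intros continuous_on_set_dist Ene)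
  have win: "0 \<le> w k x" "w k x \<le> 1" for k x
    using set_dist_nonneg[OF Ene, of k x] by (auto simp: w_def)
  have w0: "w k x = 0" if "x \<notin> E k" for k x
    using set_dist_zero[OF Ene, of k x] that by (auto simp: w_def)
  have wpos: "w k x > 0" if "x \<in> E k" for k x
    using set_dist_pos[OF Eopen that] Ene[of k] by (auto simp: w_def)
  \<comment> \<open>If \<open>j > 0\<close> is the first index with \<open>x \<in> E j\<close>, the
    series starts at \<open>j\<close>, whence \<open>S x \<le> 2 / 2 ^ j\<close> and
    \<open>1 / S x \<ge> 2 ^ (j - 1) \<ge> j\<close>. So \<open>1 / S\<close> is the continuous
    upper bound.\<close>
  define S where "S x = (\<Sum>k. (1/2) ^ k * w k x)" for x
  have geo: "summable (\<lambda>k. (1/2::real) ^ k)" by (rule summable_geometric) simp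
  have wgeo: "\<bar>(1/2) ^ k * w k x\<bar> \<le> (1/2) ^ k" for k x
    using win[of k x] by (simp add: abs_mult mult_left_le)
  have wsum: "summable (\<lambda>k. (1/2) ^ k * w k x)" for x
    by (rule summable_comparison_test'[OF geo, of 0]) (use wgeo in simp)
  have Scont: "continuous_on UNIV S"
  proof (rule uniform_limit_theorem)
    show "uniform_limit UNIV (\<lambda>n x. \<Sum>k<n. (1/2) ^ k * w k x) S sequentially"
      unfolding S_def by (rule Weierstrass_m_test[OF _ geo]) (use wgeo in simp)
    show "\<forall>\<^sub>F n in sequentially. continuous_on UNIV (\<lambda>x. \<Sum>k<n. (1/2) ^ k * w k x)"
      by (intro always_eventually allI continuous_intros wcont)
  qed simp
  define G where "G = (\<Union>k. E k)"
  have Gopen: "open G" using Eopen by (auto simp: G_def)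
  have Spos: "S x > 0" if x: "x \<in> G" for x
  proof -
    obtain k where k: "x \<in> E k" using x by (auto simp: G_def)
    show ?thesis unfolding S_def
      by (rule suminf_pos2[OF wsum, where i = k]) (use win wpos[OF k] in auto)
  qed
  define \<kappa> where "\<kappa> x = 1 / S x" for x
  have \<kappa>: "\<exists>j. x \<in> E j \<and> real j \<le> \<kappa> x" if x: "x \<in> G" for x
  proof -
    define j where "j = (LEAST k. x \<in> E k)"
    have j: "x \<in> E j" unfolding j_def by (rule LeastI_ex) (use x in \<open>auto simp: G_def\<close>)
    show ?thesis
    proof (cases j)
      case 0
      then show ?thesis using j Spos[OF x] by (intro exI[of _ 0]) (auto simp: \<kappa>_def)
    next
      case (Suc i)
      then have "x \<notin> E i" unfolding j_def by (metis lessI not_less_Least)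
      then have zero: "w k x = 0" if "k < j" for k
        using w0[of x k] Emono[of k i] that Suc by auto
      have "S x = (\<Sum>k. (1/2) ^ (k + j) * w (k + j) x) + (\<Sum>k<j. (1/2) ^ k * w k x)"
        unfolding S_def by (rule suminf_split_initial_segment[OF wsum])
      also have "\<dots> = (\<Sum>k. (1/2) ^ (k + j) * w (k + j) x)" using zero by simp
      also have "\<dots> \<le> (\<Sum>k. (1/2) ^ (k + j))"
      proof (rule suminf_le)
        show "summable (\<lambda>k. (1/2) ^ (k + j) * w (k + j) x)"
          using summable_ignore_initial_segment[OF wsum, of j x] .
        show "summable (\<lambda>k. (1/2::real) ^ (k + j))"
          using summable_ignore_initial_segment[OF geo, of j] .
      qed (use win in \<open>auto intro: mult_left_le\<close>)
      also have "\<dots> = (1/2) ^ j * 2"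
        using suminf_mult2[OF geo, of "(1/2) ^ j"] suminf_geometric[of "1/2::real"]
        by (simp add: power_add mult.commute)
      also have "\<dots> = 1 / 2 ^ i" using Suc by (simp add: power_divide)
      finally have "2 ^ i \<le> \<kappa> x" using Spos[OF x] by (simp add: \<kappa>_def field_simps)
      moreover have "real j \<le> 2 ^ i"
      proof -
        have "i < 2 ^ i" by (rule less_exp)
        then have "real (Suc i) \<le> real (2 ^ i)" by (simp only: of_nat_le_iff Suc_le_eq)
        then show ?thesis using Suc by simp
      qed
      ultimately show ?thesis using j by (meson order_trans)
    qed
  qed
  have \<kappa>cont: "continuous_on G \<kappa>"
    unfolding \<kappa>_def using Spos Scont
    by (intro continuous_intros) (auto elim: continuous_on_subset simp: less_imp_neq[THEN not_sym] dest: Spos)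
  have \<kappa>0: "\<kappa> x \<ge> 0" if "x \<in> G" for x using Spos[OF that] by (simp add: \<kappa>_def)
  \<comment> \<open>The number of steps jumps with \<open>x\<close>, but extra steps have not yet
    started by the stopping time and change nothing; near a given point one fixed \<open>N\<close>
    can therefore be used, which gives continuity.\<close>
  define h where "h = (\<lambda>(x, t). \<Phi> (nat \<lceil>\<kappa> x\<rceil>) (x, t * \<kappa> x))"
  have heq: "h (x, t) = \<Phi> N (x, t * \<kappa> x)" if "x \<in> G" "t \<in> {0..1}" "\<kappa> x \<le> real N" for x t N
  proof -
    have "nat \<lceil>\<kappa> x\<rceil> \<le> N" using that(3) by (simp add: ceiling_le_iff nat_le_iff)
    moreover have "t * \<kappa> x \<le> real (nat \<lceil>\<kappa> x\<rceil>)"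
    proof -
      have "t * \<kappa> x \<le> \<kappa> x" using that(2) \<kappa>0[OF that(1)] by (simp add: mult_left_le_one_le)
      then show ?thesis using real_nat_ceiling_ge[of "\<kappa> x"] by linarith
    qed
    ultimately show ?thesis using stable[of "t * \<kappa> x" "nat \<lceil>\<kappa> x\<rceil>" "N - nat \<lceil>\<kappa> x\<rceil>" x] by (simp add: h_def)
  qed
  show thesis
  proof (rule that[of G h])
    show "open G" by (rule Gopen)
    show "A \<subseteq> G" using reach by (auto simp: G_def E_def)
    show "continuous_on (G \<times> {0..1}) h"
    proof (rule continuous_on_local)
      fix p assume "p \<in> G \<times> {0..1::real}"
      then obtain x0 t0 where p: "p = (x0, t0)" "x0 \<in> G" by auto
      obtain N :: nat where N: "\<kappa> x0 < real N" using reals_Archimedean2 by blast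
      define W where "W = G \<inter> \<kappa> -` {..<real N}"
      have W: "open W" unfolding W_def by (rule continuous_open_preimage[OF \<kappa>cont Gopen]) simp
      have "continuous_on (W \<times> {0..1}) (\<lambda>p. \<Phi> N (fst p, snd p * \<kappa> (fst p)))"
        by (rule continuous_on_compose2[OF \<Phi>cont[of UNIV]])
           (auto simp: W_def intro!: continuous_intros continuous_on_compose2[OF \<kappa>cont])
      then have "continuous_on (W \<times> {0..1}) h"
        by (rule continuous_on_eq) (use heq[of _ _ N] in \<open>auto simp: W_def\<close>)
      moreover have "G \<times> {0..1} \<inter> W \<times> UNIV = W \<times> {0..1::real}" by (auto simp: W_def)
      ultimately show "\<exists>W. open W \<and> p \<in> W \<and> continuous_on (G \<times> {0..1} \<inter> W) h"
        using W N p by (intro exI[of _ "W \<times> UNIV"]) (auto simp: open_Times W_def)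
    qed
    show "h (x, 0) = x" if "x \<in> G" for x
      using stable[of 0 0 "nat \<lceil>\<kappa> x\<rceil>" x] by (simp add: h_def \<Phi>0)
    show "F (h (x, 1)) < \<beta>" if x: "x \<in> G" for x
    proof -
      obtain j where j: "x \<in> E j" "real j \<le> \<kappa> x" using \<kappa>[OF x] by blast
      have "j \<le> nat \<lceil>\<kappa> x\<rceil>" using j(2) by linarith
      then have "F (h (x, 1)) \<le> F (\<Phi> j (x, \<kappa> x))" using mono by (simp add: h_def)
      also have "\<dots> < \<beta>" using P[OF j(2)] j(1) by (simp add: E_def)
      finally show ?thesis .
    qed
  qed
qed

end

section \<open>The Riemannian distance\<close>

text \<open>The difference clause for lists of length 0 is the definition of the derivative. For
  length 1, with \<epsilon> equal to 1 and together with the bound on the second derivative, it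
  gives a Lipschitz estimate for the first derivative at each point, hence its continuity in
  operator norm.\<close>

lemma smooth_on_imp_C1:
  fixes f :: "'a::real_normed_vector \<Rightarrow> 'b::real_normed_vector"
  assumes "smooth_on U f"
  obtains f' :: "'a \<Rightarrow> 'a \<Rightarrow>\<^sub>L 'b" where "continuous_on U f'"
    "\<And>x. x \<in> U \<Longrightarrow> (f has_derivative blinfun_apply (f' x)) (at x)"
proof -
  have U: "open U" using assms unfolding smooth_on_def by (rule conjunct1)
  obtain D :: "'a \<Rightarrow> 'a list \<Rightarrow> 'b" where D: "\<forall>x\<in>U. D x [] = f x \<and>
        (\<forall>us ws. linear (\<lambda>v. D x (us @ v # ws))) \<and>
        (\<forall>n. \<exists>K. \<forall>vs. length vs = n \<longrightarrow> norm (D x vs) \<le> K * prod_list (map norm vs)) \<and>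
        (\<forall>n. \<forall>\<epsilon>>0. \<exists>\<delta>>0. \<forall>h. norm h < \<delta> \<longrightarrow> (\<forall>vs. length vs = n \<longrightarrow>
            norm (D (x + h) vs - D x vs - D x (h # vs)) \<le> \<epsilon> * norm h * prod_list (map norm vs)))"
    using assms unfolding smooth_on_def by (elim conjE exE)
  have D0: "D x [] = f x" if "x \<in> U" for x using bspec[OF D that] by (elim conjE)
  have lin: "linear (\<lambda>v. D x (us @ v # ws))" if "x \<in> U" for x us ws
    using bspec[OF D that] by (elim conjE) simp
  have bd: "\<exists>K. \<forall>vs. length vs = n \<longrightarrow> norm (D x vs) \<le> K * prod_list (map norm vs)" if "x \<in> U" for x n
    using bspec[OF D that] by (elim conjE) (rule spec)
  have der: "\<exists>\<delta>>0. \<forall>h. norm h < \<delta> \<longrightarrow> (\<forall>vs. length vs = n \<longrightarrow>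
            norm (D (x + h) vs - D x vs - D x (h # vs)) \<le> \<epsilon> * norm h * prod_list (map norm vs))"
    if "x \<in> U" "\<epsilon> > 0" for x n \<epsilon>
  proof -
    have "\<forall>n. \<forall>\<epsilon>>0. \<exists>\<delta>>0. \<forall>h. norm h < \<delta> \<longrightarrow> (\<forall>vs. length vs = n \<longrightarrow>
            norm (D (x + h) vs - D x vs - D x (h # vs)) \<le> \<epsilon> * norm h * prod_list (map norm vs))"
      using bspec[OF D that(1)] by (elim conjE)
    then show ?thesis using that(2) by (elim allE[of _ n] allE[of _ \<epsilon>] impE)
  qed
  have bl: "bounded_linear (\<lambda>v. D x [v])" if x: "x \<in> U" for x
  proof -
    obtain K where K: "\<And>vs. length vs = 1 \<Longrightarrow> norm (D x vs) \<le> K * prod_list (map norm vs)"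
      using bd[OF x] by blast
    have "norm (D x [v]) \<le> norm v * K" for v using K[of "[v]"] by (simp add: mult.commute)
    then show ?thesis
      using lin[OF x, of "[]" "[]"] by (intro bounded_linear.intro bounded_linear_axioms.intro) auto
  qed
  define f' where "f' x = Blinfun (\<lambda>v. D x [v])" for x
  have f': "blinfun_apply (f' x) = (\<lambda>v. D x [v])" if "x \<in> U" for x
    unfolding f'_def using bl[OF that] by (rule bounded_linear_Blinfun_apply)
  show thesis
  proof (rule that[of f'])
    show "(f has_derivative blinfun_apply (f' x)) (at x)" if x: "x \<in> U" for x
      unfolding has_derivative_at_alt
    proof (intro conjI allI impI)
      show "bounded_linear (blinfun_apply (f' x))" by (rule blinfun.bounded_linear_right)
      fix e :: real assume e: "e > 0"
      obtain \<delta> where \<delta>: "\<delta> > 0" "\<And>h. norm h < \<delta> \<Longrightarrow> norm (D (x + h) [] - D x [] - D x [h]) \<le> e * norm h"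
        using der[OF x e, of 0] by auto
      obtain r where r: "r > 0" "ball x r \<subseteq> U" using U x openE by blast
      have "norm (f y - f x - blinfun_apply (f' x) (y - x)) \<le> e * norm (y - x)"
        if y: "norm (y - x) < min \<delta> r" for y
      proof -
        have "y \<in> U" using y r by (auto simp: dist_norm norm_minus_commute)
        then show ?thesis using \<delta>(2)[of "y - x"] y x by (simp add: D0 f')
      qed
      then show "\<exists>d>0. \<forall>y. norm (y - x) < d \<longrightarrow>
          norm (f y - f x - blinfun_apply (f' x) (y - x)) \<le> e * norm (y - x)"
        using \<delta>(1) r(1) by (intro exI[of _ "min \<delta> r"]) auto
    qed
    show "continuous_on U f'"
    proof (rule continuous_at_imp_continuous_on, rule ballI)
      fix x assume x: "x \<in> U"
      obtain \<delta> where \<delta>: "\<delta> > 0" "\<And>h vs. \<lbrakk>norm h < \<delta>; length vs = 1\<rbrakk> \<Longrightarrow>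
          norm (D (x + h) vs - D x vs - D x (h # vs)) \<le> 1 * norm h * prod_list (map norm vs)"
        using der[OF x, of 1 1] by auto
      obtain K where K: "\<And>vs. length vs = 2 \<Longrightarrow> norm (D x vs) \<le> K * prod_list (map norm vs)"
        using bd[OF x] by blast
      obtain r where r: "r > 0" "ball x r \<subseteq> U" using U x openE by blast
      have lip: "norm (f' y - f' x) \<le> (1 + \<bar>K\<bar>) * norm (y - x)" if y: "norm (y - x) < min \<delta> r" for y
      proof (rule norm_blinfun_bound)
        fix v
        have yU: "y \<in> U" using y r by (auto simp: dist_norm norm_minus_commute)
        have "norm (D y [v] - D x [v]) \<le>
            norm (D y [v] - D x [v] - D x [y - x, v]) + norm (D x [y - x, v])"
          using norm_triangle_ineq[of "D y [v] - D x [v] - D x [y - x, v]" "D x [y - x, v]"] by simp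
        also have "\<dots> \<le> norm (y - x) * norm v + K * (norm (y - x) * norm v)"
          using \<delta>(2)[of "y - x" "[v]"] K[of "[y - x, v]"] y by simp
        also have "\<dots> \<le> norm (y - x) * norm v + \<bar>K\<bar> * (norm (y - x) * norm v)"
          by (intro add_left_mono mult_right_mono) auto
        finally show "norm (blinfun_apply (f' y - f' x) v) \<le> (1 + \<bar>K\<bar>) * norm (y - x) * norm v"
          using x yU by (simp add: blinfun.diff_left f' algebra_simps)
      qed auto
      have "((\<lambda>y. f' y - f' x) \<longlongrightarrow> 0) (at x)"
      proof (rule Lim_null_comparison)
        show "\<forall>\<^sub>F y in at x. norm (f' y - f' x) \<le> (1 + \<bar>K\<bar>) * norm (y - x)"
          unfolding eventually_at
          by (rule exI[of _ "min \<delta> r"]) (use \<delta>(1) r(1) lip in \<open>auto simp: dist_norm\<close>)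
        have "((\<lambda>y. (1 + \<bar>K\<bar>) * norm (y - x)) \<longlongrightarrow> (1 + \<bar>K\<bar>) * norm (x - x)) (at x)"
          by (intro tendsto_intros)
        then show "((\<lambda>y. (1 + \<bar>K\<bar>) * norm (y - x)) \<longlongrightarrow> 0) (at x)" by simp
      qed
      then show "continuous (at x) f'" by (simp add: continuous_at LIM_zero_iff)
    qed
  qed
qed

text \<open>The topological part of a manifold is kept separate because it passes to the power
  coordinate by coordinate, so that the facts about charts become available for both.\<close>

locale topological_atlas =
  fixes A :: "('c, 'm::topological_space, 'e::real_normed_vector) atlas"
  assumes cover: "(\<Union>c\<in>indices A. cdom A c) = UNIV"
    and open_cdom: "c \<in> indices A \<Longrightarrow> open (cdom A c)"
    and open_image: "c \<in> indices A \<Longrightarrow> open (chart_image A c)"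
    and homeo: "c \<in> indices A \<Longrightarrow> homeomorphism (cdom A c) (chart_image A c) (chart A c) (chart_inv A c)"
begin

lemma chart_at: "chart_at A x \<in> indices A" "x \<in> cdom A (chart_at A x)"
proof -
  have "\<exists>c. c \<in> indices A \<and> x \<in> cdom A c" using cover by blast
  then have "chart_at A x \<in> indices A \<and> x \<in> cdom A (chart_at A x)"
    unfolding chart_at_def by (rule someI_ex)
  then show "chart_at A x \<in> indices A" "x \<in> cdom A (chart_at A x)" by auto
qed

lemma chart_in: "x \<in> cdom A c \<Longrightarrow> chart A c x \<in> chart_image A c"
  by (simp add: chart_image_def)

lemma chart_inv_chart: "c \<in> indices A \<Longrightarrow> x \<in> cdom A c \<Longrightarrow> chart_inv A c (chart A c x) = x"
  using homeo by (auto simp: homeomorphism_def)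

lemma chart_inv_in: "c \<in> indices A \<Longrightarrow> y \<in> chart_image A c \<Longrightarrow> chart_inv A c y \<in> cdom A c"
  using homeo by (auto simp: homeomorphism_def)

lemma chart_chart_inv: "c \<in> indices A \<Longrightarrow> y \<in> chart_image A c \<Longrightarrow> chart A c (chart_inv A c y) = y"
  using homeo by (auto simp: homeomorphism_def)

lemma continuous_on_chart: "c \<in> indices A \<Longrightarrow> continuous_on (cdom A c) (chart A c)"
  using homeo by (auto simp: homeomorphism_def)

lemma continuous_on_chart_inv: "c \<in> indices A \<Longrightarrow> continuous_on (chart_image A c) (chart_inv A c)"
  using homeo by (auto simp: homeomorphism_def)

lemma open_chart_vimage: "c \<in> indices A \<Longrightarrow> open V \<Longrightarrow> open (cdom A c \<inter> chart A c -` V)"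
  by (rule continuous_open_preimage[OF continuous_on_chart open_cdom])

end

section \<open>Local estimates for the Riemannian metric\<close>

locale riemannian_manifold =
  fixes A :: "('c, 'm::t2_space, 'e::banach) atlas" and g :: "('c, 'm, 'e) metric_rep"
  assumes manifold: "banach_manifold A" and metric: "riemannian_metric A g"
begin

sublocale topological_atlas A
  using manifold unfolding banach_manifold_def by unfold_locales auto

definition gnorm :: "'c \<Rightarrow> 'm \<Rightarrow> 'e \<Rightarrow> real" where
  "gnorm c x v = sqrt (g c x v v)"

definition trans_deriv :: "'c \<Rightarrow> 'c \<Rightarrow> 'm \<Rightarrow> 'e \<Rightarrow> 'e" where
  "trans_deriv c c' x = frechet_derivative (transition A c c') (at (chart A c x))"

lemma transition_C1:
  assumes "c \<in> indices A" "c' \<in> indices A"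
  obtains T :: "'e \<Rightarrow> 'e \<Rightarrow>\<^sub>L 'e" where
    "continuous_on (chart A c ` (cdom A c \<inter> cdom A c')) T"
    "\<And>x. x \<in> cdom A c \<inter> cdom A c' \<Longrightarrow>
       (transition A c c' has_derivative blinfun_apply (T (chart A c x))) (at (chart A c x))"
    "\<And>x. x \<in> cdom A c \<inter> cdom A c' \<Longrightarrow> trans_deriv c c' x = blinfun_apply (T (chart A c x))"
proof -
  have "smooth_on (chart A c ` (cdom A c \<inter> cdom A c')) (transition A c c')"
    using manifold assms unfolding banach_manifold_def by blast
  then obtain T where T: "continuous_on (chart A c ` (cdom A c \<inter> cdom A c')) T"
    "\<And>y. y \<in> chart A c ` (cdom A c \<inter> cdom A c') \<Longrightarrow> (transition A c c' has_derivative blinfun_apply (T y)) (at y)"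
    using smooth_on_imp_C1 by blast
  show thesis
  proof (rule that[OF T(1)])
    fix x assume x: "x \<in> cdom A c \<inter> cdom A c'"
    then show *: "(transition A c c' has_derivative blinfun_apply (T (chart A c x))) (at (chart A c x))"
      by (intro T(2)) auto
    show "trans_deriv c c' x = blinfun_apply (T (chart A c x))"
      unfolding trans_deriv_def using frechet_derivative_at[OF *] by simp
  qed
qed

lemma transition_has_derivative:
  assumes "c \<in> indices A" "c' \<in> indices A" "x \<in> cdom A c \<inter> cdom A c'"
  shows "(transition A c c' has_derivative trans_deriv c c' x) (at (chart A c x))"
  using transition_C1[OF assms(1,2)] assms(3) by metis

lemma metric_transition:
  assumes "c \<in> indices A" "c' \<in> indices A" "x \<in> cdom A c \<inter> cdom A c'"
  shows "g c x v w = g c' x (trans_deriv c c' x v) (trans_deriv c c' x w)"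
  using metric assms unfolding riemannian_metric_def trans_deriv_def Let_def by blast

lemma metric_continuous:
  assumes "c \<in> indices A"
  obtains G :: "'e \<Rightarrow> 'e \<Rightarrow>\<^sub>L 'e \<Rightarrow>\<^sub>L real" where "continuous_on (chart_image A c) G"
    "\<And>x v w. x \<in> cdom A c \<Longrightarrow> g c x v w = blinfun_apply (blinfun_apply (G (chart A c x)) v) w"
proof -
  obtain G :: "'e \<Rightarrow> 'e \<Rightarrow>\<^sub>L 'e \<Rightarrow>\<^sub>L real" where G: "smooth_on (chart_image A c) G"
    "\<And>x v w. x \<in> cdom A c \<Longrightarrow> g c x v w = blinfun_apply (blinfun_apply (G (chart A c x)) v) w"
    using metric assms unfolding riemannian_metric_def by meson
  obtain G' where "\<And>y. y \<in> chart_image A c \<Longrightarrow> (G has_derivative blinfun_apply (G' y)) (at y)"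
    using smooth_on_imp_C1[OF G(1)] by blast
  then have "continuous_on (chart_image A c) G"
    by (meson continuous_at_imp_continuous_on has_derivative_continuous)
  then show thesis using that G(2) by blast
qed

lemma metric_sym: "c \<in> indices A \<Longrightarrow> x \<in> cdom A c \<Longrightarrow> g c x v w = g c x w v"
  using metric unfolding riemannian_metric_def by blast

lemma metric_coercive:
  "c \<in> indices A \<Longrightarrow> x \<in> cdom A c \<Longrightarrow> \<exists>\<delta>>0. \<forall>v. g c x v v \<ge> \<delta> * (norm v)\<^sup>2"
  using metric unfolding riemannian_metric_def by blast

lemma metric_nonneg: "c \<in> indices A \<Longrightarrow> x \<in> cdom A c \<Longrightarrow> g c x v v \<ge> 0"
  using metric_coercive by (metis less_imp_le mult_nonneg_nonneg order_trans zero_le_power2)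

lemma gnorm_nonneg: "c \<in> indices A \<Longrightarrow> x \<in> cdom A c \<Longrightarrow> gnorm c x v \<ge> 0"
  using metric_nonneg by (simp add: gnorm_def)

lemma gnorm_scale:
  assumes "c \<in> indices A" "x \<in> cdom A c"
  shows "gnorm c x (r *\<^sub>R v) = \<bar>r\<bar> * gnorm c x v"
proof -
  obtain G where G: "\<And>x v w. x \<in> cdom A c \<Longrightarrow> g c x v w = blinfun_apply (blinfun_apply (G (chart A c x)) v) w"
    using metric_continuous[OF assms(1)] by metis
  have "g c x (r *\<^sub>R v) (r *\<^sub>R v) = r\<^sup>2 * g c x v v"
    by (simp add: G[OF assms(2)] blinfun.scaleR_right blinfun.scaleR_left power2_eq_square)
  then show ?thesis by (simp add: gnorm_def real_sqrt_mult)
qed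

lemma gnorm_transition:
  assumes "c \<in> indices A" "c' \<in> indices A" "x \<in> cdom A c \<inter> cdom A c'"
  shows "gnorm c' x (trans_deriv c c' x v) = gnorm c x v"
  using metric_transition[OF assms] by (simp add: gnorm_def)

text \<open>Coercivity is given pointwise, with a constant depending on the point. Continuity of the
  local representative in operator norm makes it uniform: where \<open>G\<close> differs from its
  value at \<open>l\<close> by at most half the constant \<delta>, the other half of \<delta>
  survives. The result compares Riemannian length with the norm of the model space near
  \<open>l\<close>.\<close>

lemma gnorm_local_bounds:
  assumes c: "c \<in> indices A" and l: "l \<in> cdom A c"
  obtains e \<kappa> M where "e > 0" "\<kappa> > 0" "M \<ge> 0" "ball (chart A c l) e \<subseteq> chart_image A c"
    "\<And>y v. y \<in> ball (chart A c l) e \<Longrightarrow>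
       \<kappa> * norm v \<le> gnorm c (chart_inv A c y) v \<and> gnorm c (chart_inv A c y) v \<le> M * norm v"
proof -
  obtain G where G: "continuous_on (chart_image A c) G"
    "\<And>x v w. x \<in> cdom A c \<Longrightarrow> g c x v w = blinfun_apply (blinfun_apply (G (chart A c x)) v) w"
    using metric_continuous[OF c] by metis
  obtain \<delta> where \<delta>: "\<delta> > 0" "\<And>v. g c l v v \<ge> \<delta> * (norm v)\<^sup>2"
    using metric_coercive[OF c l] by blast
  let ?p = "chart A c l"
  have "continuous (at ?p) G"
    using G(1) open_image[OF c] chart_in[OF l] continuous_on_eq_continuous_at by blast
  then obtain e1 where e1: "e1 > 0" "\<And>y. dist y ?p < e1 \<Longrightarrow> dist (G y) (G ?p) < \<delta> / 2"
    unfolding continuous_at_eps_delta using \<delta>(1) by (meson half_gt_zero)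
  obtain e2 where e2: "e2 > 0" "ball ?p e2 \<subseteq> chart_image A c"
    using open_image[OF c] chart_in[OF l] openE by blast
  let ?e = "min e1 e2"
  let ?M = "norm (G ?p) + \<delta> / 2"
  have bounds: "\<delta> / 2 * (norm v)\<^sup>2 \<le> g c (chart_inv A c y) v v \<and> g c (chart_inv A c y) v v \<le> ?M * (norm v)\<^sup>2"
    if y: "y \<in> ball ?p ?e" for y v
  proof -
    have yi: "y \<in> chart_image A c" using y e2 by auto
    have gy: "g c (chart_inv A c y) v v = blinfun_apply (blinfun_apply (G y) v) v"
      using G(2)[OF chart_inv_in[OF c yi]] chart_chart_inv[OF c yi] by simp
    have gl: "g c l v v = blinfun_apply (blinfun_apply (G ?p) v) v" using G(2)[OF l] .
    have nd: "norm (G y - G ?p) \<le> \<delta> / 2" using e1(2)[of y] y by (auto simp: dist_norm norm_minus_commute)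
    have "\<bar>blinfun_apply (blinfun_apply (G y - G ?p) v) v\<bar> \<le> norm (blinfun_apply (G y - G ?p) v) * norm v"
      using norm_blinfun[of "blinfun_apply (G y - G ?p) v" v] by simp
    also have "\<dots> \<le> (norm (G y - G ?p) * norm v) * norm v"
      by (intro mult_right_mono norm_blinfun) auto
    also have "\<dots> \<le> \<delta> / 2 * norm v * norm v"
      using nd by (intro mult_right_mono) auto
    finally have diff: "\<bar>g c (chart_inv A c y) v v - g c l v v\<bar> \<le> \<delta> / 2 * (norm v)\<^sup>2"
      by (simp add: gy gl blinfun.diff_left power2_eq_square mult.assoc)
    have "g c l v v \<le> norm (blinfun_apply (G ?p) v) * norm v"
      unfolding gl using norm_blinfun[of "blinfun_apply (G ?p) v" v] by simp
    also have "\<dots> \<le> (norm (G ?p) * norm v) * norm v"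
      by (intro mult_right_mono norm_blinfun) auto
    finally have "g c l v v \<le> norm (G ?p) * (norm v)\<^sup>2" by (simp add: power2_eq_square mult.assoc)
    moreover have "?M * (norm v)\<^sup>2 = norm (G ?p) * (norm v)\<^sup>2 + \<delta> / 2 * (norm v)\<^sup>2"
      by (simp add: distrib_right)
    moreover have "\<delta> / 2 * (norm v)\<^sup>2 + \<delta> / 2 * (norm v)\<^sup>2 = \<delta> * (norm v)\<^sup>2" by simp
    ultimately show ?thesis using diff \<delta>(2)[of v] by linarith
  qed
  show thesis
  proof (rule that[of ?e "sqrt (\<delta> / 2)" "sqrt ?M"])
    fix y and v :: 'e assume y: "y \<in> ball ?p ?e"
    have "sqrt (\<delta> / 2) * norm v = sqrt (\<delta> / 2 * (norm v)\<^sup>2)" "sqrt ?M * norm v = sqrt (?M * (norm v)\<^sup>2)"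
      unfolding real_sqrt_mult by simp_all
    then show "sqrt (\<delta> / 2) * norm v \<le> gnorm c (chart_inv A c y) v \<and>
        gnorm c (chart_inv A c y) v \<le> sqrt ?M * norm v"
      using bounds[OF y, of v] by (simp only: gnorm_def real_sqrt_le_iff)
  qed (use e1 e2 \<delta> in \<open>auto simp: add_nonneg_nonneg\<close>)
qed

section \<open>Speed and length of piecewise C1 curves\<close>

definition speed_on :: "real \<Rightarrow> real \<Rightarrow> (real \<Rightarrow> 'm) \<Rightarrow> real \<Rightarrow> real" where
  "speed_on a b \<gamma> t = gnorm (chart_at A (\<gamma> t)) (\<gamma> t)
     (vector_derivative (\<lambda>s. chart A (chart_at A (\<gamma> t)) (\<gamma> s)) (at t within {a..b}))"

lemma speed_eq_speed_on: "speed A g \<gamma> = speed_on 0 1 \<gamma>"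
  by (simp add: fun_eq_iff speed_def speed_on_def gnorm_def Let_def)

lemma speed_on_nonneg: "speed_on a b \<gamma> t \<ge> 0"
  unfolding speed_on_def using gnorm_nonneg chart_at by blast

lemma speed_nonneg: "speed A g \<gamma> t \<ge> 0"
  by (simp add: speed_eq_speed_on speed_on_nonneg)

text \<open>The speed at time \<open>t\<close> is computed in the chart chosen at
  \<open>\<gamma> t\<close>, which may change erratically with \<open>t\<close>. The transition maps
  are isometries for the metric, so by the chain rule any one chart can be used over a whole stretch
  of the curve.\<close>

lemma speed_on_chart:
  assumes "a < b" "t \<in> {a..b}" and cont: "continuous (at t within {a..b}) \<gamma>"
    and c: "c \<in> indices A" "\<gamma> t \<in> cdom A c"
    and v: "((\<lambda>s. chart A c (\<gamma> s)) has_vector_derivative v) (at t within {a..b})"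
  shows "speed_on a b \<gamma> t = gnorm c (\<gamma> t) v"
proof -
  let ?c = "chart_at A (\<gamma> t)" and ?F = "at t within {a..b}"
  have x: "\<gamma> t \<in> cdom A c \<inter> cdom A ?c" using c chart_at by blast
  let ?T = "trans_deriv c ?c (\<gamma> t)"
  have T: "(transition A c ?c has_derivative ?T) (at (chart A c (\<gamma> t)))"
    by (rule transition_has_derivative) (use c chart_at x in auto)
  have "((\<lambda>s. transition A c ?c (chart A c (\<gamma> s))) has_derivative (\<lambda>h. ?T (h *\<^sub>R v))) ?F"
    using has_derivative_compose[OF v[unfolded has_vector_derivative_def] T] .
  moreover have "\<forall>\<^sub>F s in ?F. transition A c ?c (chart A c (\<gamma> s)) = chart A ?c (\<gamma> s)"
  proof -
    have "\<forall>\<^sub>F s in ?F. \<gamma> s \<in> cdom A c"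
      using cont open_cdom[OF c(1)] c(2) unfolding continuous_within by (rule topological_tendstoD)
    then show ?thesis
      by eventually_elim (simp add: transition_def chart_inv_chart[OF c(1)])
  qed
  ultimately have "((\<lambda>s. chart A ?c (\<gamma> s)) has_derivative (\<lambda>h. ?T (h *\<^sub>R v))) ?F"
    by (rule has_derivative_transform_eventually)
       (use assms(2) c in \<open>simp_all add: transition_def chart_inv_chart\<close>)
  moreover have "(\<lambda>h. ?T (h *\<^sub>R v)) = (\<lambda>h. h *\<^sub>R ?T v)"
    using has_derivative_linear[OF T] by (simp add: linear_cmul)
  ultimately have "((\<lambda>s. chart A ?c (\<gamma> s)) has_vector_derivative ?T v) ?F"
    by (simp add: has_vector_derivative_def)
  then have "vector_derivative (\<lambda>s. chart A ?c (\<gamma> s)) ?F = ?T v"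
    by (rule vector_derivative_within[rotated])
       (use assms(1,2) islimpt_Icc[of a b t] in \<open>auto simp: trivial_limit_within\<close>)
  then show ?thesis
    using gnorm_transition[OF c(1) chart_at(1) x, of v] by (simp add: speed_on_def)
qed

text \<open>At a break point the derivative within the unit interval, which \<open>speed\<close>
  uses, may fail to exist, while each piece has one-sided derivatives. The two notions are matched
  away from the ends, which is enough under the integral.\<close>

lemma speed_on_interior:
  assumes "t \<in> {a<..<b}" "{a..b} \<subseteq> {0..1}"
  shows "speed A g \<gamma> t = speed_on a b \<gamma> t"
proof -
  have "at t within {a..b} = at t" "at t within {0..1} = at t"
    using assms by (auto intro!: at_within_interior)
  then show ?thesis by (simp add: speed_eq_speed_on speed_on_def)
qed

lemma C1_curve_deriv:
  assumes "C1_curve_on A \<gamma> a b" "c \<in> indices A"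
  obtains v where "continuous_on {t\<in>{a..b}. \<gamma> t \<in> cdom A c} v"
    "\<And>t. t \<in> {a..b} \<Longrightarrow> \<gamma> t \<in> cdom A c \<Longrightarrow>
       ((\<lambda>s. chart A c (\<gamma> s)) has_vector_derivative v t) (at t within {a..b})"
  using assms unfolding C1_curve_on_def by meson

lemma continuous_on_speed_on:
  assumes C1: "C1_curve_on A \<gamma> a b" and ab: "a < b"
  shows "continuous_on {a..b} (speed_on a b \<gamma>)"
proof (rule continuous_on_local)
  have cont: "continuous_on {a..b} \<gamma>" using C1 by (simp add: C1_curve_on_def)
  fix t assume t: "t \<in> {a..b}"
  define c where "c = chart_at A (\<gamma> t)"
  have c: "c \<in> indices A" "\<gamma> t \<in> cdom A c" using chart_at by (auto simp: c_def)
  obtain v where v: "continuous_on {t\<in>{a..b}. \<gamma> t \<in> cdom A c} v"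
    "\<And>t. t \<in> {a..b} \<Longrightarrow> \<gamma> t \<in> cdom A c \<Longrightarrow>
       ((\<lambda>s. chart A c (\<gamma> s)) has_vector_derivative v t) (at t within {a..b})"
    using C1_curve_deriv[OF C1 c(1)] by metis
  obtain G where G: "continuous_on (chart_image A c) G"
    "\<And>x v w. x \<in> cdom A c \<Longrightarrow> g c x v w = blinfun_apply (blinfun_apply (G (chart A c x)) v) w"
    using metric_continuous[OF c(1)] by metis
  obtain W where W: "open W" "W \<inter> {a..b} = \<gamma> -` cdom A c \<inter> {a..b}"
    using cont open_cdom[OF c(1)] unfolding continuous_on_open_invariant by blast
  let ?D = "{a..b} \<inter> W"
  have D: "s \<in> {a..b}" "\<gamma> s \<in> cdom A c" if "s \<in> ?D" for s using that W(2) by auto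
  have cD: "continuous_on ?D (\<lambda>s. chart A c (\<gamma> s))"
    by (rule continuous_on_compose2[OF continuous_on_chart[OF c(1)] continuous_on_subset[OF cont]])
       (use D in auto)
  have "continuous_on ?D (\<lambda>s. G (chart A c (\<gamma> s)))"
    by (rule continuous_on_compose2[OF G(1) cD]) (use D chart_in in auto)
  moreover have "continuous_on ?D v" by (rule continuous_on_subset[OF v(1)]) (use D in auto)
  ultimately have "continuous_on ?D (\<lambda>s. sqrt (blinfun_apply (blinfun_apply (G (chart A c (\<gamma> s))) (v s)) (v s)))"
    by (intro continuous_intros)
  moreover have "speed_on a b \<gamma> s = sqrt (blinfun_apply (blinfun_apply (G (chart A c (\<gamma> s))) (v s)) (v s))"
    if s: "s \<in> ?D" for s
  proof -
    have "continuous (at s within {a..b}) \<gamma>" using cont D(1)[OF s] by (simp add: continuous_on_eq_continuous_within)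
    then have "speed_on a b \<gamma> s = gnorm c (\<gamma> s) (v s)"
      by (rule speed_on_chart[OF ab D(1)[OF s] _ c(1) D(2)[OF s] v(2)[OF D[OF s]]])
    then show ?thesis by (simp add: gnorm_def G(2)[OF D(2)[OF s]])
  qed
  ultimately have "continuous_on ?D (speed_on a b \<gamma>)" by (auto intro: continuous_on_eq)
  moreover have "t \<in> W" using W(2) t c(2) by auto
  ultimately show "\<exists>W. open W \<and> t \<in> W \<and> continuous_on ({a..b} \<inter> W) (speed_on a b \<gamma>)"
    using W(1) by blast
qed

lemma consecutive_cover:
  fixes S :: "real set"
  assumes "finite S" "S \<subseteq> {0..1}" "0 \<in> S" "1 \<in> S" "t \<in> {0..1}"
  obtains a b where "a \<in> S" "b \<in> S" "a < b" "S \<inter> {a<..<b} = {}" "t \<in> {a..b}"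
proof -
  have fin: "finite {s\<in>S. s \<le> t}" "finite {s\<in>S. t < s}" "finite {s\<in>S. s < 1}" using assms by auto
  show thesis
  proof (cases "t < 1")
    case True
    define a where "a = Max {s\<in>S. s \<le> t}"
    define b where "b = Min {s\<in>S. t < s}"
    have ne: "{s\<in>S. s \<le> t} \<noteq> {}" "{s\<in>S. t < s} \<noteq> {}" using assms True by auto
    have a: "a \<in> S" "a \<le> t" using Max_in[OF fin(1) ne(1)] by (auto simp: a_def)
    have b: "b \<in> S" "t < b" using Min_in[OF fin(2) ne(2)] by (auto simp: b_def)
    have "s \<le> a \<or> b \<le> s" if "s \<in> S" for s
      using Max_ge[OF fin(1), of s] Min_le[OF fin(2), of s] that by (force simp: a_def b_def)
    then show thesis using that[OF a(1) b(1)] a b by force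
  next
    case False
    \<comment> \<open>At \<open>t = 1\<close> no break point lies to the right, so the piece ending
      there is taken.\<close>
    define a where "a = Max {s\<in>S. s < 1}"
    have ne: "{s\<in>S. s < 1} \<noteq> {}" using assms by auto
    have a: "a \<in> S" "a < 1" using Max_in[OF fin(3) ne] by (auto simp: a_def)
    have "s \<le> a \<or> 1 \<le> s" if "s \<in> S" for s
      using Max_ge[OF fin(3), of s] that by (force simp: a_def)
    then show thesis using that[OF a(1) assms(4)] a assms(5) False by force
  qed
qed

text \<open>Consecutive break points cut the unit interval into finitely many closed pieces, over
  which continuity and integrability are assembled. The exceptional set of the third claim contains
  0 and 1, so the derivatives it speaks of are two-sided.\<close>

lemma piecewise_C1_curveD:
  assumes "piecewise_C1_curve A \<gamma>"
  shows "continuous_on {0..1} \<gamma>" "speed A g \<gamma> integrable_on {0..1}"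
    "\<exists>S. finite S \<and> 0 \<in> S \<and> 1 \<in> S \<and> (\<forall>t\<in>{0..1} - S. \<forall>c\<in>indices A. \<gamma> t \<in> cdom A c \<longrightarrow>
       (\<exists>v. ((\<lambda>s. chart A c (\<gamma> s)) has_vector_derivative v) (at t)))"
proof -
  obtain S where S: "finite S" "S \<subseteq> {0..1}" "0 \<in> S" "1 \<in> S"
    and C1: "\<And>a b. \<lbrakk>a \<in> S; b \<in> S; a < b; S \<inter> {a<..<b} = {}\<rbrakk> \<Longrightarrow> C1_curve_on A \<gamma> a b"
    using assms unfolding piecewise_C1_curve_def by metis
  define P where "P = {(a, b). a \<in> S \<and> b \<in> S \<and> a < b \<and> S \<inter> {a<..<b} = {}}"
  have fin: "finite P" by (rule finite_subset[of _ "S \<times> S"]) (use S in \<open>auto simp: P_def\<close>)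
  have C1P: "C1_curve_on A \<gamma> (fst p) (snd p)" "fst p < snd p" "{fst p..snd p} \<subseteq> {0..1}" if "p \<in> P" for p
    using that C1 S(2) by (auto simp: P_def subset_iff)
  have un: "(\<Union>p\<in>P. {fst p..snd p}) = {0..1}"
  proof
    show "(\<Union>p\<in>P. {fst p..snd p}) \<subseteq> {0..1}" using C1P(3) by blast
    show "{0..1} \<subseteq> (\<Union>p\<in>P. {fst p..snd p})"
    proof
      fix t :: real assume "t \<in> {0..1}"
      then obtain a b where "a \<in> S" "b \<in> S" "a < b" "S \<inter> {a<..<b} = {}" "t \<in> {a..b}"
        using consecutive_cover[OF S] by blast
      then show "t \<in> (\<Union>p\<in>P. {fst p..snd p})" by (intro UN_I[of "(a, b)"]) (auto simp: P_def)
    qed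
  qed
  have "continuous_on (\<Union>p\<in>P. {fst p..snd p}) \<gamma>"
    by (rule continuous_on_closed_Union[OF fin]) (use C1P(1) in \<open>auto simp: C1_curve_on_def\<close>)
  then show "continuous_on {0..1} \<gamma>" by (simp add: un)
  have int: "speed A g \<gamma> integrable_on {fst p..snd p}" if p: "p \<in> P" for p
  proof (rule integrable_spike_finite[of "{fst p, snd p}" _ _ "speed_on (fst p) (snd p) \<gamma>"])
    show "speed_on (fst p) (snd p) \<gamma> integrable_on {fst p..snd p}"
      using continuous_on_speed_on[OF C1P(1,2)[OF p]] by (rule integrable_continuous_real)
    show "speed A g \<gamma> t = speed_on (fst p) (snd p) \<gamma> t" if "t \<in> {fst p..snd p} - {fst p, snd p}" for t
      using that C1P(3)[OF p] by (intro speed_on_interior) auto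
  qed auto
  have "(speed A g \<gamma> has_integral (\<Sum>p\<in>P. integral {fst p..snd p} (speed A g \<gamma>))) (\<Union>p\<in>P. {fst p..snd p})"
  proof (rule has_integral_UN[OF fin])
    show "(speed A g \<gamma> has_integral integral {fst p..snd p} (speed A g \<gamma>)) {fst p..snd p}" if "p \<in> P" for p
      using int[OF that] by (rule integrable_integral)
    show "pairwise (\<lambda>p q. negligible ({fst p..snd p} \<inter> {fst q..snd q})) P"
    proof (rule pairwiseI)
      fix p q assume pq: "p \<in> P" "q \<in> P" "p \<noteq> q"
      obtain a b a' b' where p: "p = (a, b)" and q: "q = (a', b')" by (cases p; cases q)
      \<comment> \<open>A common point outside \<open>S\<close> would be interior to both pieces; as
        neither contains a break point in its interior, their ends would coincide.\<close>
      have "{fst p..snd p} \<inter> {fst q..snd q} \<subseteq> S"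
      proof (rule ccontr)
        assume "\<not> ?thesis"
        then obtain t where "t \<in> {fst p..snd p} \<inter> {fst q..snd q}" "t \<notin> S" by blast
        then have t: "t \<in> {a..b}" "t \<in> {a'..b'}" "t \<notin> S" by (simp_all add: p q)
        have ab: "a \<in> S" "b \<in> S" "a' \<in> S" "b' \<in> S" "S \<inter> {a<..<b} = {}" "S \<inter> {a'<..<b'} = {}"
          using pq by (auto simp: P_def p q)
        then have "a < t" "t < b" "a' < t" "t < b'" using t by (auto simp: less_le)
        then have "a = a'" "b = b'" using ab by (force simp: disjoint_iff)+
        then show False using pq(3) p q by simp
      qed
      then show "negligible ({fst p..snd p} \<inter> {fst q..snd q})"
        using S(1) negligible_finite negligible_subset by blast
    qed
  qed
  then show "speed A g \<gamma> integrable_on {0..1}" unfolding un by (rule has_integral_integrable)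
  have deriv: "\<exists>v. ((\<lambda>s. chart A c (\<gamma> s)) has_vector_derivative v) (at t)"
    if t: "t \<in> {0..1} - S" and c: "c \<in> indices A" "\<gamma> t \<in> cdom A c" for t c
  proof -
    obtain p where p: "p \<in> P" "t \<in> {fst p..snd p}" using t un by blast
    then have "t \<in> {fst p<..<snd p}" using t by (auto simp: P_def less_le)
    then have at: "at t within {fst p..snd p} = at t" by (auto intro!: at_within_interior)
    obtain v where "((\<lambda>s. chart A c (\<gamma> s)) has_vector_derivative v t) (at t within {fst p..snd p})"
      using C1_curve_deriv[OF C1P(1)[OF p(1)] c(1)] p(2) c(2) by metis
    then show ?thesis using at by auto
  qed
  show "\<exists>S. finite S \<and> 0 \<in> S \<and> 1 \<in> S \<and> (\<forall>t\<in>{0..1} - S. \<forall>c\<in>indices A. \<gamma> t \<in> cdom A c \<longrightarrow>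
       (\<exists>v. ((\<lambda>s. chart A c (\<gamma> s)) has_vector_derivative v) (at t)))"
    by (intro exI[of _ S] conjI ballI impI) (fact S deriv)+
qed

lemma speed_interior:
  assumes "t \<in> {0<..<1}"
    and "((\<lambda>s. chart A (chart_at A (\<gamma> t)) (\<gamma> s)) has_vector_derivative v) (at t)"
  shows "speed A g \<gamma> t = gnorm (chart_at A (\<gamma> t)) (\<gamma> t) v"
proof -
  have "at t within {0..1} = at t" using assms(1) by (auto intro!: at_within_interior)
  then show ?thesis
    using vector_derivative_at[OF assms(2)] by (simp add: speed_eq_speed_on speed_on_def)
qed

text \<open>With \<open>m\<close> of either sign, this covers both the concatenation and the reversal of curves.\<close>

lemma speed_affine:
  assumes t: "t \<in> {0<..<1}" "m * t + q \<in> {0<..<1}" and eq: "\<forall>\<^sub>F s in nhds t. \<gamma>' s = \<gamma> (m * s + q)"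
    and v: "((\<lambda>s. chart A (chart_at A (\<gamma> (m * t + q))) (\<gamma> s)) has_vector_derivative v) (at (m * t + q))"
  shows "speed A g \<gamma>' t = \<bar>m\<bar> * speed A g \<gamma> (m * t + q)"
proof -
  have eqt: "\<gamma>' t = \<gamma> (m * t + q)" using eventually_nhds_x_imp_x[OF eq] .
  let ?c = "chart_at A (\<gamma> (m * t + q))"
  have "((\<lambda>s. m * s + q) has_vector_derivative m) (at t)"
    by (auto intro!: derivative_eq_intros simp: has_real_derivative_iff_has_vector_derivative[symmetric])
  then have "((\<lambda>s. chart A ?c (\<gamma> (m * s + q))) has_vector_derivative m *\<^sub>R v) (at t)"
    using vector_diff_chain_at[where f = "\<lambda>s. m * s + q", OF _ v] by (simp add: o_def)
  then have "((\<lambda>s. chart A ?c (\<gamma>' s)) has_vector_derivative m *\<^sub>R v) (at t)"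
    unfolding has_vector_derivative_def
    by (rule has_derivative_transform_eventually)
       (use eq eqt in \<open>auto simp: eventually_nhds_conv_at elim: eventually_mono\<close>)
  then have "speed A g \<gamma>' t = gnorm ?c (\<gamma>' t) (m *\<^sub>R v)"
    using speed_interior[OF t(1), of \<gamma>' "m *\<^sub>R v"] eqt by simp
  then show ?thesis
    using speed_interior[OF t(2) v] gnorm_scale[OF chart_at] eqt by simp
qed

lemma C1_curve_affine:
  assumes C1: "C1_curve_on A \<gamma> a b" and sub: "\<And>t. t \<in> {a'..b'} \<Longrightarrow> m * t + q \<in> {a..b}"
    and eq: "\<And>t. t \<in> {a'..b'} \<Longrightarrow> \<gamma>' t = \<gamma> (m * t + q)"
  shows "C1_curve_on A \<gamma>' a' b'"
  unfolding C1_curve_on_def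
proof (intro conjI ballI)
  have "continuous_on {a'..b'} (\<lambda>t. \<gamma> (m * t + q))"
    by (rule continuous_on_compose2[of "{a..b}" \<gamma>])
       (use C1 sub in \<open>auto simp: C1_curve_on_def intro!: continuous_intros\<close>)
  then show "continuous_on {a'..b'} \<gamma>'" using eq by (auto intro: continuous_on_eq)
  fix c assume c: "c \<in> indices A"
  obtain v where v: "continuous_on {t\<in>{a..b}. \<gamma> t \<in> cdom A c} v"
    "\<And>t. t \<in> {a..b} \<Longrightarrow> \<gamma> t \<in> cdom A c \<Longrightarrow>
       ((\<lambda>s. chart A c (\<gamma> s)) has_vector_derivative v t) (at t within {a..b})"
    using C1_curve_deriv[OF C1 c] by metis
  show "\<exists>v. continuous_on {t\<in>{a'..b'}. \<gamma>' t \<in> cdom A c} v \<and> (\<forall>t\<in>{a'..b'}. \<gamma>' t \<in> cdom A c \<longrightarrow>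
     ((\<lambda>s. chart A c (\<gamma>' s)) has_vector_derivative v t) (at t within {a'..b'}))"
  proof (intro exI conjI ballI impI)
    have "continuous_on {t\<in>{a'..b'}. \<gamma>' t \<in> cdom A c} (\<lambda>t. v (m * t + q))"
    proof (rule continuous_on_compose2[OF v(1)])
      show "continuous_on {t\<in>{a'..b'}. \<gamma>' t \<in> cdom A c} (\<lambda>t. m * t + q)"
        by (intro continuous_intros)
      show "(\<lambda>t. m * t + q) ` {t\<in>{a'..b'}. \<gamma>' t \<in> cdom A c} \<subseteq> {t\<in>{a..b}. \<gamma> t \<in> cdom A c}"
      proof (rule image_subsetI)
        fix t assume "t \<in> {t\<in>{a'..b'}. \<gamma>' t \<in> cdom A c}"
        then have "t \<in> {a'..b'}" "\<gamma>' t \<in> cdom A c" by blast+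
        then show "m * t + q \<in> {t\<in>{a..b}. \<gamma> t \<in> cdom A c}" using sub[of t] eq[of t] by simp
      qed
    qed
    then show "continuous_on {t\<in>{a'..b'}. \<gamma>' t \<in> cdom A c} (\<lambda>t. m *\<^sub>R v (m * t + q))"
      by (intro continuous_intros)
    fix t assume t: "t \<in> {a'..b'}" "\<gamma>' t \<in> cdom A c"
    have "((\<lambda>s. m * s + q) has_vector_derivative m) (at t within {a'..b'})"
      by (auto intro!: derivative_eq_intros simp: has_real_derivative_iff_has_vector_derivative[symmetric])
    moreover have "((\<lambda>s. chart A c (\<gamma> s)) has_vector_derivative v (m * t + q))
        (at (m * t + q) within (\<lambda>s. m * s + q) ` {a'..b'})"
    proof (rule has_vector_derivative_within_subset[OF v(2)])
      show "m * t + q \<in> {a..b}" "\<gamma> (m * t + q) \<in> cdom A c" using sub[OF t(1)] t eq by simp_all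
      show "(\<lambda>s. m * s + q) ` {a'..b'} \<subseteq> {a..b}" using sub by blast
    qed
    ultimately have "((\<lambda>s. chart A c (\<gamma> (m * s + q))) has_vector_derivative m *\<^sub>R v (m * t + q)) (at t within {a'..b'})"
      using vector_diff_chain_within[of "\<lambda>s. m * s + q" m t "{a'..b'}" "\<lambda>s. chart A c (\<gamma> s)"]
      unfolding o_def by blast
    then show "((\<lambda>s. chart A c (\<gamma>' s)) has_vector_derivative m *\<^sub>R v (m * t + q)) (at t within {a'..b'})"
      by (rule has_vector_derivative_transform[OF t(1), rotated]) (simp add: eq)
  qed
qed

section \<open>The Riemannian distance as an extended pseudometric\<close>

abbreviation rd :: "'m \<Rightarrow> 'm \<Rightarrow> ereal" where
  "rd \<equiv> riemannian_dist A g"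

lemma rd_le:
  assumes "piecewise_C1_curve A \<gamma>" "\<gamma> 0 = x" "\<gamma> 1 = y"
  shows "rd x y \<le> ereal (integral {0..1} (speed A g \<gamma>))"
  unfolding riemannian_dist_def by (rule INF_lower) (simp add: assms)

lemma rd_nonneg: "rd x y \<ge> 0"
  unfolding riemannian_dist_def
proof (rule INF_greatest)
  fix \<gamma> assume "\<gamma> \<in> {\<gamma>. piecewise_C1_curve A \<gamma> \<and> \<gamma> 0 = x \<and> \<gamma> 1 = y}"
  then have "integral {0..1} (speed A g \<gamma>) \<ge> 0"
    by (intro integral_nonneg piecewise_C1_curveD(2)) (auto simp: speed_nonneg)
  then show "0 \<le> ereal (integral {0..1} (speed A g \<gamma>))" by simp
qed

lemma rd_lessD:
  assumes "rd x y < ereal r"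
  obtains \<gamma> where "piecewise_C1_curve A \<gamma>" "\<gamma> 0 = x" "\<gamma> 1 = y" "integral {0..1} (speed A g \<gamma>) < r"
  using assms unfolding riemannian_dist_def INF_less_iff by auto

text \<open>The factor \<open>\<bar>m\<bar>\<close> of the chain rule cancels against the one of the
  substitution. The ends and the preimages of break points, where the chain rule may fail, form a
  finite set that the integral ignores.\<close>

lemma speed_integral_affine:
  assumes pw: "piecewise_C1_curve A \<gamma>" and m: "m \<noteq> 0" and ab: "{a..b} \<subseteq> {0..1}"
    and im: "(\<lambda>t. m * t + q) ` {a..b} = {0..1}"
    and eq: "\<And>t. t \<in> {a..b} \<Longrightarrow> \<gamma>' t = \<gamma> (m * t + q)"
  shows "(speed A g \<gamma>' has_integral integral {0..1} (speed A g \<gamma>)) {a..b}"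
proof -
  obtain S where S: "finite S" "0 \<in> S" "1 \<in> S"
    and der: "\<And>t c. \<lbrakk>t \<in> {0..1} - S; c \<in> indices A; \<gamma> t \<in> cdom A c\<rbrakk> \<Longrightarrow>
       \<exists>v. ((\<lambda>s. chart A c (\<gamma> s)) has_vector_derivative v) (at t)"
    using piecewise_C1_curveD(3)[OF pw] by (elim exE conjE) blast
  let ?I = "integral {0..1} (speed A g \<gamma>)"
  let ?inv = "\<lambda>x. (1 / m) *\<^sub>R x + - ((1 / m) *\<^sub>R q)"
  have "(speed A g \<gamma> has_integral ?I) (cbox 0 1)"
    using piecewise_C1_curveD(2)[OF pw] by (simp add: integrable_integral)
  from has_integral_affinity[OF this m, of q]
  have "((\<lambda>x. speed A g \<gamma> (m * x + q)) has_integral ?I / \<bar>m\<bar>) (?inv ` {0..1})"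
    by simp
  moreover have "?inv ` {0..1} = {a..b}"
    unfolding im[symmetric] image_image using m by (simp add: add_divide_distrib)
  ultimately have "((\<lambda>x. speed A g \<gamma> (m * x + q)) has_integral ?I / \<bar>m\<bar>) {a..b}" by simp
  then have *: "((\<lambda>x. \<bar>m\<bar> * speed A g \<gamma> (m * x + q)) has_integral \<bar>m\<bar> * (?I / \<bar>m\<bar>)) {a..b}"
    by (rule has_integral_mult_right)
  show ?thesis
  proof (rule has_integral_spike_finite[of "{a, b} \<union> ?inv ` S"])
    show "finite ({a, b} \<union> ?inv ` S)" using S(1) by simp
    show "((\<lambda>x. \<bar>m\<bar> * speed A g \<gamma> (m * x + q)) has_integral ?I) {a..b}" using * m by simp
    fix t assume t: "t \<in> {a..b} - ({a, b} \<union> ?inv ` S)"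
    have "t = ?inv (m * t + q)" using m by (simp add: add_divide_distrib)
    then have nS: "m * t + q \<notin> S" using t by blast
    have "m * t + q \<in> {0..1}" unfolding im[symmetric] using t by blast
    then have mt: "m * t + q \<in> {0..1} - S" "m * t + q \<in> {0<..<1}" using nS S(2,3) by (auto simp: less_le)
    have tab: "t \<in> {a<..<b}" using t by auto
    have "\<forall>\<^sub>F s in nhds t. s \<in> {a<..<b}" using tab by (intro eventually_nhds_in_open) auto
    then have ev: "\<forall>\<^sub>F s in nhds t. \<gamma>' s = \<gamma> (m * s + q)"
      by eventually_elim (simp add: eq)
    obtain v where "((\<lambda>s. chart A (chart_at A (\<gamma> (m * t + q))) (\<gamma> s)) has_vector_derivative v) (at (m * t + q))"
      using der[OF mt(1) chart_at] by blast
    moreover have "a \<in> {0..1}" "b \<in> {0..1}" using ab tab by (auto simp: subset_iff)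
    then have "t \<in> {0<..<1}" using tab by auto
    ultimately show "speed A g \<gamma>' t = \<bar>m\<bar> * speed A g \<gamma> (m * t + q)"
      using speed_affine[OF _ mt(2) ev] by blast
  qed
qed

lemma rd_sym_le: "rd x y \<le> rd y x"
proof (rule ereal_le_real)
  fix r assume r: "rd y x \<le> ereal r"
  show "rd x y \<le> ereal r"
  proof (rule ereal_le_epsilon2)
    fix \<epsilon> :: real assume "\<epsilon> > 0"
    then have "rd y x < ereal (r + \<epsilon>)" using r by (metis ereal_less_eq(3) less_add_same_cancel1 linorder_not_less order_trans)
    then obtain \<gamma> where \<gamma>: "piecewise_C1_curve A \<gamma>" "\<gamma> 0 = y" "\<gamma> 1 = x" "integral {0..1} (speed A g \<gamma>) < r + \<epsilon>"
      by (rule rd_lessD)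
    obtain S where S: "finite S" "S \<subseteq> {0..1}" "0 \<in> S" "1 \<in> S"
      and C1: "\<And>a b. \<lbrakk>a \<in> S; b \<in> S; a < b; S \<inter> {a<..<b} = {}\<rbrakk> \<Longrightarrow> C1_curve_on A \<gamma> a b"
      using \<gamma>(1) unfolding piecewise_C1_curve_def by metis
    define \<gamma>' where "\<gamma>' t = \<gamma> (- 1 * t + 1)" for t
    have "piecewise_C1_curve A \<gamma>'"
      unfolding piecewise_C1_curve_def
    proof (intro exI[of _ "(\<lambda>s. 1 - s) ` S"] conjI ballI impI)
      show "finite ((\<lambda>s. 1 - s) ` S)" using S by simp
      show "(\<lambda>s. 1 - s) ` S \<subseteq> {0..1}" using S(2) by (auto simp: subset_iff)
      show "0 \<in> (\<lambda>s. 1 - s) ` S" "1 \<in> (\<lambda>s. 1 - s) ` S" using S(3,4) by force+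
      fix a b assume ab: "a \<in> (\<lambda>s. 1 - s) ` S" "b \<in> (\<lambda>s. 1 - s) ` S"
        "a < b \<and> (\<lambda>s. 1 - s) ` S \<inter> {a<..<b} = {}"
      have "S \<inter> {1 - b<..<1 - a} = {}"
      proof (rule ccontr)
        assume "\<not> ?thesis"
        then obtain s where "s \<in> S" "1 - b < s" "s < 1 - a" by auto
        then have "1 - s \<in> (\<lambda>s. 1 - s) ` S \<inter> {a<..<b}" by auto
        then show False using ab(3) by blast
      qed
      then have "C1_curve_on A \<gamma> (1 - b) (1 - a)" using ab by (intro C1) auto
      then show "C1_curve_on A \<gamma>' a b"
        by (rule C1_curve_affine[where m = "- 1" and q = 1]) (auto simp: \<gamma>'_def)
    qed
    moreover have "(speed A g \<gamma>' has_integral integral {0..1} (speed A g \<gamma>)) {0..1}"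
    proof (rule speed_integral_affine[OF \<gamma>(1), of "- 1" _ _ 1])
      show "(\<lambda>t. - 1 * t + 1) ` {0..1} = {0..1::real}"
      proof (intro set_eqI iffI)
        fix x :: real assume "x \<in> {0..1}"
        then show "x \<in> (\<lambda>t. - 1 * t + 1) ` {0..1}" by (intro image_eqI[of _ _ "1 - x"]) auto
      qed auto
    qed (auto simp: \<gamma>'_def)
    ultimately have "rd x y \<le> ereal (integral {0..1} (speed A g \<gamma>))"
      using rd_le[of \<gamma>' x y] \<gamma>(2,3) by (simp add: \<gamma>'_def integral_unique)
    also have "\<dots> \<le> ereal (r + \<epsilon>)" using \<gamma>(4) by simp
    finally show "rd x y \<le> ereal r + ereal \<epsilon>" by simp
  qed
qed

lemma rd_sym: "rd x y = rd y x"
  by (rule antisym) (rule rd_sym_le)+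

text \<open>Strict real bounds hand over actual curves, which can be concatenated; the form also
  avoids sums of infinite distances.\<close>

lemma rd_triangle_less:
  assumes "rd x y < ereal r" "rd y z < ereal s"
  shows "rd x z < ereal (r + s)"
proof -
  obtain \<alpha> where \<alpha>: "piecewise_C1_curve A \<alpha>" "\<alpha> 0 = x" "\<alpha> 1 = y" "integral {0..1} (speed A g \<alpha>) < r"
    using assms(1) by (rule rd_lessD)
  obtain \<beta> where \<beta>: "piecewise_C1_curve A \<beta>" "\<beta> 0 = y" "\<beta> 1 = z" "integral {0..1} (speed A g \<beta>) < s"
    using assms(2) by (rule rd_lessD)
  obtain S where S: "finite S" "S \<subseteq> {0..1}" "0 \<in> S" "1 \<in> S"
    and C1: "\<And>a b. \<lbrakk>a \<in> S; b \<in> S; a < b; S \<inter> {a<..<b} = {}\<rbrakk> \<Longrightarrow> C1_curve_on A \<alpha> a b"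
    using \<alpha>(1) unfolding piecewise_C1_curve_def by metis
  obtain T where T: "finite T" "T \<subseteq> {0..1}" "0 \<in> T" "1 \<in> T"
    and C1': "\<And>a b. \<lbrakk>a \<in> T; b \<in> T; a < b; T \<inter> {a<..<b} = {}\<rbrakk> \<Longrightarrow> C1_curve_on A \<beta> a b"
    using \<beta>(1) unfolding piecewise_C1_curve_def by metis
  define \<gamma> where "\<gamma> t = (if t \<le> 1/2 then \<alpha> (2 * t + 0) else \<beta> (2 * t + - 1))" for t :: real
  have \<gamma>1: "\<gamma> t = \<alpha> (2 * t + 0)" if "t \<in> {a..1/2}" for t a using that by (simp add: \<gamma>_def)
  have \<gamma>2: "\<gamma> t = \<beta> (2 * t + - 1)" if "t \<in> {1/2..b}" for t b
  proof (cases "t = 1/2")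
    case True
    then have "2 * t + 0 = 1" "2 * t + - 1 = 0" by simp_all
    then show ?thesis using \<alpha>(3) \<beta>(2) True by (simp only: \<gamma>_def) simp
  next
    case False
    then show ?thesis using that by (simp add: \<gamma>_def)
  qed
  \<comment> \<open>Since \<open>1 \<in> S\<close>, the junction \<open>1/2\<close> is itself a
    break point, and no piece extends over both curves.\<close>
  define R where "R = (\<lambda>s. s / 2) ` S \<union> (\<lambda>s. (s + 1) / 2) ` T"
  have "piecewise_C1_curve A \<gamma>"
    unfolding piecewise_C1_curve_def
  proof (intro exI[of _ R] conjI ballI impI)
    show "finite R" using S T by (simp add: R_def)
    show "R \<subseteq> {0..1}" using S(2) T(2) by (fastforce simp: R_def)
    show "0 \<in> R" using S(3) by (force simp: R_def)
    show "1 \<in> R" using T(4) by (force simp: R_def)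
    have half: "1/2 \<in> R" using S(4) by (force simp: R_def)
    have R1: "2 * a \<in> S" if "a \<in> R" "a \<le> 1/2" for a
      using that(1) unfolding R_def
    proof (elim UnE imageE)
      fix s assume s: "a = (s + 1) / 2" "s \<in> T"
      then have "2 * a = 1" using that(2) T(2) by (force simp: subset_iff)
      then show ?thesis using S(4) by simp
    qed (simp add: mult.commute)
    have R2: "2 * a - 1 \<in> T" if "a \<in> R" "a \<ge> 1/2" for a
      using that(1) unfolding R_def
    proof (elim UnE imageE)
      fix s assume s: "a = s / 2" "s \<in> S"
      then have "2 * a - 1 = 0" using that(2) S(2) by (force simp: subset_iff)
      then show ?thesis using T(3) by (simp only:)
    next
      fix s assume s: "a = (s + 1) / 2" "s \<in> T"
      then have "2 * a - 1 = s" by (simp add: field_simps)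
      then show ?thesis using s(2) by (simp only:)
    qed
    fix a b assume ab: "a \<in> R" "b \<in> R" "a < b \<and> R \<inter> {a<..<b} = {}"
    have gap: "u \<notin> R" if "a < u" "u < b" for u using ab(3) that by auto
    have "b \<le> 1/2 \<or> 1/2 \<le> a" using gap[of "1/2"] half by linarith
    then show "C1_curve_on A \<gamma> a b"
    proof
      assume b: "b \<le> 1/2"
      have "S \<inter> {2 * a<..<2 * b} = {}"
      proof (rule ccontr)
        assume "\<not> ?thesis"
        then obtain s where "s \<in> S" "2 * a < s" "s < 2 * b" by auto
        then show False using gap[of "s / 2"] by (auto simp: R_def)
      qed
      then have "C1_curve_on A \<alpha> (2 * a) (2 * b)" using ab b R1[of a] R1[of b] by (intro C1) auto
      then show ?thesis
        by (rule C1_curve_affine[where m = 2 and q = 0]) (use b \<gamma>1 in auto)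
    next
      assume a: "1/2 \<le> a"
      have "T \<inter> {2 * a - 1<..<2 * b - 1} = {}"
      proof (rule ccontr)
        assume "\<not> ?thesis"
        then obtain s where "s \<in> T" "2 * a - 1 < s" "s < 2 * b - 1" by auto
        then show False using gap[of "(s + 1) / 2"] by (auto simp: R_def)
      qed
      then have "C1_curve_on A \<beta> (2 * a - 1) (2 * b - 1)" using ab a R2[of a] R2[of b] by (intro C1') auto
      then show ?thesis
        by (rule C1_curve_affine[where m = 2 and q = "- 1"]) (use a \<gamma>2[of _ b] in auto)
    qed
  qed
  moreover have "(speed A g \<gamma> has_integral integral {0..1} (speed A g \<alpha>)) {0..1/2}"
  proof (rule speed_integral_affine[OF \<alpha>(1), of 2 _ _ 0])
    show "(\<lambda>t. 2 * t + 0) ` {0..1/2} = {0..1::real}"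
    proof (intro set_eqI iffI)
      fix x :: real assume "x \<in> {0..1}"
      then show "x \<in> (\<lambda>t. 2 * t + 0) ` {0..1/2}" by (intro image_eqI[of _ _ "x / 2"]) auto
    qed auto
  qed (use \<gamma>1 in auto)
  moreover have "(speed A g \<gamma> has_integral integral {0..1} (speed A g \<beta>)) {1/2..1}"
  proof (rule speed_integral_affine[OF \<beta>(1), of 2 _ _ "- 1"])
    show "(\<lambda>t. 2 * t + - 1) ` {1/2..1} = {0..1::real}"
    proof (intro set_eqI iffI)
      fix x :: real assume "x \<in> {0..1}"
      then show "x \<in> (\<lambda>t. 2 * t + - 1) ` {1/2..1}" by (intro image_eqI[of _ _ "(x + 1) / 2"]) (auto simp: field_simps)
    qed auto
  qed (use \<gamma>2[of _ 1] in auto)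
  ultimately have "piecewise_C1_curve A \<gamma>"
    and I: "(speed A g \<gamma> has_integral (integral {0..1} (speed A g \<alpha>) + integral {0..1} (speed A g \<beta>))) {0..1}"
    by (auto intro: has_integral_combine[of 0 "1/2" 1])
  then have "rd x z \<le> ereal (integral {0..1} (speed A g \<gamma>))"
    using \<alpha>(2) \<beta>(3) by (intro rd_le) (auto simp: \<gamma>_def)
  also have "\<dots> < ereal (r + s)" using integral_unique[OF I] \<alpha>(4) \<beta>(4) by simp
  finally show ?thesis .
qed

text \<open>A straight segment in a chart is a competitor in the infimum, with the constant velocity
  \<open>v\<close> in that chart; in every other chart its velocity is obtained from the continuous
  derivative of the transition map. This is the upper estimate that complements
  \<open>rd_exit_ball\<close>.\<close>

lemma rd_segment:
  assumes c: "c \<in> indices A" and im: "\<And>s. s \<in> {0..1} \<Longrightarrow> p + s *\<^sub>R v \<in> chart_image A c"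
    and M: "\<And>s. s \<in> {0..1} \<Longrightarrow> gnorm c (chart_inv A c (p + s *\<^sub>R v)) v \<le> M"
  shows "rd (chart_inv A c p) (chart_inv A c (p + v)) \<le> ereal M"
proof -
  define \<gamma> where "\<gamma> s = chart_inv A c (p + s *\<^sub>R v)" for s
  have dom: "\<gamma> s \<in> cdom A c" "chart A c (\<gamma> s) = p + s *\<^sub>R v" if "s \<in> {0..1}" for s
    using im[OF that] chart_inv_in[OF c] chart_chart_inv[OF c] by (auto simp: \<gamma>_def)
  have cont: "continuous_on {0..1} \<gamma>"
    unfolding \<gamma>_def
    by (rule continuous_on_compose2[OF continuous_on_chart_inv[OF c]]) (use im in \<open>auto intro!: continuous_intros\<close>)
  have lin: "((\<lambda>s. p + s *\<^sub>R v) has_derivative (\<lambda>h. h *\<^sub>R v)) (at t within T)" for t T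
    by (auto intro!: derivative_eq_intros)
  have "C1_curve_on A \<gamma> 0 1"
    unfolding C1_curve_on_def
  proof (intro conjI ballI)
    fix c' assume c': "c' \<in> indices A"
    obtain T where T: "continuous_on (chart A c ` (cdom A c \<inter> cdom A c')) T"
      "\<And>x. x \<in> cdom A c \<inter> cdom A c' \<Longrightarrow>
       (transition A c c' has_derivative blinfun_apply (T (chart A c x))) (at (chart A c x))"
      using transition_C1[OF c c'] by metis
    let ?D = "{t\<in>{0..1}. \<gamma> t \<in> cdom A c'}"
    have D: "\<gamma> t \<in> cdom A c \<inter> cdom A c'" "chart A c (\<gamma> t) = p + t *\<^sub>R v" if "t \<in> ?D" for t using that dom by auto
    show "\<exists>w. continuous_on ?D w \<and> (\<forall>t\<in>{0..1}. \<gamma> t \<in> cdom A c' \<longrightarrow>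
        ((\<lambda>s. chart A c' (\<gamma> s)) has_vector_derivative w t) (at t within {0..1}))"
    proof (intro exI[of _ "\<lambda>t. blinfun_apply (T (p + t *\<^sub>R v)) v"] conjI ballI impI)
      have "continuous_on ?D (\<lambda>t. T (p + t *\<^sub>R v))"
      proof (rule continuous_on_compose2[OF T(1)])
        show "(\<lambda>t. p + t *\<^sub>R v) ` ?D \<subseteq> chart A c ` (cdom A c \<inter> cdom A c')"
          using D by (metis (no_types, lifting) image_eqI image_subsetI)
      qed (intro continuous_intros)
      then show "continuous_on ?D (\<lambda>t. blinfun_apply (T (p + t *\<^sub>R v)) v)" by (intro continuous_intros)
      fix t :: real assume t: "t \<in> {0..1}" "\<gamma> t \<in> cdom A c'"
      then have "(transition A c c' has_derivative blinfun_apply (T (p + t *\<^sub>R v))) (at (p + t *\<^sub>R v))"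
        using T(2)[of "\<gamma> t"] dom[OF t(1)] by simp
      from has_derivative_compose[OF lin this]
      have "((\<lambda>s. transition A c c' (p + s *\<^sub>R v)) has_derivative
          (\<lambda>h. blinfun_apply (T (p + t *\<^sub>R v)) (h *\<^sub>R v))) (at t within {0..1})" .
      then show "((\<lambda>s. chart A c' (\<gamma> s)) has_vector_derivative blinfun_apply (T (p + t *\<^sub>R v)) v) (at t within {0..1})"
        by (simp add: has_vector_derivative_def transition_def \<gamma>_def blinfun.scaleR_right)
    qed
  qed (rule cont)
  then have pw: "piecewise_C1_curve A \<gamma>"
    unfolding piecewise_C1_curve_def by (intro exI[of _ "{0, 1}"]) auto
  have speed: "speed A g \<gamma> t \<le> M" if t: "t \<in> {0..1}" for t
  proof -
    have "((\<lambda>s. p + s *\<^sub>R v) has_vector_derivative v) (at t within {0..1})"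
      using lin by (simp add: has_vector_derivative_def)
    then have "((\<lambda>s. chart A c (\<gamma> s)) has_vector_derivative v) (at t within {0..1})"
      by (rule has_vector_derivative_transform[OF t, rotated]) (simp add: dom)
    then have "speed A g \<gamma> t = gnorm c (\<gamma> t) v"
      unfolding speed_eq_speed_on
      using cont t dom c by (intro speed_on_chart) (auto simp: continuous_on_eq_continuous_within)
    then show ?thesis using M[OF t] by (simp add: \<gamma>_def)
  qed
  have "integral {0..1} (speed A g \<gamma>) \<le> integral {0..1} (\<lambda>_::real. M)"
    by (rule integral_le[OF piecewise_C1_curveD(2)[OF pw]]) (use speed in auto)
  then have "ereal (integral {0..1} (speed A g \<gamma>)) \<le> ereal M" by simp
  moreover have "\<gamma> 0 = chart_inv A c p" "\<gamma> 1 = chart_inv A c (p + v)" by (simp_all add: \<gamma>_def)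
  ultimately show ?thesis using rd_le[OF pw] by (metis order_trans)
qed

lemma rd_refl: "rd x x = 0"
proof -
  let ?c = "chart_at A x"
  have "gnorm ?c x 0 = 0" using gnorm_scale[OF chart_at, of x 0 0] by simp
  then have "rd (chart_inv A ?c (chart A ?c x)) (chart_inv A ?c (chart A ?c x + 0)) \<le> ereal 0"
    by (intro rd_segment) (auto simp: chart_at chart_in chart_inv_chart)
  then show ?thesis using rd_nonneg[of x x] by (simp add: chart_at chart_inv_chart zero_ereal_def[symmetric])
qed

text \<open>A curve of finite length that stays in the ball up to its exit time converges in the chart
  at the exit time; since \<open>'m\<close> is Hausdorff, it can only leave through the boundary sphere.\<close>

lemma rd_exit_ball:
  assumes c: "c \<in> indices A" and l: "l \<in> cdom A c" and e: "e > 0" and \<kappa>: "\<kappa> > 0"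
    and ball: "ball (chart A c l) e \<subseteq> chart_image A c"
    and low: "\<And>y v. y \<in> ball (chart A c l) e \<Longrightarrow> \<kappa> * norm v \<le> gnorm c (chart_inv A c y) v"
    and x: "x \<notin> cdom A c \<inter> chart A c -` ball (chart A c l) e"
  shows "ereal (\<kappa> * e) \<le> rd l x"
proof (rule ccontr)
  let ?p = "chart A c l"
  define B where "B = cdom A c \<inter> chart A c -` ball ?p e"
  assume "\<not> ?thesis"
  then have "rd l x < ereal (\<kappa> * e)" by simp
  then obtain \<gamma> where \<gamma>: "piecewise_C1_curve A \<gamma>" "\<gamma> 0 = l" "\<gamma> 1 = x"
    and L: "integral {0..1} (speed A g \<gamma>) < \<kappa> * e"
    by (rule rd_lessD)
  define f where "f s = chart A c (\<gamma> s)" for s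
  have cont: "continuous_on {0..1} \<gamma>" and int: "speed A g \<gamma> integrable_on {0..1}"
    using piecewise_C1_curveD(1,2)[OF \<gamma>(1)] by auto
  obtain S where S: "finite S" "0 \<in> S" "1 \<in> S"
    and der: "\<And>t c. \<lbrakk>t \<in> {0..1} - S; c \<in> indices A; \<gamma> t \<in> cdom A c\<rbrakk> \<Longrightarrow>
       \<exists>v. ((\<lambda>s. chart A c (\<gamma> s)) has_vector_derivative v) (at t)"
    using piecewise_C1_curveD(3)[OF \<gamma>(1)] by (elim exE conjE) blast
  have Bopen: "open B" unfolding B_def by (rule open_chart_vimage[OF c]) simp
  \<comment> \<open>The times spent outside the chart ball form a closed set, so at the first of
    them, \<open>t0\<close>, the curve is outside, although it is inside at all earlier
    times.\<close>
  define T where "T = {0..1} \<inter> \<gamma> -` (- B)"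
  have "closed T" unfolding T_def
    by (rule continuous_closed_preimage[OF cont]) (use Bopen in auto)
  moreover have "1 \<in> T" using x \<gamma>(3) by (auto simp: T_def B_def)
  moreover have bdd: "bdd_below T" by (rule bdd_belowI[of _ 0]) (auto simp: T_def)
  ultimately have inf: "Inf T \<in> T" by (intro closed_contains_Inf) auto
  define t0 where "t0 = Inf T"
  have t0: "t0 \<in> {0..1}" "\<gamma> t0 \<notin> B" using inf by (auto simp: T_def t0_def)
  have "l \<in> B" using l e by (auto simp: B_def)
  then have t0pos: "t0 > 0" using t0 \<gamma>(2) by (cases "t0 = 0") auto
  have inB: "\<gamma> s \<in> B" if "0 \<le> s" "s < t0" for s
  proof (rule ccontr)
    assume "\<gamma> s \<notin> B"
    then have "s \<in> T" using that t0 by (auto simp: T_def)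
    then show False using cInf_lower[OF _ bdd] that by (force simp: t0_def)
  qed
  define I where "I s = integral {0..s} (speed A g \<gamma>)" for s
  have Idiff: "I s + integral {s..s'} (speed A g \<gamma>) = I s'" if "0 \<le> s" "s \<le> s'" "s' \<le> 1" for s s'
    unfolding I_def using that int
    by (intro Henstock_Kurzweil_Integration.integral_combine integrable_on_subinterval[OF int]) auto
  have key: "\<kappa> * norm (f s' - f s) \<le> I s' - I s" if s: "0 \<le> s" "s \<le> s'" "s' < t0" for s s'
  proof -
    have sub: "{s..s'} \<subseteq> {0..1}" using s t0 by auto
    have dom: "\<gamma> t \<in> cdom A c" "chart A c (\<gamma> t) \<in> ball ?p e" if "t \<in> {s..s'}" for t
      using inB[of t] that s by (auto simp: B_def)
    \<comment> \<open>The value 0 at the break points is a dummy that keeps the pointwise bound by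
      the speed valid there; a finite set does not affect the integral.\<close>
    define v where "v t = (if t \<in> S then 0 else vector_derivative f (at t))" for t
    have dv: "(f has_vector_derivative v t) (at t)" if "t \<in> {s..s'} - S" for t
    proof -
      have "\<exists>w. (f has_vector_derivative w) (at t)"
        unfolding f_def using der[of t c] dom[of t] sub that c by blast
      then show ?thesis using that by (auto simp: v_def intro: vector_derivative_works[THEN iffD1] differentiableI_vector)
    qed
    have "continuous_on {s..s'} f"
      unfolding f_def
      by (rule continuous_on_compose2[OF continuous_on_chart[OF c] continuous_on_subset[OF cont sub]])
         (use dom in auto)
    then have hi: "(v has_integral (f s' - f s)) {s..s'}"
      using fundamental_theorem_of_calculus_interior_strong[OF S(1) s(2), of f v] dv by auto
    have "norm (v t) \<le> speed A g \<gamma> t / \<kappa>" if t: "t \<in> {s..s'}" for t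
    proof (cases "t \<in> S")
      case True
      then show ?thesis using speed_nonneg \<kappa> by (simp add: v_def)
    next
      case False
      have "t \<in> {0..1}" using t sub by blast
      then have "speed A g \<gamma> t = gnorm c (\<gamma> t) (v t)"
        unfolding speed_eq_speed_on using cont dom[OF t] c dv[of t] t False
        by (intro speed_on_chart)
           (auto simp: continuous_on_eq_continuous_within f_def[symmetric] intro: has_vector_derivative_at_within)
      then have "\<kappa> * norm (v t) \<le> speed A g \<gamma> t"
        using low[OF dom(2)[OF t], of "v t"] chart_inv_chart[OF c dom(1)[OF t]] by simp
      then show ?thesis using \<kappa> by (simp add: field_simps)
    qed
    moreover have "speed A g \<gamma> integrable_on {s..s'}" using int sub by (rule integrable_on_subinterval)
    then have "(\<lambda>t. speed A g \<gamma> t / \<kappa>) integrable_on {s..s'}" by (rule integrable_on_divide)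
    ultimately have "norm (integral {s..s'} v) \<le> integral {s..s'} (\<lambda>t. speed A g \<gamma> t / \<kappa>)"
      using hi by (intro integral_norm_bound_integral) auto
    also have "\<dots> = integral {s..s'} (speed A g \<gamma>) / \<kappa>" by simp
    finally have "\<kappa> * norm (f s' - f s) \<le> integral {s..s'} (speed A g \<gamma>)"
      using integral_unique[OF hi] \<kappa> by (simp add: field_simps)
    then show ?thesis using Idiff[of s s'] s t0 by simp
  qed
  \<comment> \<open>Times approaching \<open>t0\<close> from below. At \<open>t0\<close> itself the
    curve might have left the chart domain, where \<open>f\<close> has no meaning, so the limit in
    the chart has to come from completeness of the model space.\<close>
  define \<sigma> where "\<sigma> n = t0 * (1 - inverse (real (Suc n)))" for n
  have \<sigma>in: "0 \<le> \<sigma> n" "\<sigma> n < t0" for n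
    using t0pos by (auto simp: \<sigma>_def field_simps)
  have "\<sigma> \<longlonglongrightarrow> t0 * (1 - 0)" unfolding \<sigma>_def by (intro tendsto_intros LIMSEQ_inverse_real_of_nat)
  then have \<sigma>lim: "\<sigma> \<longlonglongrightarrow> t0" by simp
  have \<sigma>01: "\<sigma> n \<in> {0..1}" for n using \<sigma>in[of n] t0 by auto
  have "continuous_on {0..1} I" unfolding I_def by (rule indefinite_integral_continuous_1[OF int])
  then have "(\<lambda>n. I (\<sigma> n)) \<longlonglongrightarrow> I t0"
    using continuous_on_tendsto_compose[OF _ \<sigma>lim t0(1)] \<sigma>01 by auto
  then have CI: "Cauchy (\<lambda>n. I (\<sigma> n))" by (rule LIMSEQ_imp_Cauchy)
  have "Cauchy (\<lambda>n. f (\<sigma> n))"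
  proof (rule metric_CauchyI)
    fix \<epsilon> :: real assume "\<epsilon> > 0"
    then obtain N where N: "\<And>m n. \<lbrakk>m \<ge> N; n \<ge> N\<rbrakk> \<Longrightarrow> dist (I (\<sigma> m)) (I (\<sigma> n)) < \<kappa> * \<epsilon>"
      using metric_CauchyD[OF CI, of "\<kappa> * \<epsilon>"] \<kappa> by auto
    have "dist (f (\<sigma> m)) (f (\<sigma> n)) < \<epsilon>" if "m \<ge> N" "n \<ge> N" for m n
    proof -
      have "\<kappa> * norm (f (\<sigma> m) - f (\<sigma> n)) \<le> \<bar>I (\<sigma> m) - I (\<sigma> n)\<bar>"
        using key[of "\<sigma> m" "\<sigma> n"] key[of "\<sigma> n" "\<sigma> m"] \<sigma>in[of m] \<sigma>in[of n]
        by (cases "\<sigma> m \<le> \<sigma> n") (auto simp: norm_minus_commute)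
      also have "\<dots> < \<kappa> * \<epsilon>" using N[OF that] by (simp add: dist_real_def)
      finally show ?thesis using \<kappa> by (simp add: dist_norm)
    qed
    then show "\<exists>M. \<forall>m\<ge>M. \<forall>n\<ge>M. dist (f (\<sigma> m)) (f (\<sigma> n)) < \<epsilon>" by blast
  qed
  then obtain y where y: "(\<lambda>n. f (\<sigma> n)) \<longlonglongrightarrow> y" using Cauchy_convergent convergent_def by blast
  have "\<kappa> * norm (f (\<sigma> n) - ?p) \<le> integral {0..1} (speed A g \<gamma>)" for n
  proof -
    have "\<kappa> * norm (f (\<sigma> n) - f 0) \<le> I (\<sigma> n) - I 0" using key[of 0 "\<sigma> n"] \<sigma>in[of n] by simp
    moreover have "integral {\<sigma> n..1} (speed A g \<gamma>) \<ge> 0"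
      by (rule integral_nonneg[OF integrable_on_subinterval[OF int]]) (use \<sigma>01[of n] speed_nonneg in auto)
    then have "I (\<sigma> n) \<le> I 1" using Idiff[of "\<sigma> n" 1] \<sigma>01[of n] by auto
    moreover have "I 0 = 0" "I 1 = integral {0..1} (speed A g \<gamma>)" by (simp_all add: I_def)
    ultimately show ?thesis using \<gamma>(2) by (simp add: f_def)
  qed
  moreover have "(\<lambda>n. \<kappa> * norm (f (\<sigma> n) - ?p)) \<longlonglongrightarrow> \<kappa> * norm (y - ?p)" by (intro tendsto_intros y)
  ultimately have "\<kappa> * norm (y - ?p) \<le> integral {0..1} (speed A g \<gamma>)" by (intro LIMSEQ_le_const2) auto
  then have "norm (y - ?p) < e" using L \<kappa> by (meson mult_less_cancel_left_pos order_le_less_trans)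
  then have yb: "y \<in> ball ?p e" by (simp add: dist_norm norm_minus_commute)
  then have yi: "y \<in> chart_image A c" using ball by blast
  have "continuous (at y) (chart_inv A c)"
    using continuous_on_chart_inv[OF c] open_image[OF c] yi continuous_on_eq_continuous_at by blast
  then have "(\<lambda>n. chart_inv A c (f (\<sigma> n))) \<longlonglongrightarrow> chart_inv A c y"
    using y by (rule isCont_tendsto_compose)
  moreover have "chart_inv A c (f (\<sigma> n)) = \<gamma> (\<sigma> n)" for n
    using inB[OF \<sigma>in] chart_inv_chart[OF c] by (simp add: B_def f_def)
  moreover have "(\<lambda>n. \<gamma> (\<sigma> n)) \<longlonglongrightarrow> \<gamma> t0"
    using continuous_on_tendsto_compose[OF cont \<sigma>lim t0(1)] \<sigma>01 by auto
  ultimately have "\<gamma> t0 = chart_inv A c y" using LIMSEQ_unique by fastforce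
  then have "\<gamma> t0 \<in> B" using yb yi chart_inv_in[OF c] chart_chart_inv[OF c] by (simp add: B_def)
  then show False using t0(2) by simp
qed

section \<open>A real metric inducing the manifold topology\<close>

definition rdist :: "'m \<Rightarrow> 'm \<Rightarrow> real" where
  "rdist x y = real_of_ereal (min 1 (rd x y))"

text \<open>Truncation at 1 makes every value real and changes neither the balls of radius at most 1
  nor the Cauchy sequences; no information is lost in the conversion because the minimum lies
  between 0 and 1.\<close>

lemma ereal_rdist: "ereal (rdist x y) = min 1 (rd x y)"
proof -
  have "min 1 (rd x y) \<noteq> \<infinity>" "min 1 (rd x y) \<noteq> - \<infinity>" using rd_nonneg[of x y] by (auto simp: min_def)
  then show ?thesis unfolding rdist_def by (intro ereal_real') auto
qed

lemma rdist_le: "rd x y \<le> ereal r \<Longrightarrow> rdist x y \<le> r"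
  using ereal_rdist[of x y] by (metis ereal_less_eq(3) min.coboundedI2)

lemma rdist_less: "rdist x y < r \<Longrightarrow> r \<le> 1 \<Longrightarrow> rd x y < ereal r"
proof -
  assume r: "rdist x y < r" "r \<le> 1"
  have "min 1 (rd x y) < ereal r" using r(1) unfolding ereal_rdist[symmetric] by simp
  moreover have "ereal r \<le> 1" using r(2) by (simp add: one_ereal_def)
  ultimately show "rd x y < ereal r" by (auto simp: min_less_iff_disj)
qed

lemma rdist_nonneg: "rdist x y \<ge> 0"
  unfolding rdist_def using rd_nonneg[of x y] by (intro real_of_ereal_pos) auto

lemma rdist_le_1: "rdist x y \<le> 1"
  using ereal_rdist[of x y] by (metis ereal_less_eq(3) min.cobounded1 one_ereal_def)

lemma rdist_triangle: "rdist x z \<le> rdist x y + rdist y z"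
proof (rule field_le_epsilon)
  fix \<epsilon> :: real assume \<epsilon>: "\<epsilon> > 0"
  let ?a = "rdist x y + \<epsilon> / 2" and ?b = "rdist y z + \<epsilon> / 2"
  show "rdist x z \<le> rdist x y + rdist y z + \<epsilon>"
  proof (cases "?a \<le> 1 \<and> ?b \<le> 1")
    case True
    have "rd x y < ereal ?a" "rd y z < ereal ?b" using \<epsilon> True by (auto intro!: rdist_less)
    then have "rd x z < ereal (?a + ?b)" by (rule rd_triangle_less)
    then have "rdist x z \<le> ?a + ?b" by (intro rdist_le) simp
    then show ?thesis by simp
  next
    case False
    then show ?thesis using rdist_le_1[of x z] rdist_nonneg[of x y] rdist_nonneg[of y z] \<epsilon> by auto
  qed
qed

lemma rd_local_upper:
  assumes c: "c \<in> indices A" and ball: "ball p e \<subseteq> chart_image A c"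
    and up: "\<And>y v. y \<in> ball p e \<Longrightarrow> gnorm c (chart_inv A c y) v \<le> M * norm v"
    and y: "y \<in> ball p e" "y' \<in> ball p e"
  shows "rd (chart_inv A c y) (chart_inv A c y') \<le> ereal (M * norm (y' - y))"
proof -
  have "y + s *\<^sub>R (y' - y) \<in> ball p e" if "s \<in> {0..1}" for s
  proof -
    have "(1 - s) *\<^sub>R y + s *\<^sub>R y' \<in> ball p e"
      using convex_ball[of p e] y that by (intro convexD) auto
    then show ?thesis by (simp add: algebra_simps)
  qed
  then have "rd (chart_inv A c y) (chart_inv A c (y + (y' - y))) \<le> ereal (M * norm (y' - y))"
    using ball up by (intro rd_segment[OF c]) blast+
  then show ?thesis by simp
qed

text \<open>Leaving a small chart ball inside \<open>U\<close> costs a length of at least \<kappa>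
  times its radius, by \<open>rd_exit_ball\<close>. So metric balls are small in the manifold
  topology; the converse inclusion of topologies rests on \<open>rd_local_upper\<close>.\<close>

lemma rdist_ball_in_open:
  assumes U: "open U" "x \<in> U"
  shows "\<exists>\<epsilon>>0. \<forall>y. rdist x y < \<epsilon> \<longrightarrow> y \<in> U"
proof -
  let ?c = "chart_at A x"
  obtain e \<kappa> M where e: "e > 0" and \<kappa>: "\<kappa> > 0" and ball: "ball (chart A ?c x) e \<subseteq> chart_image A ?c"
    and b: "\<And>y v. y \<in> ball (chart A ?c x) e \<Longrightarrow> \<kappa> * norm v \<le> gnorm ?c (chart_inv A ?c y) v"
    using gnorm_local_bounds[OF chart_at] by metis
  have "open (chart_image A ?c \<inter> chart_inv A ?c -` U)"
    by (rule continuous_open_preimage[OF continuous_on_chart_inv[OF chart_at(1)] open_image[OF chart_at(1)] U(1)])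
  moreover have "chart A ?c x \<in> chart_image A ?c \<inter> chart_inv A ?c -` U"
    using U(2) chart_in chart_inv_chart chart_at by auto
  ultimately obtain e' where e': "e' > 0" "ball (chart A ?c x) e' \<subseteq> chart_image A ?c \<inter> chart_inv A ?c -` U"
    using openE by blast
  let ?e = "min e e'"
  have "y \<in> U" if "rdist x y < min 1 (\<kappa> * ?e)" for y
  proof (rule ccontr)
    assume "y \<notin> U"
    then have ny: "y \<notin> cdom A ?c \<inter> chart A ?c -` ball (chart A ?c x) ?e"
      using e'(2) chart_inv_chart[OF chart_at(1)] by force
    have "ereal (\<kappa> * ?e) \<le> rd x y"
    proof (rule rd_exit_ball[OF chart_at _ \<kappa> _ _ ny])
      show "ball (chart A ?c x) ?e \<subseteq> chart_image A ?c" using ball by auto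
    qed (use e e' b in auto)
    moreover have "rd x y < ereal (min 1 (\<kappa> * ?e))" using that by (rule rdist_less) simp
    ultimately show False by (metis ereal_less_eq(3) min.cobounded2 not_less order_less_le_trans)
  qed
  then show ?thesis using e e' \<kappa> by (intro exI[of _ "min 1 (\<kappa> * ?e)"]) auto
qed

sublocale rdist: topological_metric rdist
proof
  fix x y z
  show "rdist x y \<ge> 0" by (rule rdist_nonneg)
  show "rdist x y = rdist y x" by (simp add: rdist_def rd_sym)
  show "rdist x z \<le> rdist x y + rdist y z" by (rule rdist_triangle)
next
  fix x y
  show "rdist x y = 0 \<longleftrightarrow> x = y"
  proof
    assume xy: "rdist x y = 0"
    show "x = y"
    proof (rule ccontr)
      assume "x \<noteq> y"
      then obtain U where "open U" "x \<in> U" "y \<notin> U" using hausdorff by blast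
      then show False using rdist_ball_in_open[of U x] xy by auto
    qed
  qed (simp add: rdist_def rd_refl)
next
  fix U :: "'m set"
  have "\<exists>\<epsilon>>0. \<forall>y. rdist x y < \<epsilon> \<longrightarrow> y \<in> U" if "open U" "x \<in> U" for x
    using rdist_ball_in_open[OF that] .
  moreover have "open U" if H: "\<forall>x\<in>U. \<exists>\<epsilon>>0. \<forall>y. rdist x y < \<epsilon> \<longrightarrow> y \<in> U"
  proof (subst open_subopen, intro ballI)
    fix x assume "x \<in> U"
    then obtain \<epsilon> where \<epsilon>: "\<epsilon> > 0" "\<And>y. rdist x y < \<epsilon> \<Longrightarrow> y \<in> U" using H by blast
    let ?c = "chart_at A x"
    obtain e \<kappa> M where e: "e > 0" and M: "M \<ge> 0" and ball: "ball (chart A ?c x) e \<subseteq> chart_image A ?c"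
      and b: "\<And>y v. y \<in> ball (chart A ?c x) e \<Longrightarrow> gnorm ?c (chart_inv A ?c y) v \<le> M * norm v"
      using gnorm_local_bounds[OF chart_at] by metis
    \<comment> \<open>The summand 1 guards against \<open>M = 0\<close>.\<close>
    define e' where "e' = min e (\<epsilon> / (M + 1))"
    have e': "e' > 0" using e M \<epsilon>(1) by (simp add: e'_def)
    have "y \<in> U" if y: "y \<in> cdom A ?c" "chart A ?c y \<in> ball (chart A ?c x) e'" for y
    proof (rule \<epsilon>(2))
      have yb: "chart A ?c y \<in> ball (chart A ?c x) e" using y(2) by (auto simp: e'_def)
      have n: "norm (chart A ?c y - chart A ?c x) < \<epsilon> / (M + 1)"
        using y(2) by (auto simp: e'_def dist_norm norm_minus_commute)
      have "rd (chart_inv A ?c (chart A ?c x)) (chart_inv A ?c (chart A ?c y))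
          \<le> ereal (M * norm (chart A ?c y - chart A ?c x))"
        by (rule rd_local_upper[OF chart_at(1) ball b]) (use e yb in auto)
      then have "rdist x y \<le> M * norm (chart A ?c y - chart A ?c x)"
        using y(1) chart_at by (intro rdist_le) (simp add: chart_inv_chart)
      also have "\<dots> \<le> (M + 1) * norm (chart A ?c y - chart A ?c x)" by (intro mult_right_mono) auto
      also have "\<dots> < \<epsilon>" using n M by (simp add: field_simps)
      finally show "rdist x y < \<epsilon>" .
    qed
    then show "\<exists>T. open T \<and> x \<in> T \<and> T \<subseteq> U"
      using e' chart_at open_chart_vimage[OF chart_at(1), of "ball (chart A ?c x) e'"]
      by (intro exI[of _ "cdom A ?c \<inter> chart A ?c -` ball (chart A ?c x) e'"]) auto
  qed
  ultimately show "open U \<longleftrightarrow> (\<forall>x\<in>U. \<exists>e>0. \<forall>y. rdist x y < e \<longrightarrow> y \<in> U)" by blast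
qed

lemma mcomplete_rdist:
  assumes "complete_riemannian A g"
  shows "rdist.mcomplete"
  unfolding rdist.mcomplete_def
proof (intro allI impI)
  fix \<sigma> assume C: "rdist.MCauchy \<sigma>"
  have "\<exists>N. \<forall>m\<ge>N. \<forall>n\<ge>N. rd (\<sigma> m) (\<sigma> n) < ereal \<epsilon>" if \<epsilon>: "\<epsilon> > 0" for \<epsilon>
  proof -
    obtain N where N: "\<And>m n. \<lbrakk>N \<le> m; N \<le> n\<rbrakk> \<Longrightarrow> rdist (\<sigma> m) (\<sigma> n) < min 1 \<epsilon>"
      using C \<epsilon> unfolding rdist.MCauchy_def by (meson min_less_iff_conj zero_less_one)
    have "rd (\<sigma> m) (\<sigma> n) < ereal \<epsilon>" if "m \<ge> N" "n \<ge> N" for m n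
    proof -
      have "rd (\<sigma> m) (\<sigma> n) < ereal (min 1 \<epsilon>)" using N[OF that] by (rule rdist_less) simp
      also have "\<dots> \<le> ereal \<epsilon>" by simp
      finally show ?thesis .
    qed
    then show ?thesis by blast
  qed
  then obtain l where l: "(\<lambda>n. rd (\<sigma> n) l) \<longlonglongrightarrow> 0"
    using assms unfolding complete_riemannian_def by blast
  have "(\<lambda>n. rdist (\<sigma> n) l) \<longlonglongrightarrow> 0"
  proof (rule LIMSEQ_I)
    fix r :: real assume r: "r > 0"
    have "eventually (\<lambda>n. rd (\<sigma> n) l < ereal (r / 2)) sequentially"
      using l by (rule order_tendstoD(2)) (use r in auto)
    then obtain N where N: "\<And>n. n \<ge> N \<Longrightarrow> rd (\<sigma> n) l < ereal (r / 2)"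
      unfolding eventually_sequentially by blast
    have "norm (rdist (\<sigma> n) l - 0) < r" if "n \<ge> N" for n
      using rdist_le[OF less_imp_le[OF N[OF that]]] rdist_nonneg[of "\<sigma> n" l] r by simp
    then show "\<exists>no. \<forall>n\<ge>no. norm (rdist (\<sigma> n) l - 0) < r" by blast
  qed
  then have "\<sigma> \<longlonglongrightarrow> l" by (simp add: rdist.tendsto_iff_d)
  then show "\<exists>x. limitin rdist.mtopology \<sigma> x sequentially" by (auto simp: rdist.mtopology_eq)
qed

end

section \<open>The gradient and the Palais--Smale condition on the power\<close>

lemma quadratic_nonneg_imp_zero:
  fixes a b :: real
  assumes "\<And>t. 0 \<le> 2 * t * a + t\<^sup>2 * b"
  shows "a = 0"
proof (rule ccontr)
  assume "a \<noteq> 0"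
  have b: "b \<ge> 0" using assms[of 1] assms[of "-1"] by simp
  \<comment> \<open>The minimum over \<open>t\<close> would use \<open>b\<close> in the denominator,
    which may vanish; \<open>b + 1\<close> still leaves a negative value.\<close>
  define s where "s = b + 1"
  have s: "s > 0" using b by (simp add: s_def)
  have "0 \<le> s\<^sup>2 * (2 * (- a / s) * a + (- a / s)\<^sup>2 * b)"
    using assms[of "- a / s"] by (intro mult_nonneg_nonneg) auto
  also have "\<dots> = a\<^sup>2 * b - 2 * a\<^sup>2 * s"
    using s by (simp add: power2_eq_square field_simps)
  also have "\<dots> = - (a\<^sup>2 * (s + 1))"
    by (simp add: s_def algebra_simps)
  also have "\<dots> < 0" using s \<open>a \<noteq> 0\<close> by simp
  finally show False by simp
qed

lemma quadratic_nonneg_imp_discriminant: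
  fixes a b c :: real
  assumes "\<And>t. 0 \<le> a + 2 * t * b + t\<^sup>2 * c" "c \<ge> 0"
  shows "b\<^sup>2 \<le> a * c"
proof (cases "c = 0")
  case True
  have "b = 0"
  proof (rule ccontr)
    assume "b \<noteq> 0"
    then show False using assms(1)[of "- (a + 1) / (2 * b)"] True by (simp add: field_simps)
  qed
  then show ?thesis using True by simp
next
  case False
  have "0 \<le> a + 2 * (- b / c) * b + (- b / c)\<^sup>2 * c" by (rule assms(1))
  also have "\<dots> = a - b\<^sup>2 / c" using False by (simp add: power2_eq_square)
  finally have "b\<^sup>2 / c \<le> a" by simp
  then show ?thesis using False assms(2) by (simp add: pos_divide_le_eq)
qed

text \<open>The representing vector minimizes \<open>v \<mapsto> B v v - 2 \<phi> v\<close>.\<close>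

lemma riesz_coercive:
  fixes B :: "'e::banach \<Rightarrow>\<^sub>L 'e \<Rightarrow>\<^sub>L real" and \<phi> :: "'e \<Rightarrow>\<^sub>L real"
  assumes sym: "\<And>v w. blinfun_apply (blinfun_apply B v) w = blinfun_apply (blinfun_apply B w) v"
    and \<delta>: "\<delta> > 0" and coer: "\<And>v. blinfun_apply (blinfun_apply B v) v \<ge> \<delta> * (norm v)\<^sup>2"
  shows "\<exists>w. \<forall>v. blinfun_apply (blinfun_apply B w) v = blinfun_apply \<phi> v"
proof -
  define b where "b v w = blinfun_apply (blinfun_apply B v) w" for v w
  define J where "J v = b v v - 2 * blinfun_apply \<phi> v" for v
  note lin = blinfun.add_left blinfun.add_right blinfun.scaleR_left blinfun.scaleR_right
    blinfun.diff_left blinfun.diff_right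
  have bsym: "b v w = b w v" for v w using sym by (simp add: b_def)
  have bco: "b v v \<ge> \<delta> * (norm v)\<^sup>2" for v using coer by (simp add: b_def)
  have "J v \<ge> - ((norm \<phi>)\<^sup>2 / \<delta>)" for v
  proof -
    have "blinfun_apply \<phi> v \<le> norm \<phi> * norm v" using norm_blinfun[of \<phi> v] by simp
    moreover have "0 \<le> (norm \<phi> - \<delta> * norm v)\<^sup>2 / \<delta>" using \<delta> by simp
    moreover have "(norm \<phi> - \<delta> * norm v)\<^sup>2 / \<delta> = (norm \<phi>)\<^sup>2 / \<delta> - 2 * (norm \<phi> * norm v) + \<delta> * (norm v)\<^sup>2"
      using \<delta> by (simp add: power2_eq_square field_simps)
    ultimately show ?thesis using bco[of v] unfolding J_def by linarith
  qed
  then have bdd: "bdd_below (range J)" by (intro bdd_belowI) auto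
  define m where "m = Inf (range J)"
  have mle: "m \<le> J v" for v unfolding m_def by (rule cInf_lower[OF _ bdd]) auto
  have "\<exists>v. J v < m + inverse (real (Suc n))" for n
  proof -
    have "Inf (range J) < m + inverse (real (Suc n))" by (simp add: m_def)
    then show ?thesis using cInf_lessD[of "range J"] by blast
  qed
  then obtain v where v: "\<And>n. J (v n) < m + inverse (real (Suc n))" by metis
  \<comment> \<open>The parallelogram identity: the midpoint lies below the mean of the two values
    by a quarter of the form at \<open>x - y\<close>. As no value is below \<open>m\<close>, two
    near-minimizers must be close, and minimizing sequences are Cauchy.\<close>
  have par: "J ((1/2) *\<^sub>R (x + y)) = J x / 2 + J y / 2 - b (x - y) (x - y) / 4" for x y
  proof -
    have "b ((1/2) *\<^sub>R (x + y)) ((1/2) *\<^sub>R (x + y)) = (b x x + 2 * b x y + b y y) / 4"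
      "b (x - y) (x - y) = b x x - 2 * b x y + b y y"
      using bsym[of x y] by (simp_all add: b_def lin field_simps)
    moreover have "blinfun_apply \<phi> ((1/2) *\<^sub>R (x + y)) = (blinfun_apply \<phi> x + blinfun_apply \<phi> y) / 2"
      by (simp add: lin)
    ultimately show ?thesis unfolding J_def by argo
  qed
  have close: "(norm (x - y))\<^sup>2 \<le> 2 * (J x + J y - 2 * m) / \<delta>" for x y
  proof -
    have "m \<le> J x / 2 + J y / 2 - b (x - y) (x - y) / 4" using mle[of "(1/2) *\<^sub>R (x + y)"] by (simp only: par)
    then have "\<delta> * (norm (x - y))\<^sup>2 \<le> 2 * (J x + J y - 2 * m)" using bco[of "x - y"] by simp
    then show ?thesis using \<delta> by (simp add: field_simps)
  qed
  have "Cauchy v"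
  proof (rule metric_CauchyI)
    fix \<epsilon> :: real assume \<epsilon>: "\<epsilon> > 0"
    \<comment> \<open>Two points within \<open>q\<close> of the infimum give at most
      \<open>4 * q / \<delta>\<close>, that is, the square of \<epsilon>, in
      \<open>close\<close>.\<close>
    define q where "q = \<delta> * \<epsilon>\<^sup>2 / 4"
    obtain N where N: "inverse (real (Suc N)) < q"
      using reals_Archimedean[of q] \<epsilon> \<delta> by (auto simp: q_def)
    have "dist (v i) (v j) < \<epsilon>" if ij: "N \<le> i" "N \<le> j" for i j
    proof -
      have Jk: "J (v k) < m + q" if "N \<le> k" for k
      proof -
        have "inverse (real (Suc k)) \<le> inverse (real (Suc N))" using that by (intro le_imp_inverse_le) auto
        then show ?thesis using v[of k] N by linarith
      qed
      have "2 * (J (v i) + J (v j) - 2 * m) < 4 * q" using Jk[OF ij(1)] Jk[OF ij(2)] by simp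
      then have "2 * (J (v i) + J (v j) - 2 * m) < \<delta> * \<epsilon>\<^sup>2" by (simp add: q_def)
      then have "2 * (J (v i) + J (v j) - 2 * m) / \<delta> < \<epsilon>\<^sup>2" using \<delta> by (simp add: pos_divide_less_eq mult.commute)
      then have "(norm (v i - v j))\<^sup>2 < \<epsilon>\<^sup>2" using close[of "v i" "v j"] by linarith
      then show ?thesis using \<epsilon> by (simp add: dist_norm power2_less_imp_less)
    qed
    then show "\<exists>N. \<forall>i\<ge>N. \<forall>j\<ge>N. dist (v i) (v j) < \<epsilon>" by blast
  qed
  then obtain w where w: "v \<longlonglongrightarrow> w" using Cauchy_convergent convergent_def by blast
  have "(\<lambda>n. J (v n)) \<longlonglongrightarrow> J w" unfolding J_def b_def by (intro tendsto_intros w)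
  moreover have "(\<lambda>n. m + inverse (real (Suc n))) \<longlonglongrightarrow> m + 0"
    by (intro tendsto_intros LIMSEQ_inverse_real_of_nat)
  ultimately have "J w \<le> m + 0" by (rule LIMSEQ_le) (use v less_imp_le in blast)
  then have min: "J w \<le> J x" for x using mle[of x] by simp
  \<comment> \<open>The first variation at the minimizer: the increment of \<open>J\<close> along
    \<open>x\<close> is a nonnegative quadratic polynomial in \<open>t\<close> without constant
    term, so its linear coefficient vanishes.\<close>
  have "b w x - blinfun_apply \<phi> x = 0" for x
  proof (rule quadratic_nonneg_imp_zero)
    fix t :: real
    have "J (w + t *\<^sub>R x) = J w + (2 * t * (b w x - blinfun_apply \<phi> x) + t\<^sup>2 * b x x)"
      using bsym[of w x] by (simp add: J_def b_def lin algebra_simps power2_eq_square)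
    then show "0 \<le> 2 * t * (b w x - blinfun_apply \<phi> x) + t\<^sup>2 * b x x" using min[of "w + t *\<^sub>R x"] by linarith
  qed
  then show ?thesis by (auto simp: b_def)
qed

section \<open>Finite powers of an atlas\<close>

lemma bounded_linear_axis: "bounded_linear (axis i :: 'a::real_normed_vector \<Rightarrow> 'a ^ 'n)"
proof (rule bounded_linear_intro)
  show "axis i (x + y) = axis i x + axis i y" for x y :: 'a by (simp add: axis_def vec_eq_iff)
  show "axis i (r *\<^sub>R x) = r *\<^sub>R axis i x" for r and x :: 'a by (simp add: axis_def vec_eq_iff)
  fix x :: 'a
  have "norm (axis i x :: 'a ^ 'n) \<le> (\<Sum>j\<in>UNIV. norm ((axis i x :: 'a ^ 'n) $ j))"
    unfolding norm_vec_def by (rule L2_set_le_sum) auto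
  also have "\<dots> = (\<Sum>j\<in>UNIV. if j = i then norm x else 0)" by (intro sum.cong) (auto simp: axis_def)
  also have "\<dots> = norm x" by simp
  finally show "norm (axis i x :: 'a ^ 'n) \<le> norm x * 1" by simp
qed

lemma vec_lambda_eq_sum_axis: "(\<chi> i. f i) = (\<Sum>i\<in>UNIV. axis i (f i))"
  by (simp add: vec_eq_iff axis_def)

lemma has_derivative_vec_lambda:
  fixes f :: "'n::finite \<Rightarrow> 'a::real_normed_vector \<Rightarrow> 'b::real_normed_vector"
  assumes "\<And>i. (f i has_derivative f' i) F"
  shows "((\<lambda>x. \<chi> i. f i x) has_derivative (\<lambda>h. \<chi> i. f' i h)) F"
  unfolding vec_lambda_eq_sum_axis
  by (intro has_derivative_sum bounded_linear.has_derivative[OF bounded_linear_axis] assms)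

lemma power_atlas_simps:
  "c \<in> indices (power_atlas A) \<longleftrightarrow> (\<forall>i. c $ i \<in> indices A)"
  "x \<in> cdom (power_atlas A) c \<longleftrightarrow> (\<forall>i. x $ i \<in> cdom A (c $ i))"
  "chart (power_atlas A) c x = (\<chi> i. chart A (c $ i) (x $ i))"
  by (simp_all add: power_atlas_def)

context topological_atlas
begin

lemma power_chart_image:
  "chart_image (power_atlas A :: ('c ^ 'r::finite, 'm ^ 'r, 'e ^ 'r) atlas) c =
     {y. \<forall>i. y $ i \<in> chart_image A (c $ i)}"
proof (intro set_eqI iffI)
  fix y assume "y \<in> {y. \<forall>i. y $ i \<in> chart_image A (c $ i)}"
  then have "\<forall>i. \<exists>x. x \<in> cdom A (c $ i) \<and> chart A (c $ i) x = y $ i"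
    unfolding chart_image_def by (simp add: image_iff) metis
  then obtain x where x: "\<And>i. x i \<in> cdom A (c $ i) \<and> chart A (c $ i) (x i) = y $ i" by metis
  then show "y \<in> chart_image (power_atlas A) c"
    unfolding chart_image_def power_atlas_def
    by (intro image_eqI[of _ _ "\<chi> i. x i"]) (auto simp: vec_eq_iff)
qed (auto simp: chart_image_def power_atlas_def)

text \<open>Off the chart image \<open>inv_into\<close> has arbitrary values, so the coordinatewise
  formula is confined to the image, and whatever is derived from it has to be transferred
  locally.\<close>

lemma power_chart_inv:
  assumes c: "c \<in> indices (power_atlas A :: ('c ^ 'r::finite, 'm ^ 'r, 'e ^ 'r) atlas)"
    and y: "y \<in> chart_image (power_atlas A) c"
  shows "chart_inv (power_atlas A) c y = (\<chi> i. chart_inv A (c $ i) (y $ i))"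
  unfolding chart_inv_def[of "power_atlas A"]
proof (rule inv_into_f_eq)
  have ci: "c $ i \<in> indices A" for i using c by (simp add: power_atlas_def)
  have yi: "y $ i \<in> chart_image A (c $ i)" for i using y by (simp add: power_chart_image)
  show "inj_on (chart (power_atlas A) c) (cdom (power_atlas A) c)"
  proof (rule inj_onI)
    fix x x' assume x: "x \<in> cdom (power_atlas A) c" "x' \<in> cdom (power_atlas A) c"
      "chart (power_atlas A) c x = chart (power_atlas A) c x'"
    have "x $ i = x' $ i" for i
    proof -
      have "chart A (c $ i) (x $ i) = chart A (c $ i) (x' $ i)" "x $ i \<in> cdom A (c $ i)" "x' $ i \<in> cdom A (c $ i)"
        using x by (simp_all add: power_atlas_simps vec_eq_iff)
      then show ?thesis using chart_inv_chart[OF ci[of i]] by metis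
    qed
    then show "x = x'" by (simp add: vec_eq_iff)
  qed
  show "(\<chi> i. chart_inv A (c $ i) (y $ i)) \<in> cdom (power_atlas A) c"
    using chart_inv_in[OF ci yi] by (simp add: power_atlas_def)
  show "chart (power_atlas A) c (\<chi> i. chart_inv A (c $ i) (y $ i)) = y"
    using chart_chart_inv[OF ci yi] by (simp add: power_atlas_def vec_eq_iff)
qed

lemma topological_atlas_power:
  "topological_atlas (power_atlas A :: ('c ^ 'r::finite, 'm ^ 'r, 'e ^ 'r) atlas)"
proof
  let ?P = "power_atlas A :: ('c ^ 'r::finite, 'm ^ 'r, 'e ^ 'r) atlas"
  show "(\<Union>c\<in>indices ?P. cdom ?P c) = UNIV"
  proof (intro equalityI subsetI UNIV_I)
    fix x :: "'m ^ 'r"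
    show "x \<in> (\<Union>c\<in>indices ?P. cdom ?P c)"
      by (rule UN_I[of "\<chi> i. chart_at A (x $ i)"]) (auto simp: power_atlas_def chart_at)
  qed
  fix c assume c: "c \<in> indices ?P"
  have ci: "c $ i \<in> indices A" for i using c by (simp add: power_atlas_def)
  show "open (cdom ?P c)"
    using open_vector_box[of "\<lambda>i. cdom A (c $ i)"] open_cdom[OF ci] by (simp add: power_atlas_def)
  show "open (chart_image ?P c)"
    using open_vector_box[of "\<lambda>i. chart_image A (c $ i)"] open_image[OF ci] by (simp add: power_chart_image)
  show "homeomorphism (cdom ?P c) (chart_image ?P c) (chart ?P c) (chart_inv ?P c)"
  proof (rule homeomorphismI)
    show "continuous_on (cdom ?P c) (chart ?P c)"
    proof -
      have "continuous_on (cdom ?P c) (\<lambda>x. \<chi> i. chart A (c $ i) (x $ i))"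
        by (intro continuous_on_vec_lambda continuous_on_compose2[OF continuous_on_chart[OF ci]]
              continuous_on_component continuous_on_id) (auto simp: power_atlas_def)
      then show ?thesis by (simp add: power_atlas_def)
    qed
    show "continuous_on (chart_image ?P c) (chart_inv ?P c)"
    proof -
      have "continuous_on (chart_image ?P c) (\<lambda>y. \<chi> i. chart_inv A (c $ i) (y $ i))"
        by (intro continuous_on_vec_lambda continuous_on_compose2[OF continuous_on_chart_inv[OF ci]]
              continuous_on_component continuous_on_id) (auto simp: power_chart_image)
      then show ?thesis by (rule continuous_on_eq) (simp add: power_chart_inv[OF c])
    qed
    show "chart ?P c ` cdom ?P c \<subseteq> chart_image ?P c" by (simp add: chart_image_def)
    show "chart_inv ?P c ` chart_image ?P c \<subseteq> cdom ?P c"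
      using chart_inv_in[OF ci] by (auto simp: power_chart_inv[OF c] power_atlas_simps power_chart_image)
    show "chart_inv ?P c (chart ?P c x) = x" if x: "x \<in> cdom ?P c" for x
    proof -
      have "chart ?P c x \<in> chart_image ?P c" using x by (simp add: chart_image_def)
      then show ?thesis using x chart_inv_chart[OF ci]
        by (simp add: power_chart_inv[OF c]) (simp add: power_atlas_simps vec_eq_iff)
    qed
    show "chart ?P c (chart_inv ?P c y) = y" if y: "y \<in> chart_image ?P c" for y
      using y chart_chart_inv[OF ci]
      by (simp add: power_chart_inv[OF c y] power_atlas_simps vec_eq_iff power_chart_image)
  qed
qed

end

section \<open>The power with its distance, its metric and the function on it\<close>

locale power_riemannian = riemannian_manifold A g
  for A :: "('c, 'm::t2_space, 'e::banach) atlas" and g :: "('c, 'm, 'e) metric_rep" +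
  fixes F :: "'m ^ 'r::finite \<Rightarrow> real"
  assumes F_C1: "C1_function (power_atlas A) F"
begin

abbreviation P :: "('c ^ 'r, 'm ^ 'r, 'e ^ 'r) atlas" where
  "P \<equiv> power_atlas A"

abbreviation G :: "'c ^ 'r \<Rightarrow> 'm ^ 'r \<Rightarrow> 'e ^ 'r \<Rightarrow> 'e ^ 'r \<Rightarrow> real" where
  "G \<equiv> power_metric g"

sublocale P: topological_atlas P
  by (rule topological_atlas_power)

lemma index_component: "c \<in> indices P \<Longrightarrow> c $ i \<in> indices A"
  by (simp add: power_atlas_def)

lemma cdom_component: "x \<in> cdom P c \<Longrightarrow> x $ i \<in> cdom A (c $ i)"
  by (simp add: power_atlas_def)

text \<open>A sum of coordinate distances takes the place of the Riemannian distance of the product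
  metric: topology and completeness then reduce to the single factor, and a motion whose coordinates
  have speed at most 1 changes \<open>pdist\<close> at a rate of at most
  \<open>CARD('r)\<close>.\<close>

definition pdist :: "'m ^ 'r \<Rightarrow> 'm ^ 'r \<Rightarrow> real" where
  "pdist x y = (\<Sum>i\<in>UNIV. rdist (x $ i) (y $ i))"

lemma rdist_le_pdist: "rdist (x $ i) (y $ i) \<le> pdist x y"
  unfolding pdist_def by (rule member_le_sum) (auto simp: rdist_nonneg)

sublocale pdist: topological_metric pdist
proof
  fix x y z :: "'m ^ 'r"
  show "pdist x y \<ge> 0" unfolding pdist_def by (intro sum_nonneg rdist_nonneg)
  show "pdist x y = pdist y x" by (simp add: pdist_def rdist.d_commute)
  show "pdist x z \<le> pdist x y + pdist y z"
    unfolding pdist_def sum.distrib[symmetric] by (intro sum_mono rdist_triangle)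
  show "pdist x y = 0 \<longleftrightarrow> x = y"
    unfolding pdist_def by (subst sum_nonneg_eq_0_iff) (auto simp: rdist_nonneg rdist.d_eq_0 vec_eq_iff)
next
  fix U :: "('m ^ 'r) set"
  show "open U \<longleftrightarrow> (\<forall>x\<in>U. \<exists>e>0. \<forall>y. pdist x y < e \<longrightarrow> y \<in> U)"
  proof (intro iffI ballI)
    fix x assume "open U" "x \<in> U"
    then obtain B where B: "\<And>i. open (B i)" "\<And>i. x $ i \<in> B i" "\<And>y. (\<And>i. y $ i \<in> B i) \<Longrightarrow> y \<in> U"
      unfolding open_vec_def by metis
    then have "\<forall>i. \<exists>e>0. \<forall>y. rdist (x $ i) y < e \<longrightarrow> y \<in> B i"
      using rdist_ball_in_open by blast
    then obtain e where e: "\<And>i. e i > 0" "\<And>i y. rdist (x $ i) y < e i \<Longrightarrow> y \<in> B i" by metis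
    define m where "m = Min (range e)"
    have "m > 0" unfolding m_def using e(1) by (subst Min_gr_iff) auto
    moreover have "y \<in> U" if y: "pdist x y < m" for y
    proof (rule B(3))
      fix i
      have "m \<le> e i" unfolding m_def by (rule Min_le) auto
      then show "y $ i \<in> B i" using rdist_le_pdist[of x i y] y by (intro e(2)) linarith
    qed
    ultimately show "\<exists>e>0. \<forall>y. pdist x y < e \<longrightarrow> y \<in> U" by blast
  next
    assume H: "\<forall>x\<in>U. \<exists>e>0. \<forall>y. pdist x y < e \<longrightarrow> y \<in> U"
    show "open U"
      unfolding open_vec_def
    proof (intro ballI)
      fix x assume "x \<in> U"
      then obtain e where e: "e > 0" "\<And>y. pdist x y < e \<Longrightarrow> y \<in> U" using H by blast
      let ?r = "real CARD('r)"
      have "y \<in> U" if "\<And>i. rdist (x $ i) (y $ i) < e / ?r" for y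
      proof (rule e(2))
        have "pdist x y < (\<Sum>i\<in>(UNIV :: 'r set). e / ?r)"
          unfolding pdist_def by (intro sum_strict_mono that) auto
        then show "pdist x y < e" by simp
      qed
      then show "\<exists>S. (\<forall>i. open (S i) \<and> x $ i \<in> S i) \<and> (\<forall>y. (\<forall>i. y $ i \<in> S i) \<longrightarrow> y \<in> U)"
        using e(1) rdist.open_ball rdist.d_eq_0
        by (intro exI[of _ "\<lambda>i. {z. rdist (x $ i) z < e / ?r}"]) simp
    qed
  qed
qed

lemma mcomplete_pdist:
  assumes "complete_riemannian A g"
  shows "pdist.mcomplete"
  unfolding pdist.mcomplete_def
proof (intro allI impI)
  fix \<sigma> assume C: "pdist.MCauchy \<sigma>"
  have "\<exists>l. (\<lambda>n. \<sigma> n $ i) \<longlonglongrightarrow> l" for i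
  proof -
    have "rdist.MCauchy (\<lambda>n. \<sigma> n $ i)"
      using C rdist_le_pdist unfolding rdist.MCauchy_def pdist.MCauchy_def by (meson order_le_less_trans subset_UNIV)
    then have "\<exists>l. limitin rdist.mtopology (\<lambda>n. \<sigma> n $ i) l sequentially"
      using mcomplete_rdist[OF assms] unfolding rdist.mcomplete_def by blast
    then show ?thesis by (simp add: rdist.mtopology_eq)
  qed
  then obtain l where "\<And>i. (\<lambda>n. \<sigma> n $ i) \<longlonglongrightarrow> l i" by metis
  then have "\<sigma> \<longlonglongrightarrow> (\<chi> i. l i)" by (intro vec_tendstoI) simp
  then show "\<exists>x. limitin pdist.mtopology \<sigma> x sequentially" by (auto simp: pdist.mtopology_eq)
qed

lemma chart_deriv_C1:
  assumes c: "c \<in> indices P"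
  obtains F' :: "'e ^ 'r \<Rightarrow> ('e ^ 'r) \<Rightarrow>\<^sub>L real" where "continuous_on (chart_image P c) F'"
    "\<And>y. y \<in> chart_image P c \<Longrightarrow> (F \<circ> chart_inv P c has_derivative blinfun_apply (F' y)) (at y)"
    "\<And>x. x \<in> cdom P c \<Longrightarrow> chart_deriv P F c x = blinfun_apply (F' (chart P c x))"
proof -
  obtain F' :: "'e ^ 'r \<Rightarrow> ('e ^ 'r) \<Rightarrow>\<^sub>L real" where F': "continuous_on (chart_image P c) F'"
    "\<And>y. y \<in> chart_image P c \<Longrightarrow> (F \<circ> chart_inv P c has_derivative blinfun_apply (F' y)) (at y)"
    using F_C1 c unfolding C1_function_def by blast
  show thesis
  proof (rule that[OF F'])
    fix x assume "x \<in> cdom P c"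
    then show "chart_deriv P F c x = blinfun_apply (F' (chart P c x))"
      unfolding chart_deriv_def using frechet_derivative_at[OF F'(2)[OF P.chart_in]] by simp
  qed
qed

lemma chart_deriv_has_derivative:
  assumes "c \<in> indices P" "x \<in> cdom P c"
  shows "(F \<circ> chart_inv P c has_derivative chart_deriv P F c x) (at (chart P c x))"
proof -
  obtain F' :: "'e ^ 'r \<Rightarrow> ('e ^ 'r) \<Rightarrow>\<^sub>L real" where
    "continuous_on (chart_image P c) F'"
    "\<And>y. y \<in> chart_image P c \<Longrightarrow> (F \<circ> chart_inv P c has_derivative blinfun_apply (F' y)) (at y)"
    "\<And>x. x \<in> cdom P c \<Longrightarrow> chart_deriv P F c x = blinfun_apply (F' (chart P c x))"
    using chart_deriv_C1[OF assms(1)] by blast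
  then show ?thesis using P.chart_in[OF assms(2)] assms(2) by simp
qed

lemma continuous_on_F: "continuous_on S F"
proof -
  have "continuous_on UNIV F"
  proof (rule continuous_on_local)
    fix x :: "'m ^ 'r"
    let ?c = "chart_at P x"
    obtain F' where "\<And>y. y \<in> chart_image P ?c \<Longrightarrow>
        (F \<circ> chart_inv P ?c has_derivative blinfun_apply (F' y :: ('e ^ 'r) \<Rightarrow>\<^sub>L real)) (at y)"
      using chart_deriv_C1[OF P.chart_at(1)] by metis
    then have "continuous_on (chart_image P ?c) (F \<circ> chart_inv P ?c)"
      by (meson continuous_at_imp_continuous_on has_derivative_continuous)
    then have "continuous_on (cdom P ?c) (\<lambda>x. (F \<circ> chart_inv P ?c) (chart P ?c x))"
      by (rule continuous_on_compose2[OF _ P.continuous_on_chart[OF P.chart_at(1)]]) (auto simp: P.chart_in)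
    then have "continuous_on (cdom P ?c) F"
      by (rule continuous_on_eq) (simp add: P.chart_inv_chart[OF P.chart_at(1)])
    then show "\<exists>W. open W \<and> x \<in> W \<and> continuous_on (UNIV \<inter> W) F"
      using P.open_cdom[OF P.chart_at(1)] P.chart_at(2) by auto
  qed
  then show ?thesis using continuous_on_subset by blast
qed

text \<open>The expansion of the quadratic form along a line. General \<open>t\<close> yields the
  Cauchy-Schwarz inequality by the discriminant, and \<open>t = - 1\<close> the uniqueness of the
  gradient.\<close>

lemma G_combination:
  assumes "c \<in> indices P" "x \<in> cdom P c"
  shows "G c x (w + t *\<^sub>R v) (w + t *\<^sub>R v) = G c x w w + 2 * t * G c x w v + t\<^sup>2 * G c x v v"
proof -
  have "g (c $ i) (x $ i) ((w + t *\<^sub>R v) $ i) ((w + t *\<^sub>R v) $ i) =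
      g (c $ i) (x $ i) (w $ i) (w $ i) + 2 * t * g (c $ i) (x $ i) (w $ i) (v $ i)
        + t\<^sup>2 * g (c $ i) (x $ i) (v $ i) (v $ i)" for i
  proof -
    have ci: "c $ i \<in> indices A" "x $ i \<in> cdom A (c $ i)"
      using assms index_component cdom_component by auto
    obtain B where "\<And>x v w. x \<in> cdom A (c $ i) \<Longrightarrow> g (c $ i) x v w = blinfun_apply (blinfun_apply (B (chart A (c $ i) x)) v) w"
      using metric_continuous[OF ci(1)] by metis
    then show ?thesis
      using metric_sym[OF ci, of "v $ i" "w $ i"] ci(2)
      by (simp add: blinfun.add_left blinfun.add_right blinfun.scaleR_left blinfun.scaleR_right
          power2_eq_square algebra_simps)
  qed
  then show ?thesis
    by (simp add: power_metric_def sum.distrib sum_distrib_left)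
qed

lemma G_nonneg: "c \<in> indices P \<Longrightarrow> x \<in> cdom P c \<Longrightarrow> G c x v v \<ge> 0"
  unfolding power_metric_def by (intro sum_nonneg metric_nonneg index_component cdom_component)

lemma G_Cauchy_Schwarz:
  assumes "c \<in> indices P" "x \<in> cdom P c"
  shows "\<bar>G c x w v\<bar> \<le> sqrt (G c x w w) * sqrt (G c x v v)"
proof -
  have "(G c x w v)\<^sup>2 \<le> G c x w w * G c x v v"
  proof (rule quadratic_nonneg_imp_discriminant)
    fix t
    show "0 \<le> G c x w w + 2 * t * G c x w v + t\<^sup>2 * G c x v v"
      unfolding G_combination[OF assms, symmetric] by (rule G_nonneg[OF assms])
  qed (rule G_nonneg[OF assms])
  then have "sqrt ((G c x w v)\<^sup>2) \<le> sqrt (G c x w w * G c x v v)" by (rule real_sqrt_le_mono)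
  then show ?thesis by (simp add: real_sqrt_mult)
qed

lemma G_definite:
  assumes "c \<in> indices P" "x \<in> cdom P c" "G c x v v = 0"
  shows "v = 0"
proof -
  have ci: "c $ i \<in> indices A" "x $ i \<in> cdom A (c $ i)" for i
    using assms index_component cdom_component by auto
  have "v $ i = 0" for i
  proof -
    have "g (c $ i) (x $ i) (v $ i) (v $ i) = 0"
      using assms(3) metric_nonneg[OF ci] unfolding power_metric_def by (subst (asm) sum_nonneg_eq_0_iff) auto
    moreover obtain \<delta> where "\<delta> > 0" "g (c $ i) (x $ i) (v $ i) (v $ i) \<ge> \<delta> * (norm (v $ i))\<^sup>2"
      using metric_coercive[OF ci[of i]] by blast
    ultimately show ?thesis by (simp add: mult_le_0_iff)
  qed
  then show ?thesis by (simp add: vec_eq_iff)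
qed

text \<open>As \<open>gradient\<close> is a definite description, a representing vector must be
  shown to exist and to be unique. Its coordinates represent the restrictions of the derivative to
  the axes with respect to the coercive forms on the factors; uniqueness is definiteness of
  \<open>G\<close>.\<close>

lemma gradient:
  assumes c: "c \<in> indices P" and x: "x \<in> cdom P c"
  shows "G c x (gradient P G F c x) v = chart_deriv P F c x v"
proof -
  have ci: "c $ i \<in> indices A" "x $ i \<in> cdom A (c $ i)" for i
    using assms index_component cdom_component by auto
  obtain F' where F': "chart_deriv P F c x = blinfun_apply (F' (chart P c x) :: ('e ^ 'r) \<Rightarrow>\<^sub>L real)"
    using chart_deriv_C1[OF c] x by metis
  have "\<exists>w. \<forall>v. g (c $ i) (x $ i) w v = chart_deriv P F c x (axis i v)" for i
  proof -
    obtain B where B: "\<And>x v w. x \<in> cdom A (c $ i) \<Longrightarrow> g (c $ i) x v w = blinfun_apply (blinfun_apply (B (chart A (c $ i) x)) v) w"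
      using metric_continuous[OF ci(1)] by metis
    obtain \<delta> where "\<delta> > 0" "\<And>v. g (c $ i) (x $ i) v v \<ge> \<delta> * (norm v)\<^sup>2"
      using metric_coercive[OF ci[of i]] by blast
    then have "\<exists>w. \<forall>v. blinfun_apply (blinfun_apply (B (chart A (c $ i) (x $ i))) w) v =
        blinfun_apply (F' (chart P c x) o\<^sub>L Blinfun (axis i)) v"
      using metric_sym[OF ci[of i]] B[OF ci(2)] by (intro riesz_coercive[of _ \<delta>]) auto
    then show ?thesis
      by (simp add: B[OF ci(2)] F' bounded_linear_Blinfun_apply[OF bounded_linear_axis])
  qed
  then obtain w where w: "\<And>i v. g (c $ i) (x $ i) (w i) v = chart_deriv P F c x (axis i v)" by metis
  have ex: "\<forall>v. G c x (\<chi> i. w i) v = chart_deriv P F c x v"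
  proof
    fix v
    have "G c x (\<chi> i. w i) v = (\<Sum>i\<in>UNIV. chart_deriv P F c x (axis i (v $ i)))"
      by (simp add: power_metric_def w)
    also have "\<dots> = chart_deriv P F c x (\<Sum>i\<in>UNIV. axis i (v $ i))"
      by (simp add: F' blinfun.sum_right)
    also have "(\<Sum>i\<in>UNIV. axis i (v $ i)) = v" by (simp add: vec_lambda_eq_sum_axis[symmetric])
    finally show "G c x (\<chi> i. w i) v = chart_deriv P F c x v" .
  qed
  have uniq: "u = (\<chi> i. w i)" if u: "\<forall>v. G c x u v = chart_deriv P F c x v" for u
  proof -
    let ?w = "\<chi> i. w i"
    have "G c x (u + (- 1) *\<^sub>R ?w) (u + (- 1) *\<^sub>R ?w) = G c x u u + 2 * (- 1) * G c x u ?w + (- 1)\<^sup>2 * G c x ?w ?w"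
      by (rule G_combination[OF assms])
    also have "\<dots> = chart_deriv P F c x u - chart_deriv P F c x ?w"
      using u ex by simp
    also have "chart_deriv P F c x u = G c x ?w u" using ex by simp
    also have "G c x ?w u = G c x u ?w"
      unfolding power_metric_def by (intro sum.cong metric_sym ci) auto
    also have "\<dots> = chart_deriv P F c x ?w" using u by simp
    finally have "u + (- 1) *\<^sub>R ?w = 0" by (intro G_definite[OF assms]) simp
    then show ?thesis by simp
  qed
  have "\<forall>v. G c x (gradient P G F c x) v = chart_deriv P F c x v"
    unfolding gradient_def by (rule theI[of _ "\<chi> i. w i"]) (use ex uniq in blast)+
  then show ?thesis by blast
qed

lemma gradient_norm_eq:
  "gradient_norm P G F x =
     sqrt (G (chart_at P x) x (gradient P G F (chart_at P x) x) (gradient P G F (chart_at P x) x))"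
  by (simp add: gradient_norm_def Let_def)

lemma gradient_norm_nonneg: "gradient_norm P G F x \<ge> 0"
  by (simp add: gradient_norm_eq G_nonneg P.chart_at)

text \<open>The gradient norm is computed in the chart chosen at \<open>x\<close>, where the bound
  is the Cauchy-Schwarz inequality. The derivative \<open>L\<close> of the change of charts
  preserves \<open>G\<close> and intertwines the two derivatives of \<open>F\<close>, so the bound
  moves to every chart; limit arguments need it in a chart that does not vary with
  \<open>x\<close>.\<close>

lemma chart_deriv_le_gradient_norm:
  assumes c: "c \<in> indices P" and x: "x \<in> cdom P c"
  shows "\<bar>chart_deriv P F c x v\<bar> \<le> gradient_norm P G F x * sqrt (G c x v v)"
proof -
  let ?c = "chart_at P x"
  have c': "?c \<in> indices P" and x': "x \<in> cdom P ?c" using P.chart_at by auto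
  define L where "L h = (\<chi> i. trans_deriv (c $ i) (?c $ i) (x $ i) (h $ i))" for h
  have xi: "x $ i \<in> cdom A (c $ i) \<inter> cdom A (?c $ i)" for i using x x' cdom_component by auto
  have ci: "c $ i \<in> indices A" "?c $ i \<in> indices A" for i using c c' index_component by auto
  have GL: "G ?c x (L v) (L v) = G c x v v"
    unfolding power_metric_def L_def
    by (intro sum.cong refl) (simp add: metric_transition[OF ci xi])
  define \<tau> where "\<tau> y = (\<chi> i. transition A (c $ i) (?c $ i) (y $ i))" for y :: "'e ^ 'r"
  let ?p = "chart P c x"
  have pi: "?p $ i = chart A (c $ i) (x $ i)" for i by (simp add: power_atlas_def)
  have \<tau>d: "(\<tau> has_derivative L) (at ?p)"
    unfolding \<tau>_def L_def
  proof (rule has_derivative_vec_lambda)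
    fix i
    have "((\<lambda>y :: 'e ^ 'r. y $ i) has_derivative (\<lambda>h. h $ i)) (at ?p)"
      by (intro bounded_linear_imp_has_derivative bounded_linear_vec_nth)
    moreover have "(transition A (c $ i) (?c $ i) has_derivative trans_deriv (c $ i) (?c $ i) (x $ i)) (at (?p $ i))"
      unfolding pi by (rule transition_has_derivative[OF ci xi])
    ultimately show "((\<lambda>y. transition A (c $ i) (?c $ i) (y $ i)) has_derivative
        (\<lambda>h. trans_deriv (c $ i) (?c $ i) (x $ i) (h $ i))) (at ?p)"
      by (rule has_derivative_compose)
  qed
  have \<tau>p: "\<tau> ?p = chart P ?c x"
    using chart_inv_chart[OF ci(1)] xi by (simp add: \<tau>_def transition_def power_atlas_def vec_eq_iff)
  have "(F \<circ> chart_inv P ?c has_derivative chart_deriv P F ?c x) (at (\<tau> ?p))"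
    unfolding \<tau>p by (rule chart_deriv_has_derivative[OF c' x'])
  then have "((\<lambda>y. (F \<circ> chart_inv P ?c) (\<tau> y)) has_derivative (\<lambda>h. chart_deriv P F ?c x (L h))) (at ?p)"
    by (rule has_derivative_compose[OF \<tau>d])
  then have "(F \<circ> chart_inv P c has_derivative (\<lambda>h. chart_deriv P F ?c x (L h))) (at ?p)"
  proof (rule has_derivative_transform_eventually)
    have "isCont (chart_inv P c) ?p"
      using P.continuous_on_chart_inv[OF c] P.open_image[OF c] P.chart_in[OF x] continuous_on_eq_continuous_at by blast
    then have "((chart_inv P c) \<longlongrightarrow> x) (at ?p)" by (simp add: isCont_def P.chart_inv_chart[OF c x])
    then have 1: "\<forall>\<^sub>F y in at ?p. chart_inv P c y \<in> cdom P ?c"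
      using P.open_cdom[OF c'] x' by (rule topological_tendstoD)
    have 2: "\<forall>\<^sub>F y in at ?p. y \<in> chart_image P c"
      using P.open_image[OF c] P.chart_in[OF x] by (rule eventually_at_in_open')
    have eq: "(F \<circ> chart_inv P ?c) (\<tau> y) = (F \<circ> chart_inv P c) y"
      if y: "y \<in> chart_image P c" "chart_inv P c y \<in> cdom P ?c" for y
    proof -
      have "\<tau> y = chart P ?c (chart_inv P c y)"
        using y(1) by (simp add: \<tau>_def transition_def power_chart_inv[OF c y(1)]) (simp add: power_atlas_def)
      then show ?thesis using P.chart_inv_chart[OF c' y(2)] by simp
    qed
    show "\<forall>\<^sub>F y in at ?p. (F \<circ> chart_inv P ?c) (\<tau> y) = (F \<circ> chart_inv P c) y"
      using 1 2 by eventually_elim (rule eq)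
    show "(F \<circ> chart_inv P ?c) (\<tau> ?p) = (F \<circ> chart_inv P c) ?p"
      using P.chart_in[OF x] P.chart_inv_chart[OF c x] x' by (intro eq) auto
  qed auto
  then have "chart_deriv P F c x = (\<lambda>h. chart_deriv P F ?c x (L h))"
    unfolding chart_deriv_def[of P F c x] by (rule frechet_derivative_at[symmetric])
  then have "\<bar>chart_deriv P F c x v\<bar> = \<bar>G ?c x (gradient P G F ?c x) (L v)\<bar>"
    by (simp add: gradient[OF c' x'])
  also have "\<dots> \<le> gradient_norm P G F x * sqrt (G ?c x (L v) (L v))"
    unfolding gradient_norm_eq by (rule G_Cauchy_Schwarz[OF c' x'])
  finally show ?thesis by (simp only: GL)
qed

lemma gradient_norm_Crit: "x \<in> Crit P F \<Longrightarrow> gradient_norm P G F x = 0"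
  using gradient[OF P.chart_at, of x] P.chart_at[of x]
  by (auto simp: gradient_norm_eq Crit_def)

text \<open>In one chart around \<open>l\<close> the derivative in direction \<open>v\<close> is at
  most the gradient norm times the length of \<open>v\<close>. The length converges and the gradient
  norm tends to 0, so the derivative vanishes at \<open>l\<close>; continuity of the gradient norm
  itself is thereby avoided.\<close>

lemma Crit_limit:
  assumes x: "x \<longlonglongrightarrow> l" and gn: "(\<lambda>n. gradient_norm P G F (x n)) \<longlonglongrightarrow> 0"
  shows "l \<in> Crit P F"
  unfolding Crit_def
proof (intro CollectI ballI impI ext)
  fix c v assume c: "c \<in> indices P" and l: "l \<in> cdom P c"
  obtain F' where F': "continuous_on (chart_image P c) F'"
    "\<And>x. x \<in> cdom P c \<Longrightarrow> chart_deriv P F c x = blinfun_apply (F' (chart P c x) :: ('e ^ 'r) \<Rightarrow>\<^sub>L real)"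
    using chart_deriv_C1[OF c] by metis
  have ev: "\<forall>\<^sub>F n in sequentially. x n \<in> cdom P c"
    using x P.open_cdom[OF c] l by (rule topological_tendstoD)
  have cx: "(\<lambda>n. f (x n)) \<longlonglongrightarrow> f l" if "continuous_on (cdom P c) f" for f :: "'m ^ 'r \<Rightarrow> real"
    using that x l ev by (rule continuous_on_tendsto_compose)
  have "continuous_on (cdom P c) (\<lambda>x. F' (chart P c x))"
    by (rule continuous_on_compose2[OF F'(1) P.continuous_on_chart[OF c]]) (auto simp: P.chart_in)
  then have "continuous_on (cdom P c) (\<lambda>x. blinfun_apply (F' (chart P c x)) v)" by (intro continuous_intros)
  then have "continuous_on (cdom P c) (\<lambda>x. chart_deriv P F c x v)"
    by (rule continuous_on_eq) (simp add: F'(2))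
  then have lim: "(\<lambda>n. chart_deriv P F c (x n) v) \<longlonglongrightarrow> chart_deriv P F c l v" by (rule cx)
  have "continuous_on (cdom P c) (\<lambda>x. G c x v v)"
    unfolding power_metric_def
  proof (rule continuous_on_sum)
    fix i
    have ci: "c $ i \<in> indices A" using c index_component by auto
    obtain B where B: "continuous_on (chart_image A (c $ i)) B"
      "\<And>x v w. x \<in> cdom A (c $ i) \<Longrightarrow> g (c $ i) x v w = blinfun_apply (blinfun_apply (B (chart A (c $ i) x)) v) w"
      using metric_continuous[OF ci] by metis
    have "continuous_on (cdom P c) (\<lambda>x. chart A (c $ i) (x $ i))"
      by (rule continuous_on_compose2[OF continuous_on_chart[OF ci]])
         (auto intro!: continuous_on_component continuous_on_id cdom_component)
    then have "continuous_on (cdom P c) (\<lambda>x. B (chart A (c $ i) (x $ i)))"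
      by (rule continuous_on_compose2[OF B(1)]) (auto intro!: chart_in cdom_component)
    then have "continuous_on (cdom P c) (\<lambda>x. blinfun_apply (blinfun_apply (B (chart A (c $ i) (x $ i))) (v $ i)) (v $ i))"
      by (intro continuous_intros)
    then show "continuous_on (cdom P c) (\<lambda>x. g (c $ i) (x $ i) (v $ i) (v $ i))"
      by (rule continuous_on_eq) (simp add: B(2) cdom_component)
  qed
  then have "continuous_on (cdom P c) (\<lambda>x. sqrt (G c x v v))" by (intro continuous_intros)
  then have "(\<lambda>n. sqrt (G c (x n) v v)) \<longlonglongrightarrow> sqrt (G c l v v)" by (rule cx)
  then have "(\<lambda>n. gradient_norm P G F (x n) * sqrt (G c (x n) v v)) \<longlonglongrightarrow> 0 * sqrt (G c l v v)"
    by (rule tendsto_mult[OF gn])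
  then have gl: "(\<lambda>n. gradient_norm P G F (x n) * sqrt (G c (x n) v v)) \<longlonglongrightarrow> 0" by simp
  have "\<forall>\<^sub>F n in sequentially. norm (chart_deriv P F c (x n) v) \<le> gradient_norm P G F (x n) * sqrt (G c (x n) v v)"
    using ev by eventually_elim (simp add: chart_deriv_le_gradient_norm[OF c])
  then have "(\<lambda>n. chart_deriv P F c (x n) v) \<longlonglongrightarrow> 0"
    using gl by (rule Lim_null_comparison)
  then show "chart_deriv P F c l v = 0" by (rule LIMSEQ_unique[OF lim])
qed

text \<open>The motion is along chart segments in one fixed direction \<open>v\<close> opposite to
  the gradient at \<open>x\<close>. Near \<open>x\<close> the function falls at a rate of at least
  \<open>\<delta> / 4\<close>, and each coordinate moves with speed below 1, so \<open>pdist\<close>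
  grows by at most \<open>CARD('r)\<close> per unit of time; the quotient of the two rates is the
  slope in the statement.\<close>

lemma local_descent_gradient:
  assumes \<delta>: "\<delta> > 0" and x: "gradient_norm P G F x \<ge> \<delta>"
  shows "\<exists>U \<rho> H. x \<in> U \<and> pdist.local_descent (\<delta> / (4 * real CARD('r))) F U \<rho> H"
proof -
  define c where "c = chart_at P x"
  have c: "c \<in> indices P" and xc: "x \<in> cdom P c" using P.chart_at by (auto simp: c_def)
  have ci: "c $ i \<in> indices A" and xi: "x $ i \<in> cdom A (c $ i)" for i
    using index_component[OF c] cdom_component[OF xc] by auto
  define p where "p = chart P c x"
  have chart_nth: "chart P c u $ i = chart A (c $ i) (u $ i)" for u i by (simp add: power_atlas_simps)
  obtain F' :: "'e ^ 'r \<Rightarrow> ('e ^ 'r) \<Rightarrow>\<^sub>L real" where F'c: "continuous_on (chart_image P c) F'"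
    and F'd: "\<And>y. y \<in> chart_image P c \<Longrightarrow> (F \<circ> chart_inv P c has_derivative blinfun_apply (F' y)) (at y)"
    and F'x: "\<And>x. x \<in> cdom P c \<Longrightarrow> chart_deriv P F c x = blinfun_apply (F' (chart P c x))"
    using chart_deriv_C1[OF c] by blast
  define w where "w = gradient P G F c x"
  define n where "n = gradient_norm P G F x"
  have n: "n \<ge> \<delta>" "n > 0" using x \<delta> by (auto simp: n_def)
  have nw: "n = sqrt (G c x w w)" by (simp add: n_def gradient_norm_eq w_def c_def)
  then have Gww: "G c x w w = n * n" using G_nonneg[OF c xc, of w] by simp
  \<comment> \<open>Length \<open>1/2\<close> leaves room on both sides: the derivative along
    \<open>v\<close> at \<open>x\<close> is \<open>- n / 2\<close>, which is strictly below
    \<open>- \<delta> / 4\<close>, and the coordinates are strictly shorter than 1, so both bounds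
    persist near \<open>x\<close>.\<close>
  define v where "v = (- (1 / (2 * n))) *\<^sub>R w"
  have "blinfun_apply (F' p) v = - (1 / (2 * n)) * G c x w w"
    using gradient[OF c xc, of w] F'x[OF xc] by (simp add: v_def p_def w_def blinfun.scaleR_right blinfun.minus_right)
  also have "\<dots> = - (n / 2)" using n(2) by (simp add: Gww)
  finally have F'p: "blinfun_apply (F' p) v < - (\<delta> / 4)" using n \<delta> by simp
  have gv: "gnorm (c $ i) (x $ i) (v $ i) < 1" for i
  proof -
    have "g (c $ i) (x $ i) (w $ i) (w $ i) \<le> G c x w w"
      unfolding power_metric_def
      by (rule member_le_sum[of i UNIV "\<lambda>i. g (c $ i) (x $ i) (w $ i) (w $ i)"])
         (auto intro: metric_nonneg ci xi)
    then have "gnorm (c $ i) (x $ i) (w $ i) \<le> n" unfolding gnorm_def nw by (rule real_sqrt_le_mono)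
    moreover have "gnorm (c $ i) (x $ i) (v $ i) = 1 / (2 * n) * gnorm (c $ i) (x $ i) (w $ i)"
      using gnorm_scale[OF ci[of i] xi[of i], of "- (1 / (2 * n))" "w $ i"] n(2) by (simp add: v_def)
    ultimately have "gnorm (c $ i) (x $ i) (v $ i) \<le> 1 / (2 * n) * n" using n(2) by (simp add: mult_left_mono)
    then show ?thesis using n(2) by simp
  qed
  have "\<exists>B. continuous_on (chart_image A (c $ i)) B \<and>
      (\<forall>z\<in>chart_image A (c $ i). gnorm (c $ i) (chart_inv A (c $ i) z) (v $ i) =
         sqrt (blinfun_apply (blinfun_apply (B z) (v $ i)) (v $ i)))" for i
  proof -
    obtain B where "continuous_on (chart_image A (c $ i)) B"
      "\<And>x v w. x \<in> cdom A (c $ i) \<Longrightarrow> g (c $ i) x v w = blinfun_apply (blinfun_apply (B (chart A (c $ i) x)) v) w"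
      using metric_continuous[OF ci] by metis
    then show ?thesis
      by (intro exI[of _ B]) (simp add: gnorm_def chart_inv_in[OF ci] chart_chart_inv[OF ci])
  qed
  then obtain B where B: "\<And>i. continuous_on (chart_image A (c $ i)) (B i)"
    "\<And>i z. z \<in> chart_image A (c $ i) \<Longrightarrow> gnorm (c $ i) (chart_inv A (c $ i) z) (v $ i) =
         sqrt (blinfun_apply (blinfun_apply (B i z) (v $ i)) (v $ i))"
    by metis
  \<comment> \<open>The chart points where both strict bounds hold; \<open>B\<close> expresses the
    coordinate lengths of \<open>v\<close> by continuous functions on the charts, so this set is
    open.\<close>
  define S where "S = (chart_image P c \<inter> (\<lambda>y. blinfun_apply (F' y) v) -` {..< - (\<delta> / 4)}) \<inter>
     (\<Inter>i. chart_image P c \<inter> (\<lambda>y. sqrt (blinfun_apply (blinfun_apply (B i (y $ i)) (v $ i)) (v $ i))) -` {..<1})"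
  have o1: "open (chart_image P c \<inter> (\<lambda>y. blinfun_apply (F' y) v) -` {..< - (\<delta> / 4)})"
    using F'c by (intro continuous_open_preimage P.open_image[OF c] continuous_intros) auto
  have o2: "open (chart_image P c \<inter>
      (\<lambda>y. sqrt (blinfun_apply (blinfun_apply (B i (y $ i)) (v $ i)) (v $ i))) -` {..<1})" for i
  proof -
    have "continuous_on (chart_image P c) (\<lambda>y. B i (y $ i))"
      by (rule continuous_on_compose2[OF B(1)])
         (auto intro!: continuous_on_component continuous_on_id simp: power_chart_image)
    then have "continuous_on (chart_image P c)
        (\<lambda>y. sqrt (blinfun_apply (blinfun_apply (B i (y $ i)) (v $ i)) (v $ i)))"
      by (intro continuous_intros)
    then show ?thesis by (rule continuous_open_preimage[OF _ P.open_image[OF c]]) simp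
  qed
  have "open S" unfolding S_def by (rule open_Int[OF o1 open_INT]) (auto intro: o2)
  moreover have "p \<in> S"
  proof -
    have "sqrt (blinfun_apply (blinfun_apply (B i (p $ i)) (v $ i)) (v $ i)) < 1" for i
      using B(2)[OF chart_in[OF xi[of i]]] gv[of i] chart_inv_chart[OF ci[of i] xi[of i]]
      by (simp add: p_def chart_nth)
    then show ?thesis using F'p P.chart_in[OF xc] by (simp add: S_def p_def)
  qed
  ultimately obtain r where r: "r > 0" "ball p r \<subseteq> S" using openE by blast
  \<comment> \<open>Starting within \<open>r / 2\<close> of \<open>p\<close> and moving by at most
    \<open>r / 2\<close>, a segment remains in the ball of radius \<open>r\<close>; the summand 1
    keeps the denominator positive.\<close>
  define \<rho> where "\<rho> = r / (2 * (norm v + 1))"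
  have nv: "norm v + 1 > 0" by (simp add: add_nonneg_pos)
  then have \<rho>0: "\<rho> > 0" using r(1) by (simp add: \<rho>_def)
  have "\<rho> * norm v \<le> \<rho> * (norm v + 1)" using \<rho>0 by simp
  also have "\<dots> = r / 2" using nv by (simp add: \<rho>_def field_simps)
  finally have \<rho>: "\<rho> > 0" "\<rho> * norm v \<le> r / 2" using \<rho>0 by auto
  define U where "U = cdom P c \<inter> chart P c -` ball p (r / 2)"
  define H where "H = (\<lambda>(u, t). chart_inv P c (chart P c u + t *\<^sub>R v))"
  have inS: "chart P c u + t *\<^sub>R v \<in> S" if u: "u \<in> U" and t: "t \<in> {0..\<rho>}" for u t
  proof -
    have "norm (chart P c u + t *\<^sub>R v - p) \<le> norm (chart P c u - p) + norm (t *\<^sub>R v)"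
      using norm_triangle_ineq[of "chart P c u - p" "t *\<^sub>R v"] by (simp add: algebra_simps)
    also have "norm (t *\<^sub>R v) \<le> \<rho> * norm v" using t by (simp add: mult_right_mono)
    also have "norm (chart P c u - p) < r / 2" using u by (simp add: U_def dist_norm norm_minus_commute)
    finally have "norm (chart P c u + t *\<^sub>R v - p) < r" using \<rho>(2) by linarith
    then have "chart P c u + t *\<^sub>R v \<in> ball p r" by (simp add: dist_norm norm_minus_commute)
    then show ?thesis using r(2) by blast
  qed
  have Sim: "y \<in> chart_image P c" if "y \<in> S" for y using that by (simp add: S_def)
  have Si: "y $ i \<in> chart_image A (c $ i)" if "y \<in> S" for y i
    using Sim[OF that] by (simp add: power_chart_image)
  have Uc: "u \<in> cdom P c" if "u \<in> U" for u using that by (simp add: U_def)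
  have rd_le: "rdist (u $ i) (H (u, t) $ i) \<le> t" if u: "u \<in> U" and t: "t \<in> {0..\<rho>}" for u t i
  proof (rule rdist_le)
    have ui: "u $ i \<in> cdom A (c $ i)" using cdom_component[OF Uc[OF u]] .
    have seg: "chart A (c $ i) (u $ i) + s *\<^sub>R (t *\<^sub>R v $ i) = (chart P c u + (s * t) *\<^sub>R v) $ i" for s
      by (simp add: chart_nth)
    have st: "s * t \<in> {0..\<rho>}" if "s \<in> {0..1}" for s
      using that t mult_left_le_one_le[of t s] by auto
    have "rd (chart_inv A (c $ i) (chart A (c $ i) (u $ i)))
        (chart_inv A (c $ i) (chart A (c $ i) (u $ i) + t *\<^sub>R v $ i)) \<le> ereal t"
    proof (rule rd_segment[OF ci])
      fix s :: real assume s: "s \<in> {0..1}"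
      let ?y = "chart P c u + (s * t) *\<^sub>R v"
      have y: "?y \<in> S" by (rule inS[OF u st[OF s]])
      then have yi: "?y $ i \<in> chart_image A (c $ i)" by (rule Si)
      then show "chart A (c $ i) (u $ i) + s *\<^sub>R (t *\<^sub>R v $ i) \<in> chart_image A (c $ i)" by (simp only: seg)
      have "gnorm (c $ i) (chart_inv A (c $ i) (?y $ i)) (v $ i) < 1"
        using y B(2)[OF yi] by (simp add: S_def)
      then have "\<bar>t\<bar> * gnorm (c $ i) (chart_inv A (c $ i) (?y $ i)) (v $ i) \<le> t"
        using t by (simp add: mult_left_le)
      then show "gnorm (c $ i) (chart_inv A (c $ i) (chart A (c $ i) (u $ i) + s *\<^sub>R (t *\<^sub>R v $ i))) (t *\<^sub>R v $ i) \<le> t"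
        unfolding seg gnorm_scale[OF ci chart_inv_in[OF ci yi]] .
    qed
    moreover have "H (u, t) $ i = chart_inv A (c $ i) (chart A (c $ i) (u $ i) + t *\<^sub>R v $ i)"
      using power_chart_inv[OF c Sim[OF inS[OF u t]]] by (simp add: H_def chart_nth)
    ultimately show "rd (u $ i) (H (u, t) $ i) \<le> ereal t" by (simp add: chart_inv_chart[OF ci ui])
  qed
  have pd_le: "pdist u (H (u, t)) \<le> real CARD('r) * t" if "u \<in> U" "t \<in> {0..\<rho>}" for u t
    unfolding pdist_def using sum_bounded_above[of "UNIV :: 'r set" "\<lambda>i. rdist (u $ i) (H (u, t) $ i)" t] rd_le[OF that]
    by simp
  have H0: "H (u, 0) = u" if "u \<in> U" for u
    using P.chart_inv_chart[OF c Uc[OF that]] by (simp add: H_def)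
  have decr: "F (H (u, t)) \<le> F u - \<delta> / 4 * t" if u: "u \<in> U" and t: "t \<in> {0<..\<rho>}" for u t
  proof -
    let ?\<psi> = "\<lambda>s. (F \<circ> chart_inv P c) (chart P c u + s *\<^sub>R v)"
    have \<psi>': "(?\<psi> has_real_derivative blinfun_apply (F' (chart P c u + s *\<^sub>R v)) v) (at s)"
      if "0 \<le> s" "s \<le> t" for s
    proof -
      have "((\<lambda>s. chart P c u + s *\<^sub>R v) has_derivative (\<lambda>h. h *\<^sub>R v)) (at s)"
        by (auto intro!: derivative_eq_intros)
      moreover have "(F \<circ> chart_inv P c has_derivative blinfun_apply (F' (chart P c u + s *\<^sub>R v))) (at (chart P c u + s *\<^sub>R v))"
        using that t by (intro F'd Sim inS[OF u]) auto
      ultimately have "(?\<psi> has_derivative (\<lambda>h. blinfun_apply (F' (chart P c u + s *\<^sub>R v)) (h *\<^sub>R v))) (at s)"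
        by (rule has_derivative_compose)
      moreover have "(\<lambda>h. blinfun_apply (F' (chart P c u + s *\<^sub>R v)) (h *\<^sub>R v)) =
          (*) (blinfun_apply (F' (chart P c u + s *\<^sub>R v)) v)"
        by (simp add: fun_eq_iff blinfun.scaleR_right mult.commute)
      ultimately show ?thesis by (simp only: has_field_derivative_def)
    qed
    have "\<exists>z>0. z < t \<and> ?\<psi> t - ?\<psi> 0 = (t - 0) * blinfun_apply (F' (chart P c u + z *\<^sub>R v)) v"
      by (rule MVT2) (use t \<psi>' in auto)
    then obtain z where z: "0 < z" "z < t" "?\<psi> t - ?\<psi> 0 = (t - 0) * blinfun_apply (F' (chart P c u + z *\<^sub>R v)) v"
      by blast
    have "chart P c u + z *\<^sub>R v \<in> S" using z t by (intro inS[OF u]) auto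
    then have "blinfun_apply (F' (chart P c u + z *\<^sub>R v)) v \<le> - (\<delta> / 4)" by (simp add: S_def)
    then have "t * blinfun_apply (F' (chart P c u + z *\<^sub>R v)) v \<le> t * - (\<delta> / 4)"
      using t by (intro mult_left_mono) auto
    moreover have "?\<psi> t = F (H (u, t))" "?\<psi> 0 = F u"
      using P.chart_inv_chart[OF c Uc[OF u]] by (simp_all add: H_def)
    ultimately show ?thesis using z(3) by (simp add: mult.commute)
  qed
  let ?\<sigma> = "\<delta> / (4 * real CARD('r))"
  have "pdist.local_descent ?\<sigma> F U \<rho> H"
    unfolding pdist.local_descent_def
  proof (intro conjI ballI)
    show "open U" unfolding U_def by (rule P.open_chart_vimage[OF c]) simp
    show "\<rho> > 0" by (rule \<rho>(1))
    have "continuous_on (U \<times> {0..\<rho>}) (\<lambda>z. chart P c (fst z))"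
      by (rule continuous_on_compose2[OF P.continuous_on_chart[OF c]]) (auto intro!: continuous_intros Uc)
    then have "continuous_on (U \<times> {0..\<rho>}) (\<lambda>z. chart P c (fst z) + snd z *\<^sub>R v)"
      by (intro continuous_intros)
    then have "continuous_on (U \<times> {0..\<rho>}) (\<lambda>z. chart_inv P c (chart P c (fst z) + snd z *\<^sub>R v))"
      by (rule continuous_on_compose2[OF P.continuous_on_chart_inv[OF c]]) (auto intro!: Sim inS)
    then show "continuous_on (U \<times> {0..\<rho>}) H" by (simp add: H_def split_def)
    show "H (u, 0) = u" if "u \<in> U" for u by (rule H0[OF that])
    show "F (H (u, t)) < F u" if "u \<in> U" "t \<in> {0<..\<rho>}" for u t
    proof -
      have "\<delta> / 4 * t > 0" using \<delta> that(2) by simp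
      then show ?thesis using decr[OF that] by linarith
    qed
    show "?\<sigma> * pdist u (H (u, t)) \<le> F u - F (H (u, t))" if u: "u \<in> U" and t: "t \<in> {0..\<rho>}" for u t
    proof (cases "t = 0")
      case True
      then show ?thesis using H0[OF u] pdist.d_eq_0 by simp
    next
      case False
      then have t': "t \<in> {0<..\<rho>}" using t by auto
      have "?\<sigma> * pdist u (H (u, t)) \<le> ?\<sigma> * (real CARD('r) * t)"
        using pd_le[OF u t] \<delta> by (intro mult_left_mono) auto
      also have "\<dots> = \<delta> / 4 * t" by simp
      finally show ?thesis using decr[OF u t'] by linarith
    qed
  qed
  moreover have "x \<in> U" using xc r(1) by (simp add: U_def p_def)
  ultimately show ?thesis by blast
qed

section \<open>Consequences of the Palais-Smale condition\<close>

context
  assumes ps: "palais_smale P G F"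
begin

lemma Palais_Smale_sequence:
  assumes "bounded (range (\<lambda>n. \<bar>F (x n)\<bar>))" "(\<lambda>n. gradient_norm P G F (x n)) \<longlonglongrightarrow> 0"
  obtains l k where "strict_mono (k :: nat \<Rightarrow> nat)" "(x \<circ> k) \<longlonglongrightarrow> l" "l \<in> Crit P F" "(\<lambda>n. F (x (k n))) \<longlonglongrightarrow> F l"
proof -
  obtain l k where k: "strict_mono (k :: nat \<Rightarrow> nat)" "(x \<circ> k) \<longlonglongrightarrow> l"
    using ps assms unfolding palais_smale_def by blast
  have "(\<lambda>n. gradient_norm P G F ((x \<circ> k) n)) \<longlonglongrightarrow> 0"
    using LIMSEQ_subseq_LIMSEQ[OF assms(2) k(1)] by (simp add: o_def)
  then have "l \<in> Crit P F" using Crit_limit[OF k(2)] by blast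
  moreover have "(\<lambda>n. F ((x \<circ> k) n)) \<longlonglongrightarrow> F l"
    by (rule continuous_on_tendsto_compose[OF continuous_on_F[of UNIV] k(2)]) auto
  ultimately show thesis using that k by simp
qed

lemma bounded_abs_interval:
  assumes "\<And>n. F (x n) \<in> {a..b}"
  shows "bounded (range (\<lambda>n. \<bar>F (x n)\<bar>))"
proof -
  have "norm \<bar>F (x n)\<bar> \<le> \<bar>a\<bar> + \<bar>b\<bar>" for n using assms[of n] by auto
  then show ?thesis by (intro boundedI) auto
qed

text \<open>Failure of the bound for all constants \<open>inverse (real (Suc n))\<close> produces a
  Palais-Smale sequence outside \<open>N\<close> with levels tending to \<open>b\<close>. A limit of
  a subsequence is critical of level \<open>b\<close>, hence in the open set \<open>N\<close>, which
  the sequence avoids.\<close>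

lemma gradient_norm_lower_bound:
  assumes N: "open N" "{y. F y = b} \<inter> Crit P F \<subseteq> N"
  obtains \<epsilon> \<delta> where "\<epsilon> > 0" "\<delta> > 0"
    "\<And>x. \<bar>F x - b\<bar> \<le> \<epsilon> \<Longrightarrow> x \<notin> N \<Longrightarrow> gradient_norm P G F x \<ge> \<delta>"
proof (rule ccontr)
  assume neg: "\<not> thesis"
  have "\<exists>x. \<bar>F x - b\<bar> \<le> inverse (real (Suc n)) \<and> x \<notin> N \<and> gradient_norm P G F x < inverse (real (Suc n))" for n
    using neg that[of "inverse (real (Suc n))" "inverse (real (Suc n))"] by force
  then obtain x where x: "\<And>n. \<bar>F (x n) - b\<bar> \<le> inverse (real (Suc n))" "\<And>n. x n \<notin> N"
    "\<And>n. gradient_norm P G F (x n) < inverse (real (Suc n))" by metis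
  have "(\<lambda>n. F (x n) - b) \<longlonglongrightarrow> 0"
    by (rule Lim_null_comparison[OF _ LIMSEQ_inverse_real_of_nat]) (use x(1) in auto)
  then have Fb: "(\<lambda>n. F (x n)) \<longlonglongrightarrow> b" by (simp add: LIM_zero_iff)
  have "F (x n) \<in> {b - 1..b + 1}" for n
  proof -
    have "inverse (real (Suc n)) \<le> 1" by (simp add: inverse_le_1_iff)
    then show ?thesis using x(1)[of n] by (auto simp: abs_le_iff)
  qed
  then have bd: "bounded (range (\<lambda>n. \<bar>F (x n)\<bar>))" by (rule bounded_abs_interval)
  have "(\<lambda>n. gradient_norm P G F (x n)) \<longlonglongrightarrow> 0"
    by (rule Lim_null_comparison[OF _ LIMSEQ_inverse_real_of_nat])
       (use x(3) gradient_norm_nonneg in \<open>auto intro!: always_eventually less_imp_le\<close>)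
  then obtain l k where k: "strict_mono (k :: nat \<Rightarrow> nat)" "(x \<circ> k) \<longlonglongrightarrow> l" "l \<in> Crit P F"
    "(\<lambda>n. F (x (k n))) \<longlonglongrightarrow> F l"
    using Palais_Smale_sequence[OF bd] by blast
  have "(\<lambda>n. F (x (k n))) \<longlonglongrightarrow> b" using LIMSEQ_subseq_LIMSEQ[OF Fb k(1)] by (simp add: o_def)
  then have "F l = b" using k(4) LIMSEQ_unique by blast
  then have "l \<in> N" using k(3) N(2) by blast
  then have "\<forall>\<^sub>F n in sequentially. (x \<circ> k) n \<in> N" by (rule topological_tendstoD[OF k(2) N(1)])
  then show False using x(2) by (auto simp: eventually_sequentially)
qed

text \<open>Any sequence of critical points on one level is a Palais-Smale sequence, and its
  subsequential limits are critical on the same level.\<close>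

lemma compact_critical_level: "compact ({y. F y = b} \<inter> Crit P F)"
  unfolding pdist.compact_sequentially
proof (intro allI impI)
  fix x :: "nat \<Rightarrow> 'm ^ 'r" assume "range x \<subseteq> {y. F y = b} \<inter> Crit P F"
  then have "x n \<in> {y. F y = b} \<inter> Crit P F" for n by blast
  then have x: "F (x n) = b" "gradient_norm P G F (x n) = 0" for n
    by (simp_all add: gradient_norm_Crit)
  have bd: "bounded (range (\<lambda>n. \<bar>F (x n)\<bar>))" using x(1) by simp
  have "(\<lambda>n. gradient_norm P G F (x n)) \<longlonglongrightarrow> 0" using x(2) by simp
  then obtain l k where k: "strict_mono (k :: nat \<Rightarrow> nat)" "(x \<circ> k) \<longlonglongrightarrow> l" "l \<in> Crit P F"
    "(\<lambda>n. F (x (k n))) \<longlonglongrightarrow> F l"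
    using Palais_Smale_sequence[OF bd] by blast
  have "F l = b" using k(4) x(1) by (simp add: LIMSEQ_const_iff)
  then show "\<exists>l\<in>{y. F y = b} \<inter> Crit P F. \<exists>k. strict_mono k \<and> (x \<circ> k) \<longlonglongrightarrow> l"
    using k by blast
qed

text \<open>A discrete set of reals may still accumulate at a point outside of it, so boundedness of
  the values does not suffice. The Palais-Smale condition makes the limit of a subsequence of
  critical values a critical value again, and this value is isolated, against infinitely many
  distinct ones.\<close>

lemma finite_critical_values:
  assumes disc: "discrete (F ` Crit P F)" and bdd: "bdd_below (range F)"
  shows "finite {\<mu> \<in> F ` Crit P F. \<mu> \<le> a}"
proof (rule ccontr)
  obtain lo where lo: "\<And>y. lo \<le> F y" using bdd by (auto simp: bdd_below_def)
  assume "infinite {\<mu> \<in> F ` Crit P F. \<mu> \<le> a}"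
  then obtain f :: "nat \<Rightarrow> real" where f: "inj f" "range f \<subseteq> {\<mu> \<in> F ` Crit P F. \<mu> \<le> a}"
    using infinite_countable_subset by blast
  then have fn: "f n \<in> F ` Crit P F" "f n \<le> a" for n by blast+
  have "\<exists>y. y \<in> Crit P F \<and> F y = f n" for n using fn(1)[of n] by (elim imageE) auto
  then obtain x where x: "\<And>n. x n \<in> Crit P F" "\<And>n. F (x n) = f n" by metis
  have "F (x n) \<in> {lo..a}" for n using lo[of "x n"] fn(2)[of n] x(2)[of n] by simp
  then have bd: "bounded (range (\<lambda>n. \<bar>F (x n)\<bar>))" by (rule bounded_abs_interval)
  have "(\<lambda>n. gradient_norm P G F (x n)) \<longlonglongrightarrow> 0" using gradient_norm_Crit[OF x(1)] by simp
  then obtain l k where k: "strict_mono (k :: nat \<Rightarrow> nat)" "(x \<circ> k) \<longlonglongrightarrow> l" "l \<in> Crit P F"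
    "(\<lambda>n. F (x (k n))) \<longlonglongrightarrow> F l"
    using Palais_Smale_sequence[OF bd] by blast
  have "F l isolated_in F ` Crit P F" using disc k(3) by (auto simp: discrete_def)
  then obtain T where T: "open T" "T \<inter> F ` Crit P F = {F l}" unfolding isolated_in_def by blast
  then have "\<forall>\<^sub>F n in sequentially. F (x (k n)) \<in> T" by (intro topological_tendstoD[OF k(4)]) auto
  then obtain m where m: "\<And>n. n \<ge> m \<Longrightarrow> F (x (k n)) \<in> T" by (auto simp: eventually_sequentially)
  have "f (k n) = F l" if "n \<ge> m" for n
  proof -
    have "f (k n) \<in> T \<inter> F ` Crit P F" using m[OF that] fn(1)[of "k n"] by (simp add: x(2))
    then show ?thesis by (simp add: T(2))
  qed
  then have "f (k m) = f (k (Suc m))" by simp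
  then have "k m = k (Suc m)" using f(1) by (simp add: inj_eq)
  then show False using k(1) by (metis lessI less_irrefl strict_mono_less)
qed

text \<open>There are two neighbourhoods of the critical set, \<open>N'\<close> being at distance at
  least \<open>e\<close> from the complement of \<open>N\<close>. On its way from height at most
  \<open>b + \<epsilon>\<close> down to \<open>b - \<epsilon>\<close> a point loses at most
  \<open>2 * \<epsilon>\<close>, hence moves by less than \<open>e\<close>; starting outside
  \<open>N\<close> it never meets \<open>N'\<close>, and outside \<open>N'\<close> the gradient is
  bounded below.\<close>

lemma level_deformation:
  assumes complete: "complete_riemannian A g"
    and N: "open N" "{y. F y = b} \<inter> Crit P F \<subseteq> N"
  obtains \<epsilon> E h where "\<epsilon> > 0" "open E" "sublevel F (b + \<epsilon>) - N \<subseteq> E" "continuous_on (E \<times> {0..1::real}) h"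
    "\<And>x. x \<in> E \<Longrightarrow> h (x, 0) = x" "\<And>x. x \<in> E \<Longrightarrow> F (h (x, 1)) < b - \<epsilon>"
proof -
  let ?K = "{y. F y = b} \<inter> Crit P F"
  obtain N' e where N': "open N'" "?K \<subseteq> N'" and e: "e > 0"
    and sep: "\<And>x y. x \<notin> N \<Longrightarrow> pdist x y < e \<Longrightarrow> y \<notin> N'"
  proof (cases "?K = {}")
    case True
    \<comment> \<open>Without critical points on the level there is nothing to avoid, and any
      positive distance will do.\<close>
    show thesis by (rule that[of "{}" 1]) (use True in auto)
  next
    case False
    obtain e where e: "e > 0" "\<And>y. pdist.set_dist ?K y < e \<Longrightarrow> y \<in> N"
      using pdist.compact_neighbourhood[OF compact_critical_level N False] by metis
    \<comment> \<open>The gap \<open>e\<close> around the critical set is shared equally between the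
      radius of \<open>N'\<close> and the margin that separates it from the complement of
      \<open>N\<close>.\<close>
    show thesis
    proof (rule that[of "{y. pdist.set_dist ?K y < e / 2}" "e / 2"])
      show "open {y. pdist.set_dist ?K y < e / 2}"
        by (intro open_Collect_less pdist.continuous_on_set_dist[OF False] continuous_intros)
      show "?K \<subseteq> {y. pdist.set_dist ?K y < e / 2}"
        using pdist.set_dist_zero[OF False] e(1) by auto
      show "y \<notin> {y. pdist.set_dist ?K y < e / 2}" if "x \<notin> N" "pdist x y < e / 2" for x y
        using e(2)[of x] that pdist.set_dist_nonexpansive[OF False, of x y] by (auto simp: abs_le_iff)
    qed (use e in auto)
  qed
  obtain \<epsilon>0 \<delta> where \<epsilon>0: "\<epsilon>0 > 0" and \<delta>: "\<delta> > 0"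
    and grad: "\<And>x. \<bar>F x - b\<bar> \<le> \<epsilon>0 \<Longrightarrow> x \<notin> N' \<Longrightarrow> gradient_norm P G F x \<ge> \<delta>"
    using gradient_norm_lower_bound[OF N'] by metis
  define \<sigma> where "\<sigma> = \<delta> / (4 * real CARD('r))"
  have \<sigma>: "\<sigma> > 0" using \<delta> by (simp add: \<sigma>_def)
  \<comment> \<open>The denominator 3 makes \<open>2 * \<epsilon> < \<sigma> * e\<close> strict; the
    other bound keeps the whole descent in the range of levels where the gradient estimate
    holds.\<close>
  define \<epsilon> where "\<epsilon> = min \<epsilon>0 (\<sigma> * e / 3)"
  have \<epsilon>: "\<epsilon> > 0" "\<epsilon> \<le> \<epsilon>0" "2 * \<epsilon> < \<sigma> * e" using \<epsilon>0 \<sigma> e by (auto simp: \<epsilon>_def min_def)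
  define D where "D = {x. \<bar>F x - b\<bar> \<le> \<epsilon>0 \<and> x \<notin> N'}"
  obtain E h where "open E" "sublevel F (b + \<epsilon>) - N \<subseteq> E" "continuous_on (E \<times> {0..1::real}) h"
    "\<And>x. x \<in> E \<Longrightarrow> h (x, 0) = x" "\<And>x. x \<in> E \<Longrightarrow> F (h (x, 1)) < b - \<epsilon>"
  proof (rule pdist.deformation[OF mcomplete_pdist[OF complete] continuous_on_F \<sigma>])
    show "\<exists>U \<rho> H. z \<in> U \<and> pdist.local_descent \<sigma> F U \<rho> H" if "z \<in> D" for z
      unfolding \<sigma>_def using that by (intro local_descent_gradient[OF \<delta>] grad) (auto simp: D_def)
    show "y \<in> D" if x: "x \<in> sublevel F (b + \<epsilon>) - N" and le: "\<sigma> * pdist x y \<le> F x - F y" and y: "b - \<epsilon> \<le> F y" for x y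
    proof -
      have Fx: "F x \<le> b + \<epsilon>" using x by (simp add: sublevel_def)
      have "0 \<le> \<sigma> * pdist x y" using \<sigma> pdist.d_nonneg by simp
      then have "\<bar>F y - b\<bar> \<le> \<epsilon>0" using le y Fx \<epsilon>(2) by linarith
      moreover have "\<sigma> * pdist x y < \<sigma> * e" using le Fx y \<epsilon>(3) by linarith
      then have "pdist x y < e" using \<sigma> by simp
      then have "y \<notin> N'" using sep x by blast
      ultimately show ?thesis by (simp add: D_def)
    qed
  qed (rule that)
  then show thesis using that \<epsilon>(1) by blast
qed

end

end

section \<open>Summation over the critical levels\<close>

text \<open>The estimate propagates past the infimum of the levels at which it fails.\<close>

lemma enat_level_induction:
  fixes f s :: "real \<Rightarrow> enat"
  assumes mono: "\<And>b c. b \<le> c \<Longrightarrow> f b \<le> f c" and zero: "\<And>b. b < lo \<Longrightarrow> f b = 0"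
    and T: "finite T" "\<And>\<mu>. \<mu> \<le> a \<Longrightarrow> \<mu> \<notin> T \<Longrightarrow> s \<mu> = 0"
    and step: "\<And>b. \<exists>\<epsilon>>0. f (b + \<epsilon>) \<le> f (b - \<epsilon>) + s b"
  shows "f a \<le> sum s {\<mu> \<in> T. \<mu> \<le> a}"
proof (rule ccontr)
  define S where "S b = sum s {\<mu> \<in> T. \<mu> \<le> b}" for b
  define B where "B = {b. b \<le> a \<and> \<not> f b \<le> S b}"
  have Smono: "S b \<le> S c" if "b \<le> c" for b c
    unfolding S_def using that T(1) by (intro sum_mono2) auto
  assume "\<not> ?thesis"
  then have "a \<in> B" by (simp add: B_def S_def)
  have bdd: "bdd_below B"
  proof (rule bdd_belowI[of _ lo])
    fix b assume "b \<in> B"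
    then show "lo \<le> b" using zero[of b] by (force simp: B_def)
  qed
  define m where "m = Inf B"
  have ma: "m \<le> a" unfolding m_def by (rule cInf_lower[OF \<open>a \<in> B\<close> bdd])
  have good: "f b \<le> S b" if "b < m" for b
  proof (rule ccontr)
    assume "\<not> ?thesis"
    then have "b \<in> B" using that ma by (simp add: B_def)
    then show False using cInf_lower[OF _ bdd] that by (force simp: m_def)
  qed
  obtain \<epsilon> where \<epsilon>: "\<epsilon> > 0" "f (m + \<epsilon>) \<le> f (m - \<epsilon>) + s m" using step by blast
  \<comment> \<open>A level \<open>m\<close> in \<open>T\<close> is counted in \<open>S m\<close>
    but not yet in \<open>S (m - \<epsilon>)\<close>; any other level up to \<open>a\<close>
    contributes nothing.\<close>
  have "S (m - \<epsilon>) + s m \<le> S m"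
  proof (cases "m \<in> T")
    case True
    have "S (m - \<epsilon>) + s m = sum s (insert m {\<mu> \<in> T. \<mu> \<le> m - \<epsilon>})"
      unfolding S_def using T(1) \<epsilon>(1) by (subst sum.insert) (auto simp: add.commute)
    also have "\<dots> \<le> S m" unfolding S_def using T(1) True \<epsilon>(1) by (intro sum_mono2) auto
    finally show ?thesis .
  next
    case False
    then show ?thesis using T(2)[OF ma] Smono[of "m - \<epsilon>" m] \<epsilon>(1) by simp
  qed
  moreover have "f (m - \<epsilon>) \<le> S (m - \<epsilon>)" using \<epsilon>(1) by (intro good) simp
  ultimately have top: "f (m + \<epsilon>) \<le> S m" using \<epsilon>(2) by (meson add_right_mono order_trans)
  have "f b \<le> S b" if "b < m + \<epsilon>" for b
  proof (cases "b < m")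
    case False
    \<comment> \<open>The step estimate jumps over \<open>m\<close>, so its value at the upper end
      controls all levels between \<open>m\<close> and \<open>m + \<epsilon>\<close>.\<close>
    have "f b \<le> f (m + \<epsilon>)" using that by (intro mono) simp
    also have "\<dots> \<le> S m" by (rule top)
    also have "\<dots> \<le> S b" using False by (intro Smono) simp
    finally show ?thesis .
  qed (rule good)
  then have "m + \<epsilon> \<le> b" if "b \<in> B" for b using that by (force simp: B_def)
  then have "m + \<epsilon> \<le> m" unfolding m_def using \<open>a \<in> B\<close> by (intro cInf_greatest) auto
  then show False using \<epsilon>(1) by simp
qed

theorem corollary2p9:
  fixes X :: "('c, 'm::t2_space, 'e::banach) atlas"
    and g :: "('c, 'm, 'e) metric_rep"
    and F :: "'m ^ 'r::{finite,linorder} \<Rightarrow> real"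
  assumes "CARD('r) \<ge> 2"
    and "banach_manifold X"
    and "connected (UNIV :: 'm set)"
    and "riemannian_metric X g"
    and "complete_riemannian X g"
    and "C1_function (power_atlas X) F"
    and "bdd_below (range F)"
    and "palais_smale (power_atlas X) (power_metric g) F"
    and "discrete (F ` Crit (power_atlas X) F)"
  shows "\<forall>a :: real. TC (sublevel F a)
           \<le> (\<Sum>\<^sub>\<infinity>\<mu>\<in>{..a}. SUP C\<in>critical_components (power_atlas X) F \<mu>. TC C)"
proof
  fix a :: real
  interpret power_riemannian X g F
    by unfold_locales (rule assms)+
  note ps = \<open>palais_smale (power_atlas X) (power_metric g) F\<close>
  let ?K = "\<lambda>\<mu>. {y. F y = \<mu>} \<inter> Crit P F"
  define s where "s \<mu> = (SUP C\<in>critical_components (power_atlas X) F \<mu>. TC C)" for \<mu>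
  obtain lo where lo: "\<And>y. lo \<le> F y" using assms(7) by (auto simp: bdd_below_def)
  let ?T = "{\<mu> \<in> F ` Crit P F. \<mu> \<le> a}"
  have fin: "finite ?T" by (rule finite_critical_values[OF ps assms(9,7)])
  have s0: "s \<mu> = 0" if "\<mu> \<notin> F ` Crit P F" for \<mu>
  proof -
    \<comment> \<open>A level without critical points has no components, and the supremum over the
      empty set of extended naturals is 0, in accordance with the convention for the
      maximum.\<close>
    have "?K \<mu> = {}" using that by auto
    then show ?thesis by (simp add: s_def critical_components_def bot_enat_def)
  qed
  have "TC (sublevel F a) \<le> sum s {\<mu> \<in> ?T. \<mu> \<le> a}"
  proof (rule enat_level_induction[where f = "\<lambda>b. TC (sublevel F b)" and lo = lo])
    show "TC (sublevel F b) \<le> TC (sublevel F c)" if "b \<le> c" for b c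
      by (rule TC_mono) (use that in \<open>auto simp: sublevel_def\<close>)
    show "TC (sublevel F b) = 0" if "b < lo" for b
    proof -
      have "\<not> F y \<le> b" for y using lo[of y] \<open>b < lo\<close> by simp
      then have "sublevel F b = {}" by (simp add: sublevel_def)
      then show ?thesis by (simp add: TC_empty)
    qed
    show "s \<mu> = 0" if "\<mu> \<le> a" "\<mu> \<notin> ?T" for \<mu>
      using that by (intro s0) auto
    fix b
    \<comment> \<open>The sublevel set is split along \<open>N\<close>: this part costs no more than
      the critical set itself, and the remainder is pushed below the level.\<close>
    obtain N where N: "open N" "?K b \<subseteq> N" "TC N \<le> TC (?K b)" by (rule TC_open_neighbourhood)
    obtain \<epsilon> E h where \<epsilon>: "\<epsilon> > 0" and E: "open E" "sublevel F (b + \<epsilon>) - N \<subseteq> E"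
      and h: "continuous_on (E \<times> {0..1::real}) h" "\<And>x. x \<in> E \<Longrightarrow> h (x, 0) = x"
        "\<And>x. x \<in> E \<Longrightarrow> F (h (x, 1)) < b - \<epsilon>"
      using level_deformation[OF ps assms(5) N(1,2)] by metis
    have "TC (sublevel F (b + \<epsilon>) - N) \<le> TC (sublevel F (b - \<epsilon>))"
      by (rule TC_homotopy[OF assms(1) E h(1,2)]) (use E(2) h(3) in \<open>auto simp: sublevel_def less_imp_le\<close>)
    moreover have "TC N \<le> s b"
    proof -
      have "TC (?K b) \<le> (SUP C\<in>components (?K b). TC C)"
        by (rule TC_compact_le_components[OF pdist.Hausdorff compact_critical_level[OF ps]])
      then show ?thesis using N(3) unfolding s_def critical_components_def by (rule order_trans[rotated])
    qed
    moreover have "TC (sublevel F (b + \<epsilon>)) \<le> TC ((sublevel F (b + \<epsilon>) - N) \<union> N)"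
      by (rule TC_mono) auto
    ultimately have "TC (sublevel F (b + \<epsilon>)) \<le> TC (sublevel F (b - \<epsilon>)) + s b"
      using TC_Un[of "sublevel F (b + \<epsilon>) - N" N] by (meson add_mono order_trans)
    then show "\<exists>\<epsilon>>0. TC (sublevel F (b + \<epsilon>)) \<le> TC (sublevel F (b - \<epsilon>)) + s b" using \<epsilon> by blast
  qed (rule fin)
  also have "{\<mu> \<in> ?T. \<mu> \<le> a} = ?T" by auto
  also have "sum s ?T = infsum s ?T" using fin by simp
  \<comment> \<open>The sum over the half-line has only finitely many nonzero terms, all at critical
    values.\<close>
  also have "\<dots> = infsum s {..a}"
    by (rule infsum_cong_neutral) (auto intro: s0)
  finally show "TC (sublevel F a) \<le> (\<Sum>\<^sub>\<infinity>\<mu>\<in>{..a}. SUP C\<in>critical_components (power_atlas X) F \<mu>. TC C)"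
    unfolding s_def .
qed

end
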